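(* Let $f\in L^2$ be regular. The following three conditions are equivalent. (i) (Martingale-coboundary decomposition in $L^2$.) There exist functions $g_S\in L^2$, $S\subset\{1,\dots,d\}$, with $g_S\in\bigcap_{q\in S}\big(L^2(\mathcal F_0^{(q)})\ominus L^2(\mathcal F_{-1}^{(q)})\big)$, such that $$f=\sum_{S\subset\{1,\dots,d\}}\ \prod_{q\in S^c}(I-U_{\epsilon_q})\,g_S .$$ (ii) For every $S\subset\{1,\dots,d\}$ and every $S'\subset S^c$, $$\sum_{j_u\ge 1,\,u\in S'}\ \sum_{j_v\ge 1,\,v\in S^c\setminus S'}\Big\|\sum_{i_r\in\mathbb Z,\,r\in S}\ \sum_{i_u\ge j_u,\,u\in S'}\ \sum_{i_v\ge j_v,\,v\in S^c\setminus S'}P_{\underline 0}\,U_{(i_r,\,i_u,\,-i_v)}f\Big\|_2^2<\infty .$$ (iii) $$\sum_{S\subset\{1,\dots,d\}}\ \sum_{j_k\ge 0,\,k\in S}\ \sum_{j_l\le 0,\,l\in S^c}\Big\|\sum_{i_k\ge j_k,\,k\in S}\ \sum_{i_l\le j_l,\,l\in S^c}P_{\underline 0}\,U_{i_1,\dots,i_d}f\Big\|_2^2<\infty .$$ Moreover, if these conditions hold, then the functions $g_S$ in (i) can be chosen regular, and in that case, for every $S\subset\{1,\dots,d\}$, $$g_S=\sum_{S'\subset S^c}(-1)^{|S^c\setminus S'|}\sum_{i_r\in\mathbb Z,\,r\in S}\ \sum_{j_u\ge 1,\,i_u\ge 0,\,u\in S'}\ \sum_{j_v\ge 0,\,i_v\ge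 1,\,v\in S^c\setminus S'}P_{(0,\,-j_u,\,j_v)}\,U_{(i_r,\,i_u,\,-i_v)}f .$$
   Context: Let $d\ge1$, let $(\Omega,\mathcal A,\mu)$ be a probability space and $(T_{\underline i})_{\underline i\in\mathbb Z^d}$ a $\mathbb Z^d$-action on it generated by commuting invertible measure-preserving transformations $T_{\epsilon_1},\dots,T_{\epsilon_d}$, where $\epsilon_q\in\mathbb Z^d$ has $1$ at the $q$-th place and $0$ elsewhere. $U_{\underline i}f=f\circ T_{\underline i}$. $I$ is the identity operator, an empty product of operators is $I$, $S^c=\{1,\dots,d\}\setminus S$, $\underline 0=(0,\dots,0)$, and $\underline i\le\underline j$ means $i_q\le j_q$ for all $q$. Functions are real-valued. There is a completely commuting filtration $(\mathcal F_{\underline j})_{\underline j\in\mathbb Z^d}$: there is a sub-$\sigma$-algebra $\mathcal F\subset\mathcal A$ with $\mathcal F_{\underline i}=T_{-\underline i}\mathcal F$ for all $\underline i$; $\mathcal F_{\underline i}\subset\mathcal F_{\underline j}$ if $\underline i\le\underline j$; and for every integrable $f$, $E\big(E(f|\mathcal F_{i_1,\dots,i_d})\,|\,\mathcal F_{j_1,\dots,j_d}\big)=E(f|\mathcal F_{i_1\wedge j_1,\dots,i_d\wedge j_d})$. $\mathcal F_l^{(q)}$ is the $\sigma$-algebra generated by all $\mathcal F_{\underline i}$ with $i_q\le l$; $\mathcal F_{-\infty}^{(q)}=\bigcap_{k}\mathcal F_{-k}^{(q)}$; $\mathcal F_{\underline\infty}$ is the $\sigma$-algebra generated by all $\mathcal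 F_{\underline i}$. For $\sigma$-algebras $\mathcal G\subset\mathcal H$, $L^p(\mathcal H)\ominus L^p(\mathcal G)=\{h\in L^p(\mathcal H):E(h|\mathcal G)=0\}$. $P_l^{(q)}f=E(f|\mathcal F_l^{(q)})-E(f|\mathcal F_{l-1}^{(q)})$; these operators commute, and $P_{j_1,\dots,j_d}=P_{j_1}^{(1)}\cdots P_{j_d}^{(d)}$. An integrable function $f$ is regular if it is $\mathcal F_{\underline\infty}$-measurable and $E(f|\mathcal F_{-\infty}^{(q)})=0$ for every $1\le q\le d$. For $S\subset\{1,\dots,d\}$, $S'\subset S^c$: $U_{(i_r,\,i_u,\,-i_v)}$ denotes $U_{\underline k}$ with $k_r=i_r$ for $r\in S$, $k_u=i_u$ for $u\in S'$, $k_v=-i_v$ for $v\in S^c\setminus S'$; $P_{(0,\,-j_u,\,j_v)}$ denotes $P_{\underline k}$ with $k_r=0$ for $r\in S$, $k_u=-j_u$ for $u\in S'$, $k_v=j_v$ for $v\in S^c\setminus S'$. Infinite series of functions converge in $L^2$; multiple series over the indices $i$ are read as iterated series (one index after another), and in two-sided series both ends tend to infinity independently. In (ii) and (iii), convergence of the inner series is part of the condition; in the formula for $g_S$ one sums over the indices $i$ for fixed $j$'s, and then over the $j$'s. *)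

theory Defs
  imports "HOL-Probability.Probability"
begin

text \<open>
  The index set \<open>{1, \<dots>, d}\<close> is a type \<open>'d\<close> of sort \<open>{finite, linorder}\<close>, so that multi-indices are
  elements of \<open>int ^ 'd\<close> and the unit vector \<open>\<epsilon>\<^sub>q\<close> is \<^term>\<open>axis q 1 :: int ^ 'd\<close>. A
  \<open>\<sigma>\<close>-algebra is represented by a measure of which only the space and the sets matter.
\<close>

section \<open>Square-integrable functions and \<open>L\<^sup>2\<close>-convergence\<close>

definition L2 :: "'a measure \<Rightarrow> ('a \<Rightarrow> real) set" where
  "L2 M = {f \<in> borel_measurable M. integrable M (\<lambda>x. (f x)\<^sup>2)}"

text \<open>
  Meaningful on \<^term>\<open>L2 M\<close> only: the Bochner integral of a non-integrable function is \<open>0\<close>.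
  The notions of convergence below therefore demand membership in \<^term>\<open>L2 M\<close>.
\<close>
definition l2norm :: "'a measure \<Rightarrow> ('a \<Rightarrow> real) \<Rightarrow> real" where
  "l2norm M f = sqrt (\<integral>x. (f x)\<^sup>2 \<partial>M)"

definition ae_measurable :: "'a measure \<Rightarrow> 'a measure \<Rightarrow> ('a \<Rightarrow> real) \<Rightarrow> bool" where
  "ae_measurable M G f \<longleftrightarrow> (\<exists>h \<in> borel_measurable G. AE x in M. f x = h x)"

text \<open>\<open>L\<^sup>2(H) \<ominus> L\<^sup>2(G)\<close> as a subspace of \<open>L\<^sup>2(M)\<close>, functions being identified up to null sets of \<open>M\<close>.\<close>
definition L2_minus :: "'a measure \<Rightarrow> 'a measure \<Rightarrow> 'a measure \<Rightarrow> ('a \<Rightarrow> real) set" where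
  "L2_minus M H G =
     {h \<in> L2 M. ae_measurable M H h \<and> (AE x in M. real_cond_exp M G h x = 0)}"

text \<open>
  \<open>s\<close> is the \<open>L\<^sup>2\<close>-sum of the \<open>t i\<close>, \<open>i \<in> A\<close>, where the lower and the upper end of the range of
  summation tend to \<open>-\<infinity>\<close> and \<open>\<infinity>\<close> independently. For \<open>A = {j..}\<close> and \<open>A = {..j}\<close> this is
  ordinary convergence of a one-sided series.
\<close>
definition l2_sums :: "'a measure \<Rightarrow> int set \<Rightarrow> (int \<Rightarrow> 'a \<Rightarrow> real) \<Rightarrow> ('a \<Rightarrow> real) \<Rightarrow> bool" where
  "l2_sums M A t s \<longleftrightarrow> (\<forall>i\<in>A. t i \<in> L2 M) \<and> s \<in> L2 M \<and>
     ((\<lambda>(m, n). l2norm M (\<lambda>x. (\<Sum>i \<in> A \<inter> {m..n}. t i x) - s x)) \<longlongrightarrow> 0) (at_bot \<times>\<^sub>F at_top)"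

definition l2_has_sum :: "'a measure \<Rightarrow> ('i \<Rightarrow> 'a \<Rightarrow> real) \<Rightarrow> 'i set \<Rightarrow> ('a \<Rightarrow> real) \<Rightarrow> bool" where
  "l2_has_sum M t J s \<longleftrightarrow> (\<forall>j\<in>J. t j \<in> L2 M) \<and> s \<in> L2 M \<and>
     ((\<lambda>K. l2norm M (\<lambda>x. (\<Sum>j \<in> K. t j x) - s x)) \<longlongrightarrow> 0) (finite_subsets_at_top J)"

text \<open>
  \<open>iter_sums M A a qs k s\<close>: the iterated \<open>L\<^sup>2\<close>-series of \<open>a i\<close> converges to \<open>s\<close>, where the
  components \<open>i $ q\<close> with \<open>q\<close> in the list \<open>qs\<close> are summed over \<open>A q\<close> (the head of the list being
  the outermost sum) and the other components are those of \<open>k\<close>.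
\<close>
primrec iter_sums ::
  "'a measure \<Rightarrow> ('d::finite \<Rightarrow> int set) \<Rightarrow> (int ^ 'd \<Rightarrow> 'a \<Rightarrow> real) \<Rightarrow> 'd list \<Rightarrow> int ^ 'd \<Rightarrow> ('a \<Rightarrow> real) \<Rightarrow> bool"
where
  "iter_sums M A a [] k s \<longleftrightarrow> s \<in> L2 M \<and> (AE x in M. s x = a k x)"
| "iter_sums M A a (q # qs) k s \<longleftrightarrow>
     (\<exists>t. (\<forall>i \<in> A q. iter_sums M A a qs (\<chi> p. if p = q then i else k $ p) (t i)) \<and> l2_sums M (A q) t s)"

text \<open>All components are summed, in the order given by \<open>qs\<close>; the start vector \<open>0\<close> is immaterial.\<close>
definition multi_sums ::
  "'a measure \<Rightarrow> 'd::finite list \<Rightarrow> ('d \<Rightarrow> int set) \<Rightarrow> (int ^ 'd \<Rightarrow> 'a \<Rightarrow> real) \<Rightarrow> ('a \<Rightarrow> real) \<Rightarrow> bool" where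
  "multi_sums M qs A a s \<longleftrightarrow> iter_sums M A a qs 0 s"

section \<open>Completely commuting filtrations\<close>

definition zd_action :: "'a measure \<Rightarrow> (int ^ 'd \<Rightarrow> 'a \<Rightarrow> 'a) \<Rightarrow> bool" where
  "zd_action M T \<longleftrightarrow>
     (\<forall>x \<in> space M. T 0 x = x) \<and>
     (\<forall>i j. \<forall>x \<in> space M. T (i + j) x = T i (T j x)) \<and>
     (\<forall>i. T i \<in> M \<rightarrow>\<^sub>M M \<and> distr M M (T i) = M)"

definition Uop :: "(int ^ 'd \<Rightarrow> 'a \<Rightarrow> 'a) \<Rightarrow> int ^ 'd \<Rightarrow> ('a \<Rightarrow> real) \<Rightarrow> 'a \<Rightarrow> real" where
  "Uop T i f = (\<lambda>x. f (T i x))"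

text \<open>\<open>\<F>\<^sub>i = T\<^sub>-\<^sub>i \<F>\<close>; the system of images is already a \<open>\<sigma>\<close>-algebra.\<close>
definition Filt :: "'a measure \<Rightarrow> (int ^ 'd \<Rightarrow> 'a \<Rightarrow> 'a) \<Rightarrow> 'a measure \<Rightarrow> int ^ 'd \<Rightarrow> 'a measure" where
  "Filt M T F i = sigma (space M) ((\<lambda>B. T (- i) ` B) ` sets F)"

definition Filt_dir ::
  "'a measure \<Rightarrow> (int ^ 'd \<Rightarrow> 'a \<Rightarrow> 'a) \<Rightarrow> 'a measure \<Rightarrow> 'd \<Rightarrow> int \<Rightarrow> 'a measure" where
  "Filt_dir M T F q l = sigma (space M) (\<Union>i \<in> {i. i $ q \<le> l}. sets (Filt M T F i))"

definition Filt_dir_minf :: "'a measure \<Rightarrow> (int ^ 'd \<Rightarrow> 'a \<Rightarrow> 'a) \<Rightarrow> 'a measure \<Rightarrow> 'd \<Rightarrow> 'a measure" where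
  "Filt_dir_minf M T F q = sigma (space M) (\<Inter>k::nat. sets (Filt_dir M T F q (- int k)))"

definition Filt_inf :: "'a measure \<Rightarrow> (int ^ 'd \<Rightarrow> 'a \<Rightarrow> 'a) \<Rightarrow> 'a measure \<Rightarrow> 'a measure" where
  "Filt_inf M T F = sigma (space M) (\<Union>i. sets (Filt M T F i))"

locale completely_commuting_filtration = prob_space M
  for M :: "'a measure" +
  fixes T :: "int ^ 'd::{finite,linorder} \<Rightarrow> 'a \<Rightarrow> 'a" and F :: "'a measure"
  assumes action: "zd_action M T"
    and subalg: "subalgebra M F"
    and Filt_mono: "i \<le> j \<Longrightarrow> sets (Filt M T F i) \<subseteq> sets (Filt M T F j)"
    and commuting: "integrable M h \<Longrightarrow>
      AE x in M. real_cond_exp M (Filt M T F j) (real_cond_exp M (Filt M T F i) h) x =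
                 real_cond_exp M (Filt M T F (\<chi> q. min (i $ q) (j $ q))) h x"

definition regular :: "'a measure \<Rightarrow> (int ^ 'd \<Rightarrow> 'a \<Rightarrow> 'a) \<Rightarrow> 'a measure \<Rightarrow> ('a \<Rightarrow> real) \<Rightarrow> bool" where
  "regular M T F f \<longleftrightarrow> integrable M f \<and> ae_measurable M (Filt_inf M T F) f \<and>
     (\<forall>q. AE x in M. real_cond_exp M (Filt_dir_minf M T F q) f x = 0)"

section \<open>Projections and the three conditions\<close>

text \<open>The product (composition) of the operators \<open>L q\<close>, \<open>q \<in> Q\<close>, with increasing \<open>q\<close> from left to right.\<close>
definition op_prod :: "('d::{finite,linorder} \<Rightarrow> 'b \<Rightarrow> 'b) \<Rightarrow> 'd set \<Rightarrow> 'b \<Rightarrow> 'b" where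
  "op_prod L Q = foldr L (sorted_list_of_set Q)"

definition Proj1 ::
  "'a measure \<Rightarrow> (int ^ 'd \<Rightarrow> 'a \<Rightarrow> 'a) \<Rightarrow> 'a measure \<Rightarrow> 'd \<Rightarrow> int \<Rightarrow> ('a \<Rightarrow> real) \<Rightarrow> 'a \<Rightarrow> real" where
  "Proj1 M T F q l h = (\<lambda>x. real_cond_exp M (Filt_dir M T F q l) h x
                           - real_cond_exp M (Filt_dir M T F q (l - 1)) h x)"

definition Proj ::
  "'a measure \<Rightarrow> (int ^ 'd::{finite,linorder} \<Rightarrow> 'a \<Rightarrow> 'a) \<Rightarrow> 'a measure \<Rightarrow>
   int ^ 'd::{finite,linorder} \<Rightarrow> ('a \<Rightarrow> real) \<Rightarrow> 'a \<Rightarrow> real"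
where
  "Proj M T F k = op_prod (\<lambda>q. Proj1 M T F q (k $ q)) UNIV"

definition I_minus_U :: "(int ^ 'd \<Rightarrow> 'a \<Rightarrow> 'a) \<Rightarrow> 'd \<Rightarrow> ('a \<Rightarrow> real) \<Rightarrow> 'a \<Rightarrow> real" where
  "I_minus_U T q h = (\<lambda>x. h x - Uop T (axis q 1) h x)"

definition mc_decomposition ::
  "'a measure \<Rightarrow> (int ^ 'd::{finite,linorder} \<Rightarrow> 'a \<Rightarrow> 'a) \<Rightarrow> 'a measure \<Rightarrow> ('a \<Rightarrow> real) \<Rightarrow> ('d set \<Rightarrow> 'a \<Rightarrow> real) \<Rightarrow> bool"
where
  "mc_decomposition M T F f g \<longleftrightarrow>
     (\<forall>S. g S \<in> L2 M \<and> (\<forall>q\<in>S. g S \<in> L2_minus M (Filt_dir M T F q 0) (Filt_dir M T F q (- 1)))) \<and>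
     (AE x in M. f x = (\<Sum>S\<in>UNIV. op_prod (I_minus_U T) (- S) (g S) x))"

text \<open>
  The multi-index \<open>(i\<^sub>r, i\<^sub>u, -i\<^sub>v)\<close> with \<open>r \<in> S\<close>, \<open>u \<in> S'\<close>, \<open>v \<in> - S - S'\<close>, and the multi-index
  \<open>(0, -j\<^sub>u, j\<^sub>v)\<close>.
\<close>
definition idx_U :: "'d set \<Rightarrow> 'd set \<Rightarrow> int ^ 'd \<Rightarrow> int ^ 'd" where
  "idx_U S S' i = (\<chi> q. if q \<in> S \<union> S' then i $ q else - (i $ q))"

definition idx_P :: "'d set \<Rightarrow> 'd set \<Rightarrow> int ^ 'd \<Rightarrow> int ^ 'd" where
  "idx_P S S' j = (\<chi> q. if q \<in> S then 0 else if q \<in> S' then - (j $ q) else j $ q)"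

text \<open>
  In the next definitions a family \<open>(j\<^sub>q)\<close>, \<open>q \<in> - S\<close>, is encoded as a vector whose components in \<open>S\<close>
  vanish; \<open>ord\<close> lists all components in the order in which those of \<open>i\<close> are summed,
  outermost first.
\<close>

definition condition_ii ::
  "('d set \<Rightarrow> 'd set \<Rightarrow> 'd list) \<Rightarrow> 'a measure \<Rightarrow> (int ^ 'd::{finite,linorder} \<Rightarrow> 'a \<Rightarrow> 'a) \<Rightarrow> 'a measure \<Rightarrow>
   ('a \<Rightarrow> real) \<Rightarrow> bool"
where
  "condition_ii ord M T F f \<longleftrightarrow> (\<forall>S S'. S' \<subseteq> - S \<longrightarrow>
     (let J = {j. (\<forall>r\<in>S. j $ r = 0) \<and> (\<forall>q\<in>- S. j $ q \<ge> 1)} in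
      \<exists>b. (\<forall>j\<in>J. multi_sums M (ord S S')
                    (\<lambda>q. if q \<in> S then UNIV else {j $ q ..})
                    (\<lambda>i. Proj M T F 0 (Uop T (idx_U S S' i) f)) (b j)) \<and>
          (\<lambda>j. (l2norm M (b j))\<^sup>2) summable_on J))"

definition condition_iii ::
  "('d set \<Rightarrow> 'd set \<Rightarrow> 'd list) \<Rightarrow> 'a measure \<Rightarrow> (int ^ 'd::{finite,linorder} \<Rightarrow> 'a \<Rightarrow> 'a) \<Rightarrow> 'a measure \<Rightarrow>
   ('a \<Rightarrow> real) \<Rightarrow> bool"
where
  "condition_iii ord M T F f \<longleftrightarrow>
     (let J = (\<lambda>S. {j. (\<forall>k\<in>S. j $ k \<ge> 0) \<and> (\<forall>l\<in>- S. j $ l \<le> 0)}) in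
      \<exists>b. (\<forall>S. \<forall>j\<in>J S. multi_sums M (ord S (- S))
                    (\<lambda>q. if q \<in> S then {j $ q ..} else {.. j $ q})
                    (\<lambda>i. Proj M T F 0 (Uop T i f)) (b S j)) \<and>
          (\<lambda>(S, j). (l2norm M (b S j))\<^sup>2) summable_on (SIGMA S:UNIV. J S))"

text \<open>The series representation of \<open>g\<^sub>S\<close>, including the convergence of all series involved.\<close>
definition g_formula ::
  "('d set \<Rightarrow> 'd set \<Rightarrow> 'd list) \<Rightarrow> 'a measure \<Rightarrow> (int ^ 'd::{finite,linorder} \<Rightarrow> 'a \<Rightarrow> 'a) \<Rightarrow> 'a measure \<Rightarrow>
   ('a \<Rightarrow> real) \<Rightarrow> 'd set \<Rightarrow> ('a \<Rightarrow> real) \<Rightarrow> bool"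
where
  "g_formula ord M T F f S gS \<longleftrightarrow>
     (\<exists>G. (\<forall>S'. S' \<subseteq> - S \<longrightarrow>
            (let J = {j. (\<forall>r\<in>S. j $ r = 0) \<and> (\<forall>u\<in>S'. j $ u \<ge> 1) \<and> (\<forall>v\<in>- S - S'. j $ v \<ge> 0)} in
             \<exists>h. (\<forall>j\<in>J. multi_sums M (ord S S')
                          (\<lambda>q. if q \<in> S then UNIV else if q \<in> S' then {0..} else {1..})
                          (\<lambda>i. Proj M T F (idx_P S S' j) (Uop T (idx_U S S' i) f)) (h j)) \<and>
                 l2_has_sum M h J (G S'))) \<and>
          (AE x in M. gS x = (\<Sum>S'\<in>Pow (- S). (- 1) ^ card (- S - S') * G S' x)))"

end

theory Submission
  imports Defs
begin

text \<open>
  A regular function \<open>f\<close> is the orthogonal sum of the \<open>P\<^sub>k f\<close>, hence is encoded by its coefficients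
  \<open>a(k) = U\<^sub>-\<^sub>k P\<^sub>k f = P\<^sub>0 U\<^sub>-\<^sub>k f\<close>, a square-summable family with values in the range of \<open>P\<^sub>0\<close>, and every such
  family occurs. In these terms \<open>U\<close> at \<open>\<epsilon>\<^sub>q\<close> is the shift in the coordinate \<open>q\<close>, a function in
  \<open>L\<^sup>2(F\<^sub>0) \<ominus> L\<^sup>2(F\<^sub>-\<^sub>1)\<close> of the direction \<open>q\<close> has coefficients supported on \<open>k\<^sub>q = 0\<close>, and (i) says that
  \<open>a = \<Sum>\<^sub>S \<Prod>\<^bsub>q\<notin>S\<^esub> (1 - shift\<^sub>q) b\<^sub>S\<close> with \<open>b\<^sub>S\<close> square-summable and supported on \<open>k\<^sub>S = 0\<close>. Telescoping
  then evaluates the iterated sums of \<open>a\<close> over half-lines, in any order, as single values of the \<open>b\<^sub>S\<close>; this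
  gives (ii), (iii) and the formula for \<open>g\<^sub>S\<close>. Conversely the \<open>b\<^sub>S\<close> are read off from the sums in (ii) or (iii).

  To calculate with vectors of a type, \<open>L\<^sup>2\<close> modulo null sets is embedded isometrically into a Banach space
  of bounded functions.
\<close>

text \<open>In one coordinate let \<open>c(k)\<close> be the sum of \<open>a\<close> over the ray
  from \<open>k\<close> away from the origin. Outward differences of \<open>c\<close> give back
  \<open>a\<close>. They are differences in a fixed direction except where the rays at -1 and 0
  meet; there the total \<open>c(0) + c(-1)\<close> splits off as the martingale part, while
  \<open>c\<close>, negated and moved by one on the nonnegative side, is the transfer function. In d
  coordinates this splitting is multiplied out, which produces the sum over \<open>S\<close>. The
  obstacle is that the order of summation may depend on \<open>S\<close> and \<open>S'\<close>, and
  sums that need not converge absolutely cannot be interchanged. In (iii) sums are subtracted only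
  inside one quadrant, where the order is constant; quadrants are combined by algebra alone. In (ii)
  the half-lines omit 0, so values of \<open>a\<close> on coordinate hyperplanes enter only through
  sums over whole lines. There the \<open>b_S\<close> are defined from the given sums, and
  \<open>a = decomp b\<close> is a uniqueness statement. Coefficients see only the regular part of a
  function, so an arbitrary decomposition leads to one with regular \<open>g_S\<close>.\<close>

definition upd :: "int ^ 'd \<Rightarrow> 'd \<Rightarrow> int \<Rightarrow> int ^ 'd" where
  "upd k q i = (\<chi> p. if p = q then i else k $ p)"

lemma upd_nth: "upd k q i $ p = (if p = q then i else k $ p)"
  by (simp add: upd_def)

lemma upd_same [simp]: "upd k q i $ q = i"
  and upd_other [simp]: "p \<noteq> q \<Longrightarrow> upd k q i $ p = k $ p"
  and upd_upd [simp]: "upd (upd k q i) q j = upd k q j"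
  and upd_triv [simp]: "upd k q (k $ q) = k"
  by (simp_all add: vec_eq_iff upd_nth)

lemma upd_commute: "p \<noteq> q \<Longrightarrow> upd (upd k q i) p j = upd (upd k p j) q i"
  by (simp add: vec_eq_iff upd_nth)

lemma upd_eq_iff: "upd k q i = upd k' q j \<longleftrightarrow> i = j \<and> (\<forall>p. p \<noteq> q \<longrightarrow> k $ p = k' $ p)"
  by (auto simp: vec_eq_iff upd_nth)

section \<open>Iterated series in a normed space\<close>

text \<open>Normed-space counterpart of \<open>l2_sums\<close>, as \<open>niter\<close> below is
  that of \<open>iter_sums\<close>. With vectors instead of functions there are no null sets to
  carry along, and sums are unique.\<close>

definition nsums :: "int set \<Rightarrow> (int \<Rightarrow> 'x::real_normed_vector) \<Rightarrow> 'x \<Rightarrow> bool" where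
  "nsums A t s \<longleftrightarrow> ((\<lambda>p. \<Sum>i \<in> A \<inter> {fst p..snd p}. t i) \<longlongrightarrow> s) (at_bot \<times>\<^sub>F at_top)"

primrec niter :: "('d \<Rightarrow> int set) \<Rightarrow> (int ^ 'd \<Rightarrow> 'x::real_normed_vector) \<Rightarrow> 'd list \<Rightarrow> int ^ 'd \<Rightarrow> 'x \<Rightarrow> bool"
where
  "niter A a [] k s \<longleftrightarrow> s = a k"
| "niter A a (q # qs) k s \<longleftrightarrow>
     (\<exists>t. (\<forall>i \<in> A q. niter A a qs (upd k q i) (t i)) \<and> nsums (A q) t s)"

lemma bot_top_nontrivial [simp]: "(at_bot :: int filter) \<times>\<^sub>F (at_top :: int filter) \<noteq> bot"
  by (simp add: prod_filter_eq_bot)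

lemma nsums_unique: "nsums A t s \<Longrightarrow> nsums A t s' \<Longrightarrow> s = s'"
  unfolding nsums_def by (rule tendsto_unique[OF bot_top_nontrivial])

lemma nsums_cong:
  assumes "\<And>i. i \<in> A \<Longrightarrow> t i = t' i"
  shows "nsums A t s \<longleftrightarrow> nsums A t' s"
proof -
  have "(\<lambda>p. \<Sum>i \<in> A \<inter> {fst p..snd p}. t i) = (\<lambda>p. \<Sum>i \<in> A \<inter> {fst p..snd p}. t' i)"
    using assms by (intro ext sum.cong) auto
  then show ?thesis unfolding nsums_def by simp
qed

lemma nsums_0: "nsums A (\<lambda>_. 0) 0"
  by (simp add: nsums_def)

lemma nsums_add: "nsums A t s \<Longrightarrow> nsums A t' s' \<Longrightarrow> nsums A (\<lambda>i. t i + t' i) (s + s')"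
  unfolding nsums_def by (drule (1) tendsto_add) (simp add: sum.distrib)

lemma nsums_diff: "nsums A t s \<Longrightarrow> nsums A t' s' \<Longrightarrow> nsums A (\<lambda>i. t i - t' i) (s - s')"
  unfolding nsums_def by (drule (1) tendsto_diff) (simp add: sum_subtractf)

lemma eventually_bot_top: "eventually (\<lambda>p. fst p \<le> (a::int) \<and> (b::int) \<le> snd p) ((at_bot :: int filter) \<times>\<^sub>F at_top)"
  using eventually_prodI[OF eventually_le_at_bot[of a] eventually_ge_at_top[of b]] .

lemma nsums_eventually:
  assumes "\<And>m n. m \<le> a \<Longrightarrow> b \<le> n \<Longrightarrow> (\<Sum>i \<in> A \<inter> {m..n}. t i) = S m n"
    and "((\<lambda>p. S (fst p) (snd p)) \<longlongrightarrow> s) (at_bot \<times>\<^sub>F at_top)"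
  shows "nsums A t s"
  unfolding nsums_def using assms(2)
  by (rule Lim_transform_eventually)
    (rule eventually_mono[OF eventually_bot_top[of a b]], auto simp: assms(1))

lemma nsums_single:
  assumes "\<And>i. i \<in> A \<Longrightarrow> i \<noteq> n \<Longrightarrow> t i = 0"
  shows "nsums A t (if n \<in> A then t n else 0)"
proof (rule nsums_eventually[of n n])
  fix m l assume "m \<le> n" "n \<le> l"
  then show "(\<Sum>i \<in> A \<inter> {m..l}. t i) = (\<lambda>_ _. if n \<in> A then t n else 0) m l"
    using assms by (subst sum.mono_neutral_right[of _ "A \<inter> {n}"]) auto
qed auto

lemma nsums_insert:
  assumes "nsums A t s" "n \<notin> A"
  shows "nsums (insert n A) t (t n + s)"
proof (rule nsums_eventually[of n n])
  fix m l assume "m \<le> n" "n \<le> l"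
  then have "insert n A \<inter> {m..l} = insert n (A \<inter> {m..l})" by auto
  then show "(\<Sum>i \<in> insert n A \<inter> {m..l}. t i) = t n + (\<Sum>i \<in> A \<inter> {m..l}. t i)"
    using assms(2) by simp
next
  show "((\<lambda>p. t n + (\<Sum>i \<in> A \<inter> {fst p..snd p}. t i)) \<longlongrightarrow> t n + s) (at_bot \<times>\<^sub>F at_top)"
    using tendsto_add[OF tendsto_const[of "t n"] assms(1)[unfolded nsums_def]] .
qed

lemma niter_unique: "niter A a qs k s \<Longrightarrow> niter A a qs k s' \<Longrightarrow> s = s'"
proof (induction qs arbitrary: k s s')
  case (Cons q qs)
  from Cons.prems obtain t t' where "\<forall>i \<in> A q. niter A a qs (upd k q i) (t i)" "nsums (A q) t s"
    "\<forall>i \<in> A q. niter A a qs (upd k q i) (t' i)" "nsums (A q) t' s'" by auto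
  moreover from this have "t i = t' i" if "i \<in> A q" for i
    using Cons.IH[of "upd k q i" "t i" "t' i"] that by blast
  then have "nsums (A q) t s' = nsums (A q) t' s'"
    by (rule nsums_cong)
  ultimately show ?case using nsums_unique[of "A q" t s s'] by simp
qed simp

lemma niter_cong:
  "(\<And>q. q \<in> set qs \<Longrightarrow> A q = A' q) \<Longrightarrow> niter A a qs k s \<longleftrightarrow> niter A' a qs k s"
  by (induction qs arbitrary: k s) auto

lemma niter_0: "niter A (\<lambda>_. 0) qs k 0"
  by (induction qs arbitrary: k) (auto intro!: exI[of _ "\<lambda>_. 0"] nsums_0)

lemma niter_add:
  "niter A a qs k s \<Longrightarrow> niter A b qs k s' \<Longrightarrow> niter A (\<lambda>i. a i + b i) qs k (s + s')"
proof (induction qs arbitrary: k s s')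
  case (Cons q qs)
  from Cons.prems obtain t t' where t: "\<forall>i \<in> A q. niter A a qs (upd k q i) (t i)" "nsums (A q) t s"
    "\<forall>i \<in> A q. niter A b qs (upd k q i) (t' i)" "nsums (A q) t' s'" by auto
  have "\<forall>i \<in> A q. niter A (\<lambda>i. a i + b i) qs (upd k q i) (t i + t' i)"
    using Cons.IH t(1,3) by blast
  then show ?case using nsums_add[OF t(2,4)] unfolding niter.simps
    by (intro exI[of _ "\<lambda>i. t i + t' i"] conjI)
qed simp

lemma niter_diff:
  "niter A a qs k s \<Longrightarrow> niter A b qs k s' \<Longrightarrow> niter A (\<lambda>i. a i - b i) qs k (s - s')"
proof (induction qs arbitrary: k s s')
  case (Cons q qs)
  from Cons.prems obtain t t' where t: "\<forall>i \<in> A q. niter A a qs (upd k q i) (t i)" "nsums (A q) t s"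
    "\<forall>i \<in> A q. niter A b qs (upd k q i) (t' i)" "nsums (A q) t' s'" by auto
  have "\<forall>i \<in> A q. niter A (\<lambda>i. a i - b i) qs (upd k q i) (t i - t' i)"
    using Cons.IH t(1,3) by blast
  then show ?case using nsums_diff[OF t(2,4)] unfolding niter.simps
    by (intro exI[of _ "\<lambda>i. t i - t' i"] conjI)
qed simp

lemma niter_sum:
  "finite I \<Longrightarrow> (\<And>x. x \<in> I \<Longrightarrow> niter A (a x) qs k (s x)) \<Longrightarrow>
    niter A (\<lambda>i. \<Sum>x\<in>I. a x i) qs k (\<Sum>x\<in>I. s x)"
  by (induction I rule: finite_induct) (auto simp: niter_0 intro: niter_add)

text \<open>The term at \<open>n\<close> is met at an intermediate stage only if the coordinates
  fixed so far are those of \<open>n\<close>. The \<open>if\<close> records this and becomes trivial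
  once the list contains every coordinate.\<close>

lemma niter_single:
  assumes "\<And>i. i \<noteq> n \<Longrightarrow> (\<And>p. i $ p \<in> A p) \<Longrightarrow> a i = 0" "\<And>p. n $ p \<in> A p" "distinct qs"
    "\<And>p. p \<notin> set qs \<Longrightarrow> k $ p \<in> A p"
  shows "niter A a qs k (if \<forall>p. p \<notin> set qs \<longrightarrow> k $ p = n $ p then a n else 0)"
  using assms(3,4)
proof (induction qs arbitrary: k)
  case Nil
  then show ?case using assms(1)[of k] by (auto simp: vec_eq_iff[symmetric])
next
  case (Cons q qs)
  let ?s = "\<lambda>k. if \<forall>p. p \<notin> set qs \<longrightarrow> k $ p = n $ p then a n else 0"
  have "niter A a qs (upd k q i) (?s (upd k q i))" if "i \<in> A q" for i
    by (rule Cons.IH) (use Cons.prems that in \<open>auto simp: upd_nth\<close>)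
  moreover have "nsums (A q) (\<lambda>i. ?s (upd k q i)) (if n $ q \<in> A q then ?s (upd k q (n $ q)) else 0)"
    using Cons.prems(1) by (intro nsums_single) auto
  moreover have "(if n $ q \<in> A q then ?s (upd k q (n $ q)) else 0) =
      (if \<forall>p. p \<notin> set (q # qs) \<longrightarrow> k $ p = n $ p then a n else 0)"
  proof -
    have "(\<forall>p. p \<notin> set qs \<longrightarrow> upd k q (n $ q) $ p = n $ p) \<longleftrightarrow>
        (\<forall>p. p \<notin> set (q # qs) \<longrightarrow> k $ p = n $ p)"
      by (auto simp: upd_nth)
    then show ?thesis using assms(2)[of q] by simp
  qed
  ultimately show ?case unfolding niter.simps by (intro exI[of _ "\<lambda>i. ?s (upd k q i)"]) simp
qed

text \<open>Both series are summed in the same order. At the level of \<open>q\<close> their inner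
  sums coincide by uniqueness, so the outer series differ by the term at \<open>n\<close> alone; at
  the other levels one subtracts termwise.\<close>

lemma niter_remove:
  assumes "niter A1 a qs k s1" "niter A2 a qs k s2" "distinct qs" "q \<in> set qs"
    and "\<And>p. p \<noteq> q \<Longrightarrow> A1 p = A p \<and> A2 p = A p" "A1 q = insert n (A2 q)" "n \<notin> A2 q" "A q = {n}"
  shows "niter A a qs k (s1 - s2)"
  using assms(1-4)
proof (induction qs arbitrary: k s1 s2)
  case (Cons p qs)
  from Cons.prems obtain t1 t2 where t: "\<forall>i \<in> A1 p. niter A1 a qs (upd k p i) (t1 i)" "nsums (A1 p) t1 s1"
    "\<forall>i \<in> A2 p. niter A2 a qs (upd k p i) (t2 i)" "nsums (A2 p) t2 s2" by auto
  show ?case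
  proof (cases "p = q")
    case True
    have "A1 x = A x \<and> A2 x = A x" if "x \<in> set qs" for x
      using assms(5)[of x] Cons.prems(3) True that by auto
    then have cong: "niter A1 a qs = niter A a qs" "niter A2 a qs = niter A a qs"
      by (auto intro!: ext niter_cong)
    have "t2 i = t1 i" if "i \<in> A2 q" for i
      by (rule niter_unique[of A a qs "upd k q i"])
        (use t(1,3) assms(6) that in \<open>simp_all add: cong True\<close>)
    then have "nsums (A2 q) t2 s2 = nsums (A2 q) t1 s2" by (rule nsums_cong)
    with t(4) have "nsums (A2 q) t1 s2" using True by simp
    from nsums_insert[OF this assms(7)] have "nsums (A1 q) t1 (t1 n + s2)"
      by (simp only: assms(6))
    then have "s1 = t1 n + s2" using t(2) nsums_unique[of "A1 q" t1 s1] True by simp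
    moreover have "nsums {n} t1 (t1 n)" using nsums_single[of "{n}" n t1] by simp
    moreover have "niter A a qs (upd k q n) (t1 n)" using t(1) assms(6) by (simp add: cong True)
    ultimately show ?thesis unfolding niter.simps True assms(8) by (intro exI[of _ t1]) simp
  next
    case False
    then have [simp]: "A1 p = A p" "A2 p = A p" using assms(5) by auto
    have "niter A a qs (upd k p i) (t1 i - t2 i)" if "i \<in> A p" for i
      by (rule Cons.IH) (use Cons.prems(3,4) t False that in auto)
    moreover have "nsums (A p) (\<lambda>i. t1 i - t2 i) (s1 - s2)"
      using t by (intro nsums_diff) simp_all
    ultimately show ?thesis unfolding niter.simps by (intro exI[of _ "\<lambda>i. t1 i - t2 i"]) simp
  qed
qed simp

text \<open>\<open>L q\<close> produces the terms to be summed in direction \<open>q\<close>, and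
  \<open>V q\<close> gives their sum. \<open>C q\<close> is what this summation requires of a
  family, and it must survive the operators of the other directions. Since operators of different
  directions commute, \<open>L q\<close> can be pulled out of the inner sums before the outer one is
  taken.\<close>

lemma niter_foldr:
  assumes "distinct qs"
    and sums: "\<And>q c k. q \<in> set qs \<Longrightarrow> c \<in> C q \<Longrightarrow> nsums (A q) (\<lambda>i. L q c (upd k q i)) (V q c k)"
    and "\<And>p q c. p \<noteq> q \<Longrightarrow> c \<in> C q \<Longrightarrow> V p c \<in> C q"
    and "\<And>p q c. p \<noteq> q \<Longrightarrow> c \<in> C q \<Longrightarrow> L p c \<in> C q"
    and "\<And>p q c. p \<noteq> q \<Longrightarrow> L p (L q c) = L q (L p c)"
    and "\<And>p q c. p \<noteq> q \<Longrightarrow> V p (L q c) = L q (V p c)"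
  shows "(\<And>q. q \<in> set qs \<Longrightarrow> c \<in> C q) \<Longrightarrow> niter A (foldr L qs c) qs k (foldr V qs c k)"
  using assms(1,2)
proof (induction qs arbitrary: c k)
  case (Cons q qs)
  have comm: "L q (foldr L qs c) = foldr L qs (L q c)" if "q \<notin> set qs" for qs and c
    using that by (induction qs) (auto simp: assms(5))
  have commV: "foldr V qs (L q c) = L q (foldr V qs c)" if "q \<notin> set qs" for qs and c
    using that by (induction qs) (auto simp: assms(6))
  have VC: "foldr V qs c \<in> C q" if "q \<notin> set qs" "c \<in> C q" for qs and c
    using that by (induction qs) (auto simp: assms(3))
  have "niter A (foldr L qs (L q c)) qs (upd k q i) (foldr V qs (L q c) (upd k q i))" for i
  proof (rule Cons.IH)
    fix p assume "p \<in> set qs"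
    with Cons.prems(1)[of p] Cons.prems(2) show "L q c \<in> C p"
      by (intro assms(4)) auto
  qed (use Cons.prems in auto)
  then have "niter A (foldr L (q # qs) c) qs (upd k q i) (L q (foldr V qs c) (upd k q i))" for i
    using Cons.prems(2) by (simp add: comm commV)
  moreover have "nsums (A q) (\<lambda>i. L q (foldr V qs c) (upd k q i)) (V q (foldr V qs c) k)"
    using Cons.prems by (intro Cons.prems(3) VC) auto
  moreover have "foldr V (q # qs) c = V q (foldr V qs c)" by simp
  ultimately show ?case unfolding niter.simps
    by (intro exI[of _ "\<lambda>i. L q (foldr V qs c) (upd k q i)"]) simp
qed simp

section \<open>Products of commuting operators in a prescribed order\<close>

lemma foldr_perm:
  assumes "\<And>p q. p \<noteq> q \<Longrightarrow> f p \<circ> f q = f q \<circ> f p" and "mset xs = mset ys"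
  shows "foldr f xs = foldr f ys"
proof -
  have "fold f (rev xs) = fold f (rev ys)"
  proof (rule fold_multiset_equiv)
    show "f x \<circ> f y = f y \<circ> f x" for x y using assms(1)[of x y] by (cases "x = y") auto
  qed (use assms(2) in simp)
  then show ?thesis by (simp add: foldr_conv_fold)
qed

lemma foldr_if_id: "foldr (\<lambda>q. if q \<in> S then id else f q) qs = foldr f (filter (\<lambda>q. q \<notin> S) qs)"
  by (induction qs) auto

text \<open>\<open>op_prod\<close> multiplies in increasing order, whereas a series is summed in the
  order of \<open>qs\<close>. Commutation lets the product follow the list, with \<open>id\<close>
  as filler so that each summation has its own factor.\<close>

lemma op_prod_eq_foldr:
  fixes f :: "'d::{finite,linorder} \<Rightarrow> 'b \<Rightarrow> 'b"
  assumes "\<And>p q. p \<noteq> q \<Longrightarrow> f p \<circ> f q = f q \<circ> f p" and "distinct qs" "set qs = UNIV"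
  shows "op_prod f (- S) = foldr (\<lambda>q. if q \<in> S then id else f q) qs"
  unfolding op_prod_def foldr_if_id
proof (rule foldr_perm[OF assms(1)])
  have "set_mset (mset (sorted_list_of_set (- S))) = set_mset (mset (filter (\<lambda>q. q \<notin> S) qs))"
    using assms(3) by auto
  then show "mset (sorted_list_of_set (- S)) = mset (filter (\<lambda>q. q \<notin> S) qs)"
    using assms(2,3) by (subst set_eq_iff_mset_eq_distinct[symmetric]) auto
qed

text \<open>For \<open>e = -1\<close> the substitution exchanges the two ends of the window, which
  is harmless because they tend to infinity independently.\<close>

lemma nsums_affine:
  assumes "nsums ((\<lambda>i. e * i + c) ` A) t s" and e: "e = 1 \<or> e = -1"
  shows "nsums A (\<lambda>i. t (e * i + c)) s"
proof -
  define r where "r = (\<lambda>p. if e = 1 then (fst p + c, snd p + c) else (c - snd p, c - fst p))"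
  have shift: "filterlim (\<lambda>i. i + c) at_bot at_bot" "filterlim (\<lambda>i. i + c) at_top at_top"
    "filterlim (\<lambda>i. c - i) at_top at_bot" "filterlim (\<lambda>i. c - i) at_bot at_top" for c :: int
    unfolding filterlim_at_top filterlim_at_bot eventually_at_bot_linorder eventually_at_top_linorder
    by presburger+
  have r: "filterlim r (at_bot \<times>\<^sub>F at_top) (at_bot \<times>\<^sub>F at_top)"
    using e unfolding r_def
    by (auto intro!: filterlim_Pair filterlim_compose[OF shift(1) filterlim_fst]
      filterlim_compose[OF shift(2) filterlim_snd]
      filterlim_compose[OF shift(3) filterlim_fst] filterlim_compose[OF shift(4) filterlim_snd])
  have "(\<Sum>i \<in> (\<lambda>i. e * i + c) ` A \<inter> {fst (r p)..snd (r p)}. t i) =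
      (\<Sum>i \<in> A \<inter> {fst p..snd p}. t (e * i + c))" for p
    using e by (intro sum.reindex_bij_witness[of _ "\<lambda>i. e * i + c" "\<lambda>i. e * (i - c)"])
      (auto simp: r_def)
  then show ?thesis
    using filterlim_compose[OF assms(1)[unfolded nsums_def] r] by (simp add: nsums_def)
qed

lemma niter_affine:
  assumes "niter (\<lambda>q. (\<lambda>i. e q * i + c q) ` A q) a qs (\<chi> q. e q * k $ q + c q) s"
    and e: "\<And>q. e q = 1 \<or> e q = -1"
  shows "niter A (\<lambda>i. a (\<chi> q. e q * i $ q + c q)) qs k s"
  using assms(1)
proof (induction qs arbitrary: k s)
  case (Cons q qs)
  then obtain t where t: "\<forall>i \<in> (\<lambda>i. e q * i + c q) ` A q.
      niter (\<lambda>q. (\<lambda>i. e q * i + c q) ` A q) a qs (upd (\<chi> q. e q * k $ q + c q) q i) (t i)"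
    "nsums ((\<lambda>i. e q * i + c q) ` A q) t s"
    by auto
  have *: "upd (\<chi> q. e q * k $ q + c q) q (e q * i + c q) = (\<chi> p. e p * upd k q i $ p + c p)" for i
    by (simp add: vec_eq_iff upd_nth)
  have "\<forall>i \<in> A q. niter A (\<lambda>i. a (\<chi> q. e q * i $ q + c q)) qs (upd k q i) (t (e q * i + c q))"
    using t(1) by (intro ballI Cons.IH) (auto simp flip: *)
  moreover have "nsums (A q) (\<lambda>i. t (e q * i + c q)) s"
    by (rule nsums_affine[OF t(2) e])
  ultimately show ?case unfolding niter.simps by (intro exI[of _ "\<lambda>i. t (e q * i + c q)"]) simp
qed simp

section \<open>Sums of differences over half-lines\<close>

definition diffq :: "'d \<Rightarrow> (int ^ 'd \<Rightarrow> 'x::real_normed_vector) \<Rightarrow> int ^ 'd \<Rightarrow> 'x" where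
  "diffq q c = (\<lambda>k. c k - c (upd k q (k $ q - 1)))"

lemma diffq_commute: "p \<noteq> q \<Longrightarrow> diffq p (diffq q c) = diffq q (diffq p c)"
  by (simp add: diffq_def fun_eq_iff upd_commute[of p q])

datatype halfline = All | Ge int | Le int

fun index_set :: "halfline \<Rightarrow> int set" where
  "index_set All = UNIV" | "index_set (Ge n) = {n..}" | "index_set (Le n) = {..n}"

text \<open>What telescoping leaves at the finite end; a lower end \<open>n\<close> contributes the
  value one step before it.\<close>

fun bdry :: "halfline \<Rightarrow> (int \<Rightarrow> 'x::real_normed_vector) \<Rightarrow> 'x" where
  "bdry All c = 0" | "bdry (Ge n) c = - c (n - 1)" | "bdry (Le n) c = c n"

lemma sum_int_telescope:
  fixes c :: "int \<Rightarrow> 'x::real_normed_vector"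
  shows "m \<le> n \<Longrightarrow> (\<Sum>i = m..n. c i - c (i - 1)) = c n - c (m - 1)"
proof (induction n rule: int_ge_induct)
  case (step n)
  then have "{m..n + 1} = insert (n + 1) {m..n}" by auto
  with step show ?case by simp
qed simp

lemma nsums_telescope:
  assumes "(c \<longlongrightarrow> 0) at_top" "(c \<longlongrightarrow> 0) at_bot"
  shows "nsums (index_set h) (\<lambda>i. c i - c (i - 1)) (bdry h c)"
proof -
  have up: "((\<lambda>p. c (snd p)) \<longlongrightarrow> 0) (at_bot \<times>\<^sub>F at_top)"
    by (rule filterlim_compose[OF assms(1) filterlim_snd])
  have "filterlim (\<lambda>i::int. i - 1) at_bot at_bot"
    unfolding filterlim_at_bot eventually_at_bot_linorder by presburger
  then have "((\<lambda>i. c (i - 1)) \<longlongrightarrow> 0) at_bot"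
    by (rule filterlim_compose[OF assms(2)])
  then have down: "((\<lambda>p. c (fst p - 1)) \<longlongrightarrow> 0) (at_bot \<times>\<^sub>F at_top)"
    by (rule filterlim_compose[OF _ filterlim_fst])
  show ?thesis
  proof (cases h)
    case All
    show ?thesis unfolding All index_set.simps bdry.simps
    proof (rule nsums_eventually[of 0 0])
      fix m n :: int assume "m \<le> 0" "0 \<le> n"
      then show "(\<Sum>i\<in>UNIV \<inter> {m..n}. c i - c (i - 1)) = c n - c (m - 1)"
        by (simp add: sum_int_telescope)
    qed (use tendsto_diff[OF up down] in simp)
  next
    case (Ge l)
    show ?thesis unfolding Ge index_set.simps bdry.simps
    proof (rule nsums_eventually[of l l])
      fix m n :: int assume "m \<le> l" "l \<le> n"
      moreover from this have "{l..} \<inter> {m..n} = {l..n}" by auto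
      ultimately show "(\<Sum>i\<in>{l..} \<inter> {m..n}. c i - c (i - 1)) = c n - c (l - 1)"
        by (simp add: sum_int_telescope)
    qed (use tendsto_diff[OF up tendsto_const[of "c (l - 1)"]] in simp)
  next
    case (Le l)
    show ?thesis unfolding Le index_set.simps bdry.simps
    proof (rule nsums_eventually[of l l])
      fix m n :: int assume "m \<le> l" "l \<le> n"
      moreover from this have "{..l} \<inter> {m..n} = {m..l}" by auto
      ultimately show "(\<Sum>i\<in>{..l} \<inter> {m..n}. c i - c (i - 1)) = c l - c (m - 1)"
        by (simp add: sum_int_telescope)
    qed (use tendsto_diff[OF tendsto_const[of "c l"] down] in simp)
  qed
qed

definition sqsum :: "('i \<Rightarrow> 'x::real_normed_vector) \<Rightarrow> bool" where
  "sqsum c \<longleftrightarrow> (\<lambda>k. (norm (c k))\<^sup>2) summable_on UNIV"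

lemma tendsto_int_at_top:
  assumes "(\<lambda>n::nat. f (int n)) \<longlonglongrightarrow> L"
  shows "(f \<longlongrightarrow> L) at_top"
proof -
  have "filterlim nat sequentially at_top"
    unfolding filterlim_at_top eventually_at_top_linorder by (metis nat_int nat_mono)
  with assms have "((\<lambda>i. f (int (nat i))) \<longlongrightarrow> L) at_top" by (rule filterlim_compose)
  then show ?thesis
    by (rule Lim_transform_eventually) (auto intro: eventually_mono[OF eventually_ge_at_top[of 0]])
qed

lemma summable_on_int_tendsto:
  fixes g :: "int \<Rightarrow> real"
  assumes "g summable_on UNIV"
  shows "(g \<longlongrightarrow> 0) at_top"
proof -
  have "g summable_on range int"
    using assms by (rule summable_on_subset) auto
  then have "(g \<circ> int) summable_on UNIV"
    by (subst (asm) summable_on_reindex) auto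
  then have "(\<lambda>n. g (int n)) \<longlonglongrightarrow> 0"
    by (intro summable_LIMSEQ_zero summable_on_imp_summable) (simp add: comp_def)
  then show ?thesis by (rule tendsto_int_at_top)
qed

text \<open>On a coordinate line the squared norms are a subfamily of a summable family. This decay
  is all that telescoping asks for.\<close>

lemma sqsum_tendsto:
  assumes "sqsum c"
  shows "((\<lambda>i. c (upd k q i)) \<longlongrightarrow> 0) at_top" "((\<lambda>i. c (upd k q i)) \<longlongrightarrow> 0) at_bot"
proof -
  have *: "((\<lambda>i. c (upd k q (e * i))) \<longlongrightarrow> 0) at_top" if "e \<noteq> 0" for e
  proof -
    have "inj (\<lambda>i. upd k q (e * i))" using that by (auto simp: inj_def upd_eq_iff)
    moreover have "(\<lambda>k. (norm (c k))\<^sup>2) summable_on range (\<lambda>i. upd k q (e * i))"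
      using assms[unfolded sqsum_def] by (rule summable_on_subset) auto
    ultimately have "((\<lambda>k. (norm (c k))\<^sup>2) \<circ> (\<lambda>i. upd k q (e * i))) summable_on UNIV"
      by (subst (asm) summable_on_reindex) auto
    from summable_on_int_tendsto[OF this] have "((\<lambda>i. (norm (c (upd k q (e * i))))\<^sup>2) \<longlongrightarrow> 0) at_top"
      by (simp add: comp_def)
    from tendsto_real_sqrt[OF this] show ?thesis
      by (simp add: tendsto_norm_zero_iff)
  qed
  show "((\<lambda>i. c (upd k q i)) \<longlongrightarrow> 0) at_top" using *[of 1] by simp
  show "((\<lambda>i. c (upd k q i)) \<longlongrightarrow> 0) at_bot"
    using *[of "-1"] by (simp add: at_bot_mirror filterlim_filtermap)
qed

text \<open>In the directions of \<open>S\<close> the family is supported at 0. Off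
  \<open>S\<close>, a range \<open>All\<close> has weight 0, so its point 0 is a dummy
  value.\<close>

definition point :: "'d set \<Rightarrow> ('d \<Rightarrow> halfline) \<Rightarrow> 'd \<Rightarrow> int" where
  "point S h q = (if q \<in> S then 0 else case h q of All \<Rightarrow> 0 | Ge n \<Rightarrow> n - 1 | Le n \<Rightarrow> n)"

text \<open>
  The iterated sum of \<open>op_prod diffq (- S) c\<close> over a product of half-lines is a single value of \<open>c\<close>, at
  \<^term>\<open>point S h\<close>, up to the factor \<open>\<Prod>\<^sub>q weight S h q \<in> {- 1, 0, 1}\<close>.
\<close>
definition weight :: "'d set \<Rightarrow> ('d \<Rightarrow> halfline) \<Rightarrow> 'd \<Rightarrow> real" where
  "weight S h q = (if q \<in> S then (if 0 \<in> index_set (h q) then 1 else 0)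
     else case h q of All \<Rightarrow> 0 | Ge n \<Rightarrow> -1 | Le n \<Rightarrow> 1)"

definition point_sum :: "'d set \<Rightarrow> ('d \<Rightarrow> halfline) \<Rightarrow> 'd \<Rightarrow> (int ^ 'd \<Rightarrow> 'x::real_normed_vector) \<Rightarrow> int ^ 'd \<Rightarrow> 'x" where
  "point_sum S h q c = (\<lambda>k. weight S h q *\<^sub>R c (upd k q (point S h q)))"

lemma foldr_point_sum:
  "distinct qs \<Longrightarrow> foldr (point_sum S h) qs c k =
     (\<Prod>q\<in>set qs. weight S h q) *\<^sub>R c (\<chi> p. if p \<in> set qs then point S h p else k $ p)"
proof (induction qs arbitrary: k)
  case (Cons q qs)
  moreover have "(\<chi> p. if p \<in> set qs then point S h p else upd k q (point S h q) $ p) =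
      (\<chi> p. if p \<in> set (q # qs) then point S h p else k $ p)"
    by (simp add: vec_eq_iff upd_nth)
  ultimately show ?case by (simp add: point_sum_def)
qed simp

definition vanishing_off :: "'d set \<Rightarrow> (int ^ 'd \<Rightarrow> 'x::real_normed_vector) \<Rightarrow> bool" where
  "vanishing_off S c \<longleftrightarrow> (\<forall>k. (\<exists>q\<in>S. k $ q \<noteq> 0) \<longrightarrow> c k = 0)"

lemma niter_diffs:
  fixes c :: "int ^ 'd::{finite,linorder} \<Rightarrow> 'x::real_normed_vector"
  assumes "distinct qs" "set qs = UNIV" "sqsum c" "vanishing_off S c"
  shows "niter (\<lambda>q. index_set (h q)) (op_prod diffq (- S) c) qs k
    ((\<Prod>q\<in>UNIV. weight S h q) *\<^sub>R c (\<chi> q. point S h q))"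
proof -
  let ?L = "\<lambda>q. if q \<in> S then id else diffq q"
  \<comment> \<open>In a direction of \<open>S\<close> the support at 0 makes the sum trivial; in
    the others decay along lines makes it telescope. Decay along single lines is easily carried
    through the operators of the other directions.\<close>
  define C where "C q = {c :: int ^ 'd::{finite,linorder} \<Rightarrow> 'x. if q \<in> S then (\<forall>k. k $ q \<noteq> 0 \<longrightarrow> c k = 0)
      else (\<forall>k. ((\<lambda>i. c (upd k q i)) \<longlongrightarrow> 0) at_top \<and> ((\<lambda>i. c (upd k q i)) \<longlongrightarrow> 0) at_bot)}" for q
  have "niter (\<lambda>q. index_set (h q)) (foldr ?L qs c) qs k (foldr (point_sum S h) qs c k)"
  proof (rule niter_foldr[where C = C])
    fix q c k assume c: "c \<in> C q"
    show "nsums (index_set (h q)) (\<lambda>i. ?L q c (upd k q i)) (point_sum S h q c k)"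
    proof (cases "q \<in> S")
      case True
      have "nsums (index_set (h q)) (\<lambda>i. c (upd k q i)) (if 0 \<in> index_set (h q) then c (upd k q 0) else 0)"
        using c True by (intro nsums_single) (auto simp: C_def)
      moreover have "(if 0 \<in> index_set (h q) then c (upd k q 0) else 0) = point_sum S h q c k"
        using True by (auto simp: point_sum_def weight_def point_def)
      ultimately show ?thesis using True by simp
    next
      case False
      then have "nsums (index_set (h q)) (\<lambda>i. c (upd k q i) - c (upd k q (i - 1))) (bdry (h q) (\<lambda>i. c (upd k q i)))"
        using c by (intro nsums_telescope) (auto simp: C_def)
      moreover have "bdry (h q) (\<lambda>i. c (upd k q i)) = point_sum S h q c k"
        using False by (cases "h q") (auto simp: point_sum_def weight_def point_def)
      ultimately show ?thesis using False by (simp add: diffq_def)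
    qed
  next
    fix p q :: "'d::{finite,linorder}" and c assume pq: "p \<noteq> q" and c: "c \<in> C q"
    have *: "(\<lambda>i. c (upd (upd k q i) p (g k))) = (\<lambda>i. c (upd (upd k p (g k)) q i))" for g k
      using pq by (simp add: upd_commute[of p q])
    have **: "((\<lambda>i. c (upd (upd k q i) p n)) \<longlongrightarrow> 0) F"
      if "q \<notin> S" "F = at_top \<or> F = at_bot" for k n F
      using c that pq by (auto simp: upd_commute[of p q] C_def)
    show "point_sum S h p c \<in> C q"
      using c pq tendsto_scaleR[OF tendsto_const[of "weight S h p"] **]
      by (auto simp: C_def point_sum_def split: if_splits)
    have "diffq p c \<in> C q"
      using c pq tendsto_diff[OF _ **] by (auto simp: C_def diffq_def split: if_splits)
    with c show "?L p c \<in> C q" by simp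
  next
    fix p q :: "'d::{finite,linorder}" and c :: "int ^ 'd::{finite,linorder} \<Rightarrow> 'x" assume "p \<noteq> q"
    then show "?L p (?L q c) = ?L q (?L p c)" by (auto simp: diffq_commute)
    from \<open>p \<noteq> q\<close> show "point_sum S h p (?L q c) = ?L q (point_sum S h p c)"
      by (auto simp: point_sum_def diffq_def fun_eq_iff upd_commute[of p q] scaleR_diff_right)
  next
    fix q
    show "c \<in> C q" using assms(3,4) sqsum_tendsto[of c] by (auto simp: C_def vanishing_off_def)
  qed fact+
  moreover have "op_prod diffq (- S) c = foldr ?L qs c"
    using assms(1,2) by (subst op_prod_eq_foldr[of diffq qs S]) (auto simp: fun_eq_iff[of "_ \<circ> _"] diffq_commute)
  ultimately show ?thesis using assms(1,2) by (simp add: foldr_point_sum)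
qed

text \<open>Condition (i) read on coefficients: \<open>diffq q\<close> corresponds to
  \<open>I - U\<close> at the unit vector of \<open>q\<close>.\<close>

definition decomp :: "('d::{finite,linorder} set \<Rightarrow> int ^ 'd::{finite,linorder} \<Rightarrow> 'x::real_normed_vector) \<Rightarrow> int ^ 'd::{finite,linorder} \<Rightarrow> 'x" where
  "decomp b = (\<lambda>k. \<Sum>S\<in>UNIV. op_prod diffq (- S) (b S) k)"

theorem niter_decomp:
  fixes b :: "'d::{finite,linorder} set \<Rightarrow> int ^ 'd::{finite,linorder} \<Rightarrow> 'x::real_normed_vector"
  assumes "distinct qs" "set qs = UNIV" "\<And>S. sqsum (b S)" "\<And>S. vanishing_off S (b S)"
  shows "niter (\<lambda>q. index_set (h q)) (decomp b) qs k
    (\<Sum>S\<in>UNIV. (\<Prod>q\<in>UNIV. weight S h q) *\<^sub>R b S (\<chi> q. point S h q))"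
  unfolding decomp_def by (rule niter_sum, simp, rule niter_diffs) (use assms in auto)

section \<open>Recovering the summands from the iterated series\<close>

text \<open>0 counts as nonnegative, so the rays at -1 and 0 partition the integers.\<close>

definition outer_ray :: "int \<Rightarrow> int set" where
  "outer_ray n = (if n < 0 then {..n} else {n..})"

text \<open>The ray at the new index is the old ray without its endpoint, and the sign pattern of
  the index is unchanged.\<close>

definition outward :: "'d \<Rightarrow> int ^ 'd \<Rightarrow> int ^ 'd" where
  "outward q k = upd k q (if k $ q < 0 then k $ q - 1 else k $ q + 1)"

definition outward_diff :: "'d \<Rightarrow> (int ^ 'd \<Rightarrow> 'x::real_normed_vector) \<Rightarrow> int ^ 'd \<Rightarrow> 'x" where
  "outward_diff q c = (\<lambda>k. c k - c (outward q k))"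

text \<open>Ranges of a partially differenced sum: whole lines on \<open>S\<close>, rays already cut
  down to their endpoint on \<open>Q\<close>, untouched rays elsewhere.\<close>

definition index_box :: "'d set \<Rightarrow> 'd set \<Rightarrow> int ^ 'd \<Rightarrow> 'd \<Rightarrow> int set" where
  "index_box S Q k = (\<lambda>q. if q \<in> S then UNIV else if q \<in> Q then {k $ q} else outer_ray (k $ q))"

text \<open>Each outward difference cuts a ray down to its endpoint by \<open>niter_remove\<close>.
  This compares sums taken in the same order, so \<open>r\<close> has to be constant along outward
  steps. \<open>D\<close> contains the base points at which the sums are known.\<close>

lemma niter_outward_diff:
  fixes c :: "int ^ 'd::finite \<Rightarrow> 'x::real_normed_vector"
  assumes ord: "\<And>k. distinct (r k)" "\<And>k. set (r k) = UNIV"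
    and out: "\<And>k q. k \<in> D \<Longrightarrow> q \<notin> S \<Longrightarrow> outward q k \<in> D \<and> r (outward q k) = r k"
    and base: "\<And>k. k \<in> D \<Longrightarrow> niter (index_box S {} k) a (r k) 0 (c k)"
    and "k \<in> D" "distinct Q" "set Q \<inter> S = {}"
  shows "niter (index_box S (set Q) k) a (r k) 0 (foldr outward_diff Q c k)"
  using assms(5-)
proof (induction Q arbitrary: k)
  case (Cons q Q)
  have q: "q \<notin> S" "q \<notin> set Q" using Cons.prems by auto
  have IH: "niter (index_box S (set Q) k) a (r k) 0 (foldr outward_diff Q c k)"
    "niter (index_box S (set Q) (outward q k)) a (r k) 0 (foldr outward_diff Q c (outward q k))"
    using Cons.IH[of k] Cons.IH[of "outward q k"] Cons.prems out[OF Cons.prems(1) q(1)] by auto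
  have "niter (index_box S (set (q # Q)) k) a (r k) 0 (foldr outward_diff Q c k - foldr outward_diff Q c (outward q k))"
    by (rule niter_remove[where q = q and n = "k $ q", OF IH])
      (use ord q in \<open>auto simp: index_box_def outward_def outer_ray_def\<close>)
  then show ?case using fun_cong[OF outward_diff_def[of q "foldr outward_diff Q c"], of k] by simp
qed (use base in simp)

text \<open>
  An outward difference splits as \<open>opW + diffq \<circ> opZ\<close>: \<open>opW\<close> collects the two half-line sums meeting at
  the origin (the martingale part in the direction \<open>q\<close>), \<open>opZ\<close> is the transfer function of the coboundary.
\<close>
definition opW :: "'d \<Rightarrow> (int ^ 'd \<Rightarrow> 'x::real_normed_vector) \<Rightarrow> int ^ 'd \<Rightarrow> 'x" where
  "opW q c = (\<lambda>k. (if k $ q = 0 then c k else 0) + (if k $ q = 0 then c (upd k q (-1)) else 0))"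

definition opZ :: "'d \<Rightarrow> (int ^ 'd \<Rightarrow> 'x::real_normed_vector) \<Rightarrow> int ^ 'd \<Rightarrow> 'x" where
  "opZ q c = (\<lambda>k. (if k $ q < 0 then c k else 0) - (if 0 \<le> k $ q then c (upd k q (k $ q + 1)) else 0))"

text \<open>The delicate case is \<open>k $ q = 0\<close>: there \<open>diffq\<close> crosses from 0
  to -1 and, in the coordinate \<open>q\<close>, gives \<open>- c(1) - c(-1)\<close>; adding
  \<open>c(0) + c(-1)\<close> leaves \<open>c(0) - c(1)\<close>.\<close>

lemma outward_diff_eq: "outward_diff q c k = opW q c k + diffq q (opZ q c) k"
  by (auto simp: outward_diff_def opW_def opZ_def diffq_def outward_def)

text \<open>The distributive law for operators, \<open>S\<close> being the set of directions in
  which \<open>W\<close> is chosen. The sums that arise are indexed by sets of directions, and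
  additivity is asked for these.\<close>

lemma foldr_add_expand:
  fixes W Y :: "'d \<Rightarrow> ('k \<Rightarrow> 'x::real_normed_vector) \<Rightarrow> 'k \<Rightarrow> 'x"
  assumes "\<And>q (I :: 'd set set) c. W q (\<lambda>k. \<Sum>x\<in>I. c x k) = (\<lambda>k. \<Sum>x\<in>I. W q (c x) k)"
    and "\<And>q (I :: 'd set set) c. Y q (\<lambda>k. \<Sum>x\<in>I. c x k) = (\<lambda>k. \<Sum>x\<in>I. Y q (c x) k)"
    and "distinct Q"
  shows "foldr (\<lambda>q c k. W q c k + Y q c k) Q c =
    (\<lambda>k. \<Sum>S\<in>Pow (set Q). foldr (\<lambda>q. if q \<in> S then W q else Y q) Q c k)"
  using assms(3)
proof (induction Q)
  case (Cons q Q)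
  let ?f = "\<lambda>S. foldr (\<lambda>q. if q \<in> S then W q else Y q)"
  have q: "q \<notin> set Q" using Cons.prems by simp
  have eq: "?f (insert q S) Q c = ?f S Q c" if "S \<subseteq> set Q" for S
    by (rule foldr_cong) (use q in auto)
  have "foldr (\<lambda>q c k. W q c k + Y q c k) (q # Q) c =
      (\<lambda>k. (\<Sum>S\<in>Pow (set Q). W q (?f S Q c) k) + (\<Sum>S\<in>Pow (set Q). Y q (?f S Q c) k))"
    using Cons by (simp add: assms(1,2))
  also have "\<dots> = (\<lambda>k. (\<Sum>S\<in>Pow (set Q). ?f (insert q S) (q # Q) c k) + (\<Sum>S\<in>Pow (set Q). ?f S (q # Q) c k))"
  proof (intro ext arg_cong2[where f = "(+)"] sum.cong refl)
    fix S assume "S \<in> Pow (set Q)"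
    then have "q \<notin> S" "S \<subseteq> set Q" using q by auto
    then show "W q (?f S Q c) k = ?f (insert q S) (q # Q) c k"
      "Y q (?f S Q c) k = ?f S (q # Q) c k" for k
      using eq[of S] by simp_all
  qed
  also have "\<dots> = (\<lambda>k. \<Sum>S\<in>Pow (set (q # Q)). ?f S (q # Q) c k)"
  proof
    fix k
    have "inj_on (insert q) (Pow (set Q))" using q by (auto intro!: inj_onI)
    moreover have "Pow (set Q) \<inter> insert q ` Pow (set Q) = {}" using q by auto
    ultimately show "(\<Sum>S\<in>Pow (set Q). ?f (insert q S) (q # Q) c k) + (\<Sum>S\<in>Pow (set Q). ?f S (q # Q) c k) =
        (\<Sum>S\<in>Pow (set (q # Q)). ?f S (q # Q) c k)"
      by (simp del: foldr.simps add: Pow_insert sum.union_disjoint sum.reindex)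
  qed
  finally show ?case .
qed simp

text \<open>Collects the differences in front, so that the rest of the product can serve as the
  family \<open>b S\<close> to which \<open>op_prod diffq\<close> is applied.\<close>

lemma foldr_comp_split:
  assumes "\<And>p q c. p \<noteq> q \<Longrightarrow> B p (L q c) = L q (B p c)" "distinct Q"
  shows "foldr (\<lambda>q. L q \<circ> B q) Q c = foldr L Q (foldr B Q c)"
  using assms(2)
proof (induction Q)
  case (Cons q Q)
  have "B q (foldr L Q d) = foldr L Q (B q d)" if "q \<notin> set Q" for Q d
    using that by (induction Q) (auto simp: assms(1))
  with Cons show ?case by simp
qed simp

lemma sqsum_add: "sqsum c \<Longrightarrow> sqsum d \<Longrightarrow> sqsum (\<lambda>k. c k + d k)"
  unfolding sqsum_def
proof (rule summable_on_comparison_test)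
  assume "(\<lambda>k. (norm (c k))\<^sup>2) summable_on UNIV" "(\<lambda>k. (norm (d k))\<^sup>2) summable_on UNIV"
  then show "(\<lambda>k. 2 * (norm (c k))\<^sup>2 + 2 * (norm (d k))\<^sup>2) summable_on UNIV"
    by (intro summable_on_add summable_on_cmult_right)
  fix k
  have "(norm (c k + d k))\<^sup>2 \<le> (norm (c k) + norm (d k))\<^sup>2"
    by (simp add: norm_triangle_ineq power_mono)
  also have "\<dots> \<le> 2 * (norm (c k))\<^sup>2 + 2 * (norm (d k))\<^sup>2"
    using zero_le_power2[of "norm (c k) - norm (d k)"] by (simp add: power2_eq_square algebra_simps)
  finally show "(norm (c k + d k))\<^sup>2 \<le> 2 * (norm (c k))\<^sup>2 + 2 * (norm (d k))\<^sup>2" .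
qed auto

lemma sqsum_minus: "sqsum c \<Longrightarrow> sqsum (\<lambda>k. - c k)"
  by (simp add: sqsum_def)

lemma sqsum_reindex:
  assumes "(\<lambda>k. (norm (c k))\<^sup>2) summable_on A" "inj_on \<phi> {k. P k}" "\<And>k. P k \<Longrightarrow> \<phi> k \<in> A"
  shows "sqsum (\<lambda>k. if P k then c (\<phi> k) else 0)"
proof -
  have "(\<lambda>k. (norm (c k))\<^sup>2) summable_on \<phi> ` {k. P k}"
    using assms(1) by (rule summable_on_subset) (use assms(3) in auto)
  then have "(\<lambda>k. (norm (c (\<phi> k)))\<^sup>2) summable_on {k. P k}"
    using assms(2) by (subst (asm) summable_on_reindex) (auto simp: comp_def)
  then show ?thesis unfolding sqsum_def
    by (rule summable_on_cong_neutral[THEN iffD1, rotated -1]) auto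
qed

lemma sqsum_sum: "finite I \<Longrightarrow> (\<And>x. x \<in> I \<Longrightarrow> sqsum (c x)) \<Longrightarrow> sqsum (\<lambda>k. \<Sum>x\<in>I. c x k)"
  by (induction I rule: finite_induct) (auto intro: sqsum_add simp: sqsum_def[of "\<lambda>_. 0"])

lemma upd_cancel: "upd k q i = upd l q j \<Longrightarrow> k $ q = l $ q \<Longrightarrow> k = l"
  by (metis upd_triv upd_upd)

lemma sqsum_opW:
  assumes "sqsum c" shows "sqsum (opW q c)"
proof -
  have "inj_on (\<lambda>k. upd k q (- 1)) {k. k $ q = 0}"
    by (rule inj_onI) (auto dest: upd_cancel)
  then show ?thesis
    unfolding opW_def using assms sqsum_reindex[of c UNIV "\<lambda>k. k" "\<lambda>k. k $ q = 0"]
      sqsum_reindex[of c UNIV "\<lambda>k. upd k q (- 1)" "\<lambda>k. k $ q = 0"]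
    by (intro sqsum_add) (simp_all add: sqsum_def)
qed

lemma sqsum_opZ:
  assumes "sqsum c" shows "sqsum (opZ q c)"
proof -
  have "inj_on (\<lambda>k. upd k q (k $ q + 1)) {k. 0 \<le> k $ q}"
  proof (rule inj_onI)
    fix k l assume eq: "upd k q (k $ q + 1) = upd l q (l $ q + 1)"
    have "k $ q = l $ q" using arg_cong[OF eq, of "\<lambda>v. v $ q"] by simp
    with eq show "k = l" by (rule upd_cancel)
  qed
  then show ?thesis
    unfolding opZ_def diff_conv_add_uminus using assms sqsum_reindex[of c UNIV "\<lambda>k. k" "\<lambda>k. k $ q < 0"]
      sqsum_reindex[of c UNIV "\<lambda>k. upd k q (k $ q + 1)" "\<lambda>k. 0 \<le> k $ q"]
    by (intro sqsum_add sqsum_minus) (simp_all add: sqsum_def)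
qed

text \<open>Outward differences in all directions turn \<open>c\<close> back into \<open>a\<close>.
  Replacing each by \<open>opW + diffq o opZ\<close> and multiplying out, the choice of
  \<open>opW\<close> on \<open>S\<close> and \<open>opZ\<close> off \<open>S\<close> defines
  \<open>b S\<close>. Values of \<open>c\<close> from different quadrants meet only in these finite
  combinations, never inside a series.\<close>

theorem decomp_of_quadrant_sums:
  fixes c :: "int ^ 'd::{finite,linorder} \<Rightarrow> 'x::real_normed_vector"
  assumes ord: "\<And>k. distinct (r k)" "\<And>k. set (r k) = UNIV"
    and out: "\<And>k q. r (outward q k) = r k"
    and base: "\<And>k. niter (index_box {} {} k) a (r k) 0 (c k)"
    and sq: "sqsum c" and V: "subspace V" "\<And>k. c k \<in> V"
  shows "\<exists>b. a = decomp b \<and> (\<forall>S. sqsum (b S) \<and> vanishing_off S (b S)) \<and> (\<forall>S k. b S k \<in> V)"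
proof -
  define Q where "Q = sorted_list_of_set (UNIV :: 'd::{finite,linorder} set)"
  have Q: "distinct Q" "set Q = UNIV" by (auto simp: Q_def)
  define b where "b S = foldr (\<lambda>q. if q \<in> S then opW q else opZ q) Q c" for S
  have lin: "opW q (\<lambda>k. \<Sum>x\<in>I. d x k) = (\<lambda>k. \<Sum>x\<in>I. opW q (d x) k)"
    "diffq q (opZ q (\<lambda>k. \<Sum>x\<in>I. d x k)) = (\<lambda>k. \<Sum>x\<in>I. diffq q (opZ q (d x)) k)"
    for q :: 'd and I :: "'d set set" and d :: "_ \<Rightarrow> _ \<Rightarrow> 'x"
    by (auto simp: opW_def diffq_def opZ_def fun_eq_iff sum.distrib sum_subtractf sum_negf)
  have comm: "opW p (diffq q d) = diffq q (opW p d)" "opZ p (diffq q d) = diffq q (opZ p d)"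
    if "p \<noteq> q" for p q :: 'd and d :: "_ \<Rightarrow> 'x"
    using that by (auto simp: opW_def opZ_def diffq_def fun_eq_iff upd_commute[of p q])
  have "a k = decomp b k" for k
  proof -
    have "niter (index_box {} UNIV k) a (r k) 0 (foldr outward_diff Q c k)"
      using niter_outward_diff[of r UNIV "{}" a c k Q] ord out base Q by auto
    \<comment> \<open>All ranges are now single points, so the series is just its term at
      \<open>k\<close>.\<close>
    moreover have "niter (index_box {} UNIV k) a (r k) 0 (a k)"
      using niter_single[of k "index_box {} UNIV k" a "r k" 0] ord by (auto simp: index_box_def vec_eq_iff)
    ultimately have "a k = foldr outward_diff Q c k" by (rule niter_unique[symmetric])
    also have "outward_diff = (\<lambda>q c k. opW q c k + (diffq q \<circ> opZ q) c k)"
      by (simp add: fun_eq_iff outward_diff_eq)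
    also have "foldr (\<lambda>q c k. opW q c k + (diffq q \<circ> opZ q) c k) Q c k =
        (\<Sum>S\<in>Pow (set Q). foldr (\<lambda>q. if q \<in> S then opW q else diffq q \<circ> opZ q) Q c k)"
      by (subst foldr_add_expand) (use Q lin in \<open>simp_all add: comp_def\<close>)
    also have "\<dots> = (\<Sum>S\<in>UNIV. op_prod diffq (- S) (b S) k)"
    proof (rule sum.cong)
      fix S :: "'d set"
      have "foldr (\<lambda>q. if q \<in> S then opW q else diffq q \<circ> opZ q) Q c =
          foldr (\<lambda>q. (if q \<in> S then id else diffq q) \<circ> (if q \<in> S then opW q else opZ q)) Q c"
        by (rule foldr_cong) auto
      also have "\<dots> = foldr (\<lambda>q. if q \<in> S then id else diffq q) Q (b S)"
        unfolding b_def by (rule foldr_comp_split) (use Q in \<open>auto simp: comm\<close>)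
      also have "\<dots> = op_prod diffq (- S) (b S)"
        using Q by (subst op_prod_eq_foldr[of diffq Q S]) (auto simp: fun_eq_iff[of "_ \<circ> _"] diffq_commute)
      finally show "foldr (\<lambda>q. if q \<in> S then opW q else diffq q \<circ> opZ q) Q c k =
        op_prod diffq (- S) (b S) k" by simp
    qed (use Q in auto)
    finally show ?thesis by (simp add: decomp_def)
  qed
  moreover have "sqsum (b S)" for S
  proof -
    have "sqsum (foldr (\<lambda>q. if q \<in> S then opW q else opZ q) Q c)" for Q
      by (induction Q) (auto intro: sqsum_opW sqsum_opZ sq)
    then show ?thesis by (simp add: b_def)
  qed
  moreover have "b S k \<in> V" for S k
  proof -
    have "foldr (\<lambda>q. if q \<in> S then opW q else opZ q) Q c k \<in> V" for Q
      by (induction Q arbitrary: k)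
        (auto simp: V opW_def opZ_def intro!: subspace_add[OF V(1)] subspace_diff[OF V(1)] subspace_0[OF V(1)] subspace_neg[OF V(1)])
    then show ?thesis by (simp add: b_def)
  qed
  moreover have "vanishing_off S (b S)" for S
  proof -
    have "foldr (\<lambda>q. if q \<in> S then opW q else opZ q) Q c k = 0"
      if "q \<in> S" "k $ q \<noteq> 0" "q \<in> set Q" for Q q k
      using that(2,3)
    proof (induction Q arbitrary: k)
      case (Cons p Q)
      show ?case
      proof (cases "p = q")
        case False
        then show ?thesis using Cons by (auto simp: opW_def opZ_def)
      qed (use \<open>q \<in> S\<close> Cons.prems in \<open>auto simp: opW_def\<close>)
    qed simp
    then show ?thesis using Q by (auto simp: b_def vanishing_off_def)
  qed
  ultimately show ?thesis by (intro exI[of _ b]) (auto simp: fun_eq_iff)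
qed

section \<open>Recovery from the tail sums of condition (ii)\<close>

definition neg_part :: "int ^ 'd \<Rightarrow> 'd set" where
  "neg_part k = {q. k $ q < 0}"

definition tail_index :: "'d set \<Rightarrow> (int ^ 'd) set" where
  "tail_index S = {j. (\<forall>r\<in>S. j $ r = 0) \<and> (\<forall>q\<in>- S. j $ q \<ge> 1)}"

definition tail_range :: "'d set \<Rightarrow> 'd set \<Rightarrow> int ^ 'd \<Rightarrow> 'd \<Rightarrow> halfline" where
  "tail_range S S' j q = (if q \<in> S then All else if q \<in> S' then Le (- (j $ q)) else Ge (j $ q))"

text \<open>Off \<open>S\<close>, a tail \<open>Le (- j)\<close> is evaluated at \<open>- j\<close>
  and a tail \<open>Ge j\<close> at \<open>j - 1\<close>. For \<open>j\<close> at least 1 these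
  points cover every integer exactly once, which is why the tails determine all values of
  \<open>b S\<close>.\<close>

definition tail_point :: "'d set \<Rightarrow> 'd set \<Rightarrow> int ^ 'd \<Rightarrow> int ^ 'd" where
  "tail_point S S' j = (\<chi> q. if q \<in> S then 0 else if q \<in> S' then - (j $ q) else j $ q - 1)"

text \<open>Only the summand of \<open>S\<close> survives. A direction in \<open>R\<close> but not
  in \<open>S\<close> is summed over a half-line missing 0, where \<open>b R\<close> is supported; a
  direction in \<open>S\<close> but not in \<open>R\<close> telescopes to 0 over the whole line.
  Each lower end contributes a factor -1.\<close>

lemma niter_decomp_tail:
  fixes b :: "'d::{finite,linorder} set \<Rightarrow> int ^ 'd::{finite,linorder} \<Rightarrow> 'x::real_normed_vector"
  assumes "distinct qs" "set qs = UNIV" "\<And>S. sqsum (b S)" "\<And>S. vanishing_off S (b S)"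
    and "S' \<subseteq> - S" "j \<in> tail_index S"
  shows "niter (\<lambda>q. index_set (tail_range S S' j q)) (decomp b) qs k
    ((- 1) ^ card (- S - S') *\<^sub>R b S (tail_point S S' j))"
proof -
  let ?h = "tail_range S S' j"
  have "(\<Prod>q\<in>UNIV. weight R ?h q) = 0" if "R \<noteq> S" for R
  proof -
    from that obtain q where "q \<in> R \<and> q \<notin> S \<or> q \<notin> R \<and> q \<in> S" by auto
    moreover have "1 \<le> j $ q" if "q \<notin> S" using assms(6) that by (auto simp: tail_index_def)
    ultimately have "weight R ?h q = 0" by (auto simp: weight_def tail_range_def)
    then show ?thesis by (intro prod_zero) auto
  qed
  then have "(\<Sum>R\<in>UNIV. (\<Prod>q\<in>UNIV. weight R ?h q) *\<^sub>R b R (\<chi> q. point R ?h q)) =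
      (\<Prod>q\<in>UNIV. weight S ?h q) *\<^sub>R b S (\<chi> q. point S ?h q)"
    by (subst sum.mono_neutral_right[of UNIV "{S}"]) auto
  moreover have "(\<Prod>q\<in>UNIV. weight S ?h q) = (\<Prod>q\<in>UNIV. if q \<in> - S - S' then -1 else 1)"
    by (intro prod.cong) (auto simp: weight_def tail_range_def)
  moreover have "(\<Prod>q\<in>UNIV. if q \<in> - S - S' then -1 else 1) = (-1 :: real) ^ card (- S - S')"
    by (subst prod.If_cases) (simp_all add: set_diff_eq)
  moreover have "(\<chi> q. point S ?h q) = tail_point S S' j"
    using assms(5) by (auto simp: vec_eq_iff point_def tail_range_def tail_point_def)
  ultimately show ?thesis using niter_decomp[OF assms(1-4), of ?h k] by simp
qed

lemma foldr_outward_diff_0: "foldr outward_diff Q (\<lambda>_. 0) = (\<lambda>_. 0)"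
  by (induction Q) (auto simp: outward_diff_def)

text \<open>
  Different boxes may be summed in different orders, so differences across boxes are not available; instead
  \<open>e\<close> vanishes by induction on the number of zero coordinates of \<open>k\<close>.
\<close>
lemma tail_sums_zero:
  fixes e :: "int ^ 'd::{finite,linorder} \<Rightarrow> 'x::real_normed_vector"
  assumes ord: "\<And>S S'. distinct (ord S S') \<and> set (ord S S') = UNIV"
    and zero: "\<And>S S' j. S' \<subseteq> - S \<Longrightarrow> j \<in> tail_index S \<Longrightarrow>
      niter (\<lambda>q. index_set (tail_range S S' j q)) e (ord S S') 0 0"
  shows "e k = 0"
proof (induction "card {q. k $ q = 0}" arbitrary: k rule: less_induct)
  case less
  define S where "S = {q. k $ q = 0}"
  \<comment> \<open>For base points that are nonzero off \<open>S\<close>, the outer rays are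
    exactly the half-lines occurring in the tail sums.\<close>
  define D where "D = {m :: int ^ 'd::{finite,linorder}. \<forall>q. q \<notin> S \<longrightarrow> m $ q \<noteq> 0}"
  define r where "r m = ord S (neg_part m - S)" for m
  obtain Q where Q: "distinct Q" "set Q = - S" using finite_distinct_list[of "- S"] by auto
  have "niter (index_box S (set Q) k) e (r k) 0 (foldr outward_diff Q (\<lambda>_. 0) k)"
  proof (rule niter_outward_diff[where D = D])
    fix m :: "int ^ 'd::{finite,linorder}" and q assume "m \<in> D" "q \<notin> S"
    moreover have "neg_part (outward q m) = neg_part m"
      by (auto simp: neg_part_def outward_def upd_nth split: if_splits)
    ultimately show "outward q m \<in> D \<and> r (outward q m) = r m"
      by (auto simp: D_def r_def outward_def upd_nth)
  next
    fix m assume m: "m \<in> D"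
    define j where "j = (\<chi> q. if q \<in> S then 0 else \<bar>m $ q\<bar>)"
    have "niter (\<lambda>q. index_set (tail_range S (neg_part m - S) j q)) e (r m) 0 0"
      unfolding r_def using m
      by (intro zero) (auto simp: tail_index_def j_def D_def int_one_le_iff_zero_less)
    moreover have "(\<lambda>q. index_set (tail_range S (neg_part m - S) j q)) = index_box S {} m"
      by (auto simp: fun_eq_iff tail_range_def index_box_def outer_ray_def j_def neg_part_def)
    ultimately show "niter (index_box S {} m) e (r m) 0 0" by simp
  qed (use ord Q in \<open>auto simp: r_def D_def S_def\<close>)
  moreover have "foldr outward_diff Q (\<lambda>_. 0) = (\<lambda>_. 0 :: 'x)"
    by (rule foldr_outward_diff_0)
  \<comment> \<open>The remaining indices agree with \<open>k\<close> off \<open>S\<close>, where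
    \<open>k\<close> is nonzero. Any of them other than \<open>k\<close> has strictly fewer zero
    coordinates, so its term vanishes by induction and only \<open>e k\<close> is left of the sum
    over whole lines.\<close>
  moreover have "niter (index_box S (set Q) k) e (r k) 0 (if \<forall>p. p \<notin> set (r k) \<longrightarrow> 0 $ p = k $ p then e k else 0)"
  proof (rule niter_single)
    fix i :: "int ^ 'd::{finite,linorder}" assume "i \<noteq> k" and i: "\<And>p. i $ p \<in> index_box S (set Q) k p"
    have off: "i $ p = k $ p" if "p \<notin> S" for p using i[of p] that Q by (auto simp: index_box_def)
    have "{q. i $ q = 0} \<subseteq> S"
    proof
      fix p assume "p \<in> {q. i $ q = 0}"
      then show "p \<in> S" using off[of p] by (cases "p \<in> S") (auto simp: S_def)
    qed
    moreover have "{q. i $ q = 0} \<noteq> S"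
    proof
      assume eq: "{q. i $ q = 0} = S"
      have "i $ p = k $ p" for p
        using off[of p] eq by (cases "p \<in> S") (auto simp: S_def)
      with \<open>i \<noteq> k\<close> show False by (simp add: vec_eq_iff)
    qed
    ultimately have "card {q. i $ q = 0} < card {q. k $ q = 0}"
      unfolding S_def by (intro psubset_card_mono) auto
    then show "e i = 0" by (rule less)
  qed (use ord Q in \<open>auto simp: r_def index_box_def\<close>)
  ultimately show ?case using ord niter_unique[of "index_box S (set Q) k" e "r k" 0 0 "e k"]
    by (auto simp: r_def)
qed

text \<open>\<open>niter_decomp_tail\<close> dictates the values of \<open>b S\<close>: they must be
  signed tail sums. With \<open>b\<close> defined in this way, \<open>a\<close> and
  \<open>decomp b\<close> have the same tail sums, and \<open>tail_sums_zero\<close> applies to the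
  difference.\<close>

theorem decomp_of_tail_sums:
  fixes a :: "int ^ 'd::{finite,linorder} \<Rightarrow> 'x::real_normed_vector"
  assumes ord: "\<And>S S'. distinct (ord S S') \<and> set (ord S S') = UNIV"
    and sums: "\<And>S S' j. S' \<subseteq> - S \<Longrightarrow> j \<in> tail_index S \<Longrightarrow>
      niter (\<lambda>q. index_set (tail_range S S' j q)) a (ord S S') 0 (\<beta> S S' j)"
    and sq: "\<And>S S'. S' \<subseteq> - S \<Longrightarrow> (\<lambda>j. (norm (\<beta> S S' j))\<^sup>2) summable_on tail_index S"
    and V: "subspace V" "\<And>S S' j. S' \<subseteq> - S \<Longrightarrow> j \<in> tail_index S \<Longrightarrow> \<beta> S S' j \<in> V"
  shows "\<exists>b. a = decomp b \<and> (\<forall>S. sqsum (b S) \<and> vanishing_off S (b S)) \<and> (\<forall>S k. b S k \<in> V)"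
proof -
  \<comment> \<open>Inverse of \<open>tail_point\<close>: off \<open>S\<close>, a negative
    coordinate comes from \<open>j = - k\<close> and a nonnegative one from
    \<open>j = k + 1\<close>.\<close>
  define jj where "jj S k = (\<chi> q. if q \<in> S then 0 else if k $ q < 0 then - (k $ q) else k $ q + 1)"
    for S and k :: "int ^ 'd::{finite,linorder}"
  define P where "P S S' k \<longleftrightarrow> (\<forall>q\<in>S. k $ q = 0) \<and> neg_part k = S'"
    for S S' and k :: "int ^ 'd::{finite,linorder}"
  define b where "b S k = (\<Sum>S'\<in>Pow (- S). if P S S' k then (- 1) ^ card (- S - S') *\<^sub>R \<beta> S S' (jj S k) else 0)"
    for S k
  have jj: "jj S k \<in> tail_index S" for S k
    by (auto simp: jj_def tail_index_def)
  have sqb: "sqsum (b S)" for S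
    unfolding b_def
  proof (intro sqsum_sum sqsum_reindex[where A = "tail_index S"])
    fix S' assume "S' \<in> Pow (- S)"
    then show "(\<lambda>j. (norm ((- 1) ^ card (- S - S') *\<^sub>R \<beta> S S' j))\<^sup>2) summable_on tail_index S"
      using sq[of S' S] by simp
    show "inj_on (jj S) {k. P S S' k}"
    proof (rule inj_onI)
      fix k l assume *: "k \<in> {k. P S S' k}" "l \<in> {k. P S S' k}" "jj S k = jj S l"
      have "k $ q = l $ q" for q
      proof -
        have "jj S k $ q = jj S l $ q" by (simp only: *(3))
        moreover have "k $ q < 0 \<longleftrightarrow> q \<in> S'" "l $ q < 0 \<longleftrightarrow> q \<in> S'"
          and "q \<in> S \<Longrightarrow> k $ q = l $ q"
          using *(1,2) by (auto simp: P_def neg_part_def)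
        ultimately show ?thesis by (cases "q \<in> S") (simp_all add: jj_def split: if_splits)
      qed
      then show "k = l" by (simp add: vec_eq_iff)
    qed
  qed (auto simp: jj)
  have van: "vanishing_off S (b S)" for S
    unfolding vanishing_off_def b_def by (intro allI impI sum.neutral ballI) (auto simp: P_def)
  have b_tail: "(- 1) ^ card (- S - S') *\<^sub>R b S (tail_point S S' j) = \<beta> S S' j"
    if "S' \<subseteq> - S" "j \<in> tail_index S" for S S' j
  proof -
    have "P S R (tail_point S S' j) \<longleftrightarrow> R = S'" for R
    proof -
      have "neg_part (tail_point S S' j) = S'"
      proof (intro set_eqI)
        fix q
        have "1 \<le> j $ q" if "q \<notin> S" using \<open>j \<in> tail_index S\<close> that by (auto simp: tail_index_def)
        then show "q \<in> neg_part (tail_point S S' j) \<longleftrightarrow> q \<in> S'"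
          using \<open>S' \<subseteq> - S\<close> by (auto simp: neg_part_def tail_point_def)
      qed
      then show ?thesis using that by (auto simp: P_def tail_point_def)
    qed
    moreover have "jj S (tail_point S S' j) = j"
    proof -
      have "jj S (tail_point S S' j) $ q = j $ q" for q
      proof (cases "q \<in> S")
        case False
        then have "1 \<le> j $ q" using that by (auto simp: tail_index_def)
        then show ?thesis using False by (auto simp: jj_def tail_point_def)
      qed (use that in \<open>auto simp: jj_def tail_index_def\<close>)
      then show ?thesis by (simp add: vec_eq_iff)
    qed
    ultimately have "b S (tail_point S S' j) =
        (\<Sum>R\<in>Pow (- S). if R = S' then (- 1) ^ card (- S - S') *\<^sub>R \<beta> S S' j else 0)"
      unfolding b_def by (intro sum.cong) auto
    also have "\<dots> = (- 1) ^ card (- S - S') *\<^sub>R \<beta> S S' j"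
      using that by (subst sum.delta) auto
    finally show ?thesis by (simp flip: power_mult_distrib)
  qed
  have "a k - decomp b k = 0" for k
  proof (rule tail_sums_zero[OF ord])
    fix S S' and j :: "int ^ 'd::{finite,linorder}" assume *: "S' \<subseteq> - S" "j \<in> tail_index S"
    from niter_diff[OF sums[OF *] niter_decomp_tail[OF _ _ sqb van *]]
    show "niter (\<lambda>q. index_set (tail_range S S' j q)) (\<lambda>k. a k - decomp b k) (ord S S') 0 0"
      using ord b_tail[OF *] by simp
  qed
  then have "a = decomp b" by (simp add: fun_eq_iff)
  moreover have "b S k \<in> V" for S k
    unfolding b_def
    by (intro subspace_sum[OF V(1)]) (auto intro!: subspace_scale[OF V(1)] V(2) jj subspace_0[OF V(1)])
  ultimately show ?thesis using sqb van by blast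
qed

section \<open>An isometric embedding of \<open>L\<^sup>2\<close> into a Banach space\<close>

lemma L2_measurable: "f \<in> L2 M \<Longrightarrow> f \<in> borel_measurable M"
  and L2_integrable_sq: "f \<in> L2 M \<Longrightarrow> integrable M (\<lambda>x. (f x)\<^sup>2)"
  by (simp_all add: L2_def)

lemma L2_mult_integrable:
  assumes "f \<in> L2 M" "g \<in> L2 M"
  shows "integrable M (\<lambda>x. f x * g x)"
proof (rule Bochner_Integration.integrable_bound)
  show "integrable M (\<lambda>x. (f x)\<^sup>2 + (g x)\<^sup>2)"
    using assms by (intro Bochner_Integration.integrable_add L2_integrable_sq)
  show "(\<lambda>x. f x * g x) \<in> borel_measurable M"
    using assms[THEN L2_measurable] by measurable
  have "\<bar>a * b\<bar> \<le> a\<^sup>2 + b\<^sup>2" for a b :: real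
  proof -
    have "2 * \<bar>a * b\<bar> \<le> a\<^sup>2 + b\<^sup>2"
      using zero_le_power2[of "\<bar>a\<bar> - \<bar>b\<bar>"] by (simp add: power2_diff abs_mult)
    then show ?thesis using zero_le_power2[of a] zero_le_power2[of b] abs_ge_zero[of "a * b"] by linarith
  qed
  then show "AE x in M. norm (f x * g x) \<le> norm ((f x)\<^sup>2 + (g x)\<^sup>2)"
    by (intro AE_I2) (simp add: order_trans[OF _ abs_ge_self])
qed

lemma L2_zero [simp]: "(\<lambda>_. 0) \<in> L2 M"
  by (simp add: L2_def)

lemma L2_cmult: "f \<in> L2 M \<Longrightarrow> (\<lambda>x. c * f x) \<in> L2 M"
  by (auto simp: L2_def power_mult_distrib)

lemma L2_add: "f \<in> L2 M \<Longrightarrow> g \<in> L2 M \<Longrightarrow> (\<lambda>x. f x + g x) \<in> L2 M"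
  using L2_mult_integrable[of f M g]
  by (auto simp: L2_def power2_sum mult.assoc)

lemma L2_diff: "f \<in> L2 M \<Longrightarrow> g \<in> L2 M \<Longrightarrow> (\<lambda>x. f x - g x) \<in> L2 M"
  using L2_add[OF _ L2_cmult[of g M "-1"]] by simp

lemma L2_sum: "(\<And>i. i \<in> I \<Longrightarrow> f i \<in> L2 M) \<Longrightarrow> (\<lambda>x. \<Sum>i\<in>I. f i x) \<in> L2 M"
  by (induction I rule: infinite_finite_induct) (auto intro: L2_add)

lemma L2_AE_cong:
  "f \<in> L2 M \<Longrightarrow> g \<in> borel_measurable M \<Longrightarrow> AE x in M. f x = g x \<Longrightarrow> g \<in> L2 M"
  unfolding L2_def by (auto intro: integrable_cong_AE_imp)

lemma l2norm_nonneg [simp]: "0 \<le> l2norm M f"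
  by (simp add: l2norm_def)

lemma l2norm_sq: "(l2norm M f)\<^sup>2 = (\<integral>x. (f x)\<^sup>2 \<partial>M)"
  by (simp add: l2norm_def)

lemma l2_Cauchy_Schwarz:
  assumes "f \<in> L2 M" "g \<in> L2 M"
  shows "\<bar>\<integral>x. f x * g x \<partial>M\<bar> \<le> l2norm M f * l2norm M g"
proof -
  define A B C where "A = (\<integral>x. (f x)\<^sup>2 \<partial>M)" "B = (\<integral>x. (g x)\<^sup>2 \<partial>M)" "C = (\<integral>x. f x * g x \<partial>M)"
  have quad: "0 \<le> A + 2 * t * C + t\<^sup>2 * B" for t
  proof -
    have "0 \<le> (\<integral>x. (f x + t * g x)\<^sup>2 \<partial>M)" by simp
    also have "\<dots> = (\<integral>x. (f x)\<^sup>2 + 2 * t * (f x * g x) + t\<^sup>2 * (g x)\<^sup>2 \<partial>M)"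
      by (simp add: power2_sum power_mult_distrib algebra_simps)
    also have "\<dots> = A + 2 * t * C + t\<^sup>2 * B"
      using assms[THEN L2_integrable_sq] L2_mult_integrable[OF assms]
      by (simp add: A_B_C_def)
    finally show ?thesis .
  qed
  have "0 \<le> A" "0 \<le> B" by (simp_all add: A_B_C_def)
  have "C\<^sup>2 \<le> A * B"
  proof (cases "B = 0")
    case True
    have "C = 0"
    proof (rule ccontr)
      assume "C \<noteq> 0"
      \<comment> \<open>For \<open>B = 0\<close> the quadratic is affine in \<open>t\<close>; at
        this \<open>t\<close> it takes the value -1.\<close>
      then show False using quad[of "- (A + 1) / (2 * C)"] True by (simp add: field_simps)
    qed
    then show ?thesis using True by simp
  next
    case False
    with \<open>0 \<le> B\<close> have "0 < B" by simp
    then show ?thesis using quad[of "- C / B"] by (simp add: field_simps power2_eq_square)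
  qed
  then have "sqrt (C\<^sup>2) \<le> sqrt (A * B)" by (rule real_sqrt_le_mono)
  then show ?thesis by (simp add: l2norm_def A_B_C_def real_sqrt_mult)
qed

lemma l2norm_eq_0_iff: "f \<in> L2 M \<Longrightarrow> l2norm M f = 0 \<longleftrightarrow> (AE x in M. f x = 0)"
  unfolding l2norm_def L2_def
  by (auto simp: integral_nonneg_eq_0_iff_AE)

text \<open>On a discrete space every function is continuous, so these are all bounded functions
  with the supremum norm, a Banach space that receives L2 without a quotient construction.\<close>

type_synonym 'a l2 = "(('a \<Rightarrow> real) discrete, real) bcontfun"

text \<open>\<open>f\<close> is represented by the functional \<open>\<phi> \<mapsto> \<integral> f \<phi>\<close> on the unit ball of \<open>L\<^sup>2\<close>.\<close>
definition emb :: "'a measure \<Rightarrow> ('a \<Rightarrow> real) \<Rightarrow> 'a l2" where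
  "emb M f = Bcontfun (\<lambda>\<phi>. let g = of_discrete \<phi> in
     if g \<in> L2 M \<and> l2norm M g \<le> 1 then \<integral>x. f x * g x \<partial>M else 0)"

lemma apply_emb:
  assumes "f \<in> L2 M"
  shows "apply_bcontfun (emb M f) \<phi> = (if of_discrete \<phi> \<in> L2 M \<and> l2norm M (of_discrete \<phi>) \<le> 1
    then \<integral>x. f x * of_discrete \<phi> x \<partial>M else 0)"
proof -
  let ?F = "\<lambda>\<phi>. let g = of_discrete \<phi> in if g \<in> L2 M \<and> l2norm M g \<le> 1 then \<integral>x. f x * g x \<partial>M else 0"
  have "?F \<in> bcontfun"
  proof (rule bcontfun_normI)
    show "continuous_on UNIV ?F"
      by (simp add: continuous_on_open_vimage open_discrete)
    fix \<phi>
    show "norm (?F \<phi>) \<le> l2norm M f"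
    proof (cases "of_discrete \<phi> \<in> L2 M \<and> l2norm M (of_discrete \<phi>) \<le> 1")
      case True
      then have "\<bar>\<integral>x. f x * of_discrete \<phi> x \<partial>M\<bar> \<le> l2norm M f * l2norm M (of_discrete \<phi>)"
        using l2_Cauchy_Schwarz[OF assms] by simp
      also have "\<dots> \<le> l2norm M f * 1" using True by (intro mult_left_mono) auto
      finally show ?thesis using True by (simp add: Let_def)
    qed (auto simp: Let_def)
  qed
  then show ?thesis unfolding emb_def by (subst Bcontfun_inverse) (simp_all add: Let_def)
qed

lemma emb_add: "f \<in> L2 M \<Longrightarrow> g \<in> L2 M \<Longrightarrow> emb M (\<lambda>x. f x + g x) = emb M f + emb M g"
  by (rule bcontfun_eqI) (auto simp: apply_emb L2_add distrib_right L2_mult_integrable)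

lemma emb_cmult: "f \<in> L2 M \<Longrightarrow> emb M (\<lambda>x. c * f x) = c *\<^sub>R emb M f"
  by (rule bcontfun_eqI) (auto simp: apply_emb L2_cmult mult.assoc L2_mult_integrable)

lemma emb_zero: "emb M (\<lambda>_. 0) = 0"
  by (rule bcontfun_eqI) (auto simp: apply_emb)

lemma emb_diff: "f \<in> L2 M \<Longrightarrow> g \<in> L2 M \<Longrightarrow> emb M (\<lambda>x. f x - g x) = emb M f - emb M g"
  by (rule bcontfun_eqI) (auto simp: apply_emb L2_diff left_diff_distrib L2_mult_integrable)

lemma emb_sum: "(\<And>i. i \<in> I \<Longrightarrow> f i \<in> L2 M) \<Longrightarrow> emb M (\<lambda>x. \<Sum>i\<in>I. f i x) = (\<Sum>i\<in>I. emb M (f i))"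
  by (induction I rule: infinite_finite_induct) (auto simp: emb_zero emb_add L2_sum)

lemma norm_emb:
  assumes "f \<in> L2 M"
  shows "norm (emb M f) = l2norm M f"
proof (rule antisym)
  show "norm (emb M f) \<le> l2norm M f"
  proof (rule norm_bound)
    fix \<phi>
    show "norm (apply_bcontfun (emb M f) \<phi>) \<le> l2norm M f"
    proof (cases "of_discrete \<phi> \<in> L2 M \<and> l2norm M (of_discrete \<phi>) \<le> 1")
      case True
      then have "\<bar>\<integral>x. f x * of_discrete \<phi> x \<partial>M\<bar> \<le> l2norm M f * l2norm M (of_discrete \<phi>)"
        using l2_Cauchy_Schwarz[OF assms] by simp
      also have "\<dots> \<le> l2norm M f * 1" using True by (intro mult_left_mono) auto
      finally show ?thesis using True assms by (simp add: apply_emb)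
    qed (auto simp: apply_emb assms)
  qed
next
  show "l2norm M f \<le> norm (emb M f)"
  proof (cases "l2norm M f = 0")
    case False
    \<comment> \<open>The normalised \<open>f\<close> lies in the unit ball and attains the
      supremum.\<close>
    define g where "g = (\<lambda>x. inverse (l2norm M f) * f x)"
    have g: "g \<in> L2 M" unfolding g_def using assms by (rule L2_cmult)
    have "(l2norm M g)\<^sup>2 = (inverse (l2norm M f))\<^sup>2 * (l2norm M f)\<^sup>2"
      unfolding l2norm_sq by (simp add: g_def power_mult_distrib)
    also have "\<dots> = 1" using False by (simp flip: power_mult_distrib)
    finally have "(l2norm M g)\<^sup>2 = 1" .
    then have "l2norm M g \<le> 1" by (auto simp: power2_eq_1_iff)
    moreover have "(\<integral>x. f x * g x \<partial>M) = l2norm M f"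
    proof -
      have "(\<integral>x. f x * g x \<partial>M) = (\<integral>x. inverse (l2norm M f) * (f x)\<^sup>2 \<partial>M)"
        by (simp add: g_def power2_eq_square algebra_simps)
      also have "\<dots> = inverse (l2norm M f) * (l2norm M f)\<^sup>2" by (simp add: l2norm_sq)
      finally show ?thesis using False by (simp add: power2_eq_square)
    qed
    ultimately have "apply_bcontfun (emb M f) (discrete g) = l2norm M f"
      using assms g by (simp add: apply_emb discrete_inverse)
    then show ?thesis using norm_bounded[of "emb M f" "discrete g"] by simp
  qed simp
qed

lemma emb_eq_iff:
  assumes "f \<in> L2 M" "g \<in> L2 M"
  shows "emb M f = emb M g \<longleftrightarrow> (AE x in M. f x = g x)"
proof -
  have "emb M f = emb M g \<longleftrightarrow> norm (emb M (\<lambda>x. f x - g x)) = 0"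
    using assms by (simp add: emb_diff)
  also have "\<dots> \<longleftrightarrow> (AE x in M. f x - g x = 0)"
    using assms by (simp only: norm_emb[OF L2_diff] l2norm_eq_0_iff[OF L2_diff])
  finally show ?thesis by simp
qed

lemma subspace_emb: "subspace (emb M ` L2 M)"
proof (rule subspaceI)
  show "0 \<in> emb M ` L2 M" by (rule image_eqI[of _ _ "\<lambda>_. 0"]) (simp_all add: emb_zero)
qed (auto simp flip: emb_add emb_cmult intro!: imageI L2_add L2_cmult)

context prob_space
begin

lemma L2_integrable: "f \<in> L2 M \<Longrightarrow> integrable M f"
  using L2_mult_integrable[of f M "\<lambda>_. 1"] by (simp add: L2_def)

lemma l1_le_l2norm:
  assumes "f \<in> L2 M"
  shows "(\<integral>x. \<bar>f x\<bar> \<partial>M) \<le> l2norm M f"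
proof -
  have "(\<lambda>x. \<bar>f x\<bar>) \<in> L2 M" "(\<lambda>_. 1) \<in> L2 M" using assms by (auto simp: L2_def)
  from l2_Cauchy_Schwarz[OF this] show ?thesis by (simp add: l2norm_def prob_space)
qed

text \<open>Riesz--Fischer: a rapidly convergent subsequence converges almost everywhere, and Fatou's
  lemma identifies its pointwise limit as the limit in \<open>L\<^sup>2\<close>.\<close>
theorem closed_emb: "closed (emb M ` L2 M)"
  unfolding closed_sequential_limits
proof (intro allI impI, elim conjE)
  fix X l assume X: "\<forall>n. X n \<in> emb M ` L2 M" and lim: "X \<longlonglongrightarrow> l"
  \<comment> \<open>Two errors of this size add up to at most \<open>(1/2) ^ n\<close> in
    \<open>dist_h\<close>.\<close>
  have "\<exists>n. dist (X n) l < (1/2) ^ (k + 2)" for k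
  proof -
    have "eventually (\<lambda>n. dist (X n) l < (1/2) ^ (k + 2)) sequentially"
      using lim by (rule tendstoD) simp
    then show ?thesis by (auto simp: eventually_sequentially)
  qed
  then obtain r where r: "\<And>k. dist (X (r k)) l < (1/2) ^ (k + 2)" by metis
  from X have "\<forall>k. \<exists>f. f \<in> L2 M \<and> X (r k) = emb M f" by auto
  then obtain h where h: "\<And>k. h k \<in> L2 M" and Xh: "\<And>k. X (r k) = emb M (h k)" by metis
  have [measurable]: "h k \<in> borel_measurable M" for k using h by (rule L2_measurable)
  have dist_h: "l2norm M (\<lambda>x. h m x - h n x) \<le> (1/2) ^ n" if "n \<le> m" for m n
  proof -
    have "l2norm M (\<lambda>x. h m x - h n x) = dist (X (r m)) (X (r n))"
      using h by (simp add: Xh dist_norm norm_emb L2_diff flip: emb_diff)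
    also have "\<dots> \<le> dist (X (r m)) l + dist (X (r n)) l" by (rule dist_triangle2)
    also have "\<dots> \<le> (1/2) ^ (m + 2) + (1/2) ^ (n + 2)" using r[of m] r[of n] by simp
    also have "\<dots> \<le> (1/2) ^ n"
    proof -
      have "(1/2 :: real) ^ m \<le> (1/2) ^ n" by (rule power_decreasing[OF that]) auto
      moreover have "0 \<le> (1/2 :: real) ^ n" by simp
      moreover have "(1/2 :: real) ^ (m + 2) = (1/2) ^ m / 4" "(1/2 :: real) ^ (n + 2) = (1/2) ^ n / 4"
        by (simp_all add: power2_eq_square)
      ultimately show ?thesis by linarith
    qed
    finally show ?thesis .
  qed
  \<comment> \<open>On a probability space the L1 norms of the increments are bounded by their L2
    norms, hence summable; therefore the increments are absolutely summable at almost every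
    point.\<close>
  have "(\<integral>\<^sup>+x. (\<Sum>n. ennreal \<bar>h (Suc n) x - h n x\<bar>) \<partial>M) = (\<Sum>n. \<integral>\<^sup>+x. ennreal \<bar>h (Suc n) x - h n x\<bar> \<partial>M)"
    by (rule nn_integral_suminf) measurable
  also have "\<dots> \<le> (\<Sum>n. ennreal ((1/2) ^ n))"
  proof (rule suminf_le)
    fix n
    have "(\<integral>\<^sup>+x. ennreal \<bar>h (Suc n) x - h n x\<bar> \<partial>M) = ennreal (\<integral>x. \<bar>h (Suc n) x - h n x\<bar> \<partial>M)"
      by (intro nn_integral_eq_integral integrable_abs L2_integrable L2_diff h) simp
    also have "\<dots> \<le> ennreal ((1/2) ^ n)"
      using l1_le_l2norm[OF L2_diff[OF h h, of "Suc n" n]] dist_h[of n "Suc n"]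
      by (intro ennreal_leI) simp
    finally show "(\<integral>\<^sup>+x. ennreal \<bar>h (Suc n) x - h n x\<bar> \<partial>M) \<le> ennreal ((1/2) ^ n)" .
  qed auto
  also have "\<dots> < \<infinity>"
    by (subst suminf_ennreal2) (simp_all add: summable_geometric)
  finally have "AE x in M. (\<Sum>n. ennreal \<bar>h (Suc n) x - h n x\<bar>) \<noteq> \<infinity>"
    by (intro nn_integral_noteq_infinite) auto
  then have conv: "AE x in M. convergent (\<lambda>n. h n x)"
  proof eventually_elim
    case (elim x)
    then have "summable (\<lambda>n. \<bar>h (Suc n) x - h n x\<bar>)"
      by (intro summable_suminf_not_top) auto
    then have "summable (\<lambda>n. h (Suc n) x - h n x)" by (rule summable_rabs_cancel)
    then have "convergent (\<lambda>n. \<Sum>k<n. h (Suc k) x - h k x)"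
      by (simp add: summable_iff_convergent)
    then have "convergent (\<lambda>n. h n x - h 0 x)" by (simp only: sum_lessThan_telescope[of "\<lambda>n. h n x"])
    then have "convergent (\<lambda>n. (h n x - h 0 x) + h 0 x)"
      by (intro convergent_add convergent_const)
    then show ?case by simp
  qed
  define g where "g x = lim (\<lambda>n. h n x)" for x
  have [measurable]: "g \<in> borel_measurable M" unfolding g_def by measurable
  have Fatou: "(\<integral>\<^sup>+x. ennreal ((g x - h n x)\<^sup>2) \<partial>M) \<le> ennreal (((1/2) ^ n)\<^sup>2)" for n
  proof -
    have "(\<integral>\<^sup>+x. ennreal ((g x - h n x)\<^sup>2) \<partial>M) =
        (\<integral>\<^sup>+x. liminf (\<lambda>m. ennreal ((h m x - h n x)\<^sup>2)) \<partial>M)"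
    proof (rule nn_integral_cong_AE)
      show "AE x in M. ennreal ((g x - h n x)\<^sup>2) = liminf (\<lambda>m. ennreal ((h m x - h n x)\<^sup>2))"
        using conv
      proof eventually_elim
        case (elim x)
        then have "(\<lambda>m. h m x) \<longlonglongrightarrow> g x"
          by (simp add: g_def convergent_LIMSEQ_iff)
        then have "(\<lambda>m. ennreal ((h m x - h n x)\<^sup>2)) \<longlonglongrightarrow> ennreal ((g x - h n x)\<^sup>2)"
          by (intro tendsto_ennrealI tendsto_intros)
        then show ?case by (intro lim_imp_Liminf[symmetric]) auto
      qed
    qed
    also have "\<dots> \<le> liminf (\<lambda>m. \<integral>\<^sup>+x. ennreal ((h m x - h n x)\<^sup>2) \<partial>M)"
      by (rule nn_integral_liminf) measurable
    also have "\<dots> \<le> ennreal (((1/2) ^ n)\<^sup>2)"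
    proof -
      have bound: "(\<integral>\<^sup>+x. ennreal ((h m x - h n x)\<^sup>2) \<partial>M) \<le> ennreal (((1/2) ^ n)\<^sup>2)" if "n \<le> m" for m
      proof -
        have "(\<integral>\<^sup>+x. ennreal ((h m x - h n x)\<^sup>2) \<partial>M) = ennreal ((l2norm M (\<lambda>x. h m x - h n x))\<^sup>2)"
          unfolding l2norm_sq
          by (intro nn_integral_eq_integral L2_integrable_sq L2_diff h) simp
        also have "\<dots> \<le> ennreal (((1/2) ^ n)\<^sup>2)"
          using dist_h[OF that] by (intro ennreal_leI power_mono) auto
        finally show ?thesis .
      qed
      have "liminf (\<lambda>m. \<integral>\<^sup>+x. ennreal ((h m x - h n x)\<^sup>2) \<partial>M) \<le>
          limsup (\<lambda>m. \<integral>\<^sup>+x. ennreal ((h m x - h n x)\<^sup>2) \<partial>M)"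
        by (intro Liminf_le_Limsup) auto
      also have "\<dots> \<le> ennreal (((1/2) ^ n)\<^sup>2)"
        by (rule Limsup_bounded) (use bound in \<open>auto simp: eventually_sequentially\<close>)
      finally show ?thesis .
    qed
    finally show ?thesis .
  qed
  have gh: "(\<lambda>x. g x - h n x) \<in> L2 M" for n
  proof -
    have "integrable M (\<lambda>x. (g x - h n x)\<^sup>2)"
    proof (rule integrableI_nonneg)
      show "(\<integral>\<^sup>+x. ennreal ((g x - h n x)\<^sup>2) \<partial>M) < \<infinity>"
        using order_le_less_trans[OF Fatou[of n] ennreal_less_top] by (simp add: infinity_ennreal_def)
    qed auto
    then show ?thesis by (simp add: L2_def)
  qed
  from L2_add[OF gh[of 0] h[of 0]] have g: "g \<in> L2 M" by simp
  have "norm (emb M g - emb M (h n)) \<le> (1/2) ^ n" for n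
  proof -
    have "ennreal ((l2norm M (\<lambda>x. g x - h n x))\<^sup>2) = (\<integral>\<^sup>+x. ennreal ((g x - h n x)\<^sup>2) \<partial>M)"
      unfolding l2norm_sq
      by (intro nn_integral_eq_integral[symmetric] L2_integrable_sq gh) simp
    also note Fatou
    finally have "(l2norm M (\<lambda>x. g x - h n x))\<^sup>2 \<le> ((1/2) ^ n)\<^sup>2" by simp
    then have "l2norm M (\<lambda>x. g x - h n x) \<le> (1/2) ^ n"
      by (rule power2_le_imp_le) simp
    then show ?thesis using g h gh by (simp add: norm_emb flip: emb_diff)
  qed
  then have "\<forall>\<^sub>F n in sequentially. norm (emb M g - emb M (h n)) \<le> (1/2) ^ n"
    by (intro always_eventually allI)
  moreover have half: "(\<lambda>n. (1/2 :: real) ^ n) \<longlonglongrightarrow> 0" by (rule LIMSEQ_realpow_zero) auto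
  ultimately have "(\<lambda>n. emb M g - emb M (h n)) \<longlonglongrightarrow> 0" by (rule Lim_null_comparison)
  from tendsto_diff[OF tendsto_const this, of "emb M g"] have "(\<lambda>n. emb M (h n)) \<longlonglongrightarrow> emb M g"
    by simp
  moreover have "(\<lambda>n. emb M (h n)) \<longlonglongrightarrow> l"
  proof (rule LIM_zero_cancel, rule Lim_null_comparison[OF _ half], intro always_eventually allI)
    fix n
    have "norm (emb M (h n) - l) < (1/2) ^ (n + 2)" using r[of n] by (simp add: Xh dist_norm)
    also have "\<dots> \<le> (1/2) ^ n" by simp
    finally show "norm (emb M (h n) - l) \<le> (1/2) ^ n" by simp
  qed
  ultimately have "l = emb M g" by (rule LIMSEQ_unique[rotated])
  then show "l \<in> emb M ` L2 M" using g by auto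
qed

end

section \<open>Transfer of series between L2 and the Banach space\<close>

lemma l2_sums_iff:
  assumes "\<And>i. i \<in> A \<Longrightarrow> t i \<in> L2 M" "s \<in> L2 M"
  shows "l2_sums M A t s \<longleftrightarrow> nsums A (\<lambda>i. emb M (t i)) (emb M s)"
proof -
  have "l2norm M (\<lambda>x. (\<Sum>i \<in> A \<inter> {m..n}. t i x) - s x) = norm ((\<Sum>i \<in> A \<inter> {m..n}. emb M (t i)) - emb M s)"
    for m n
  proof -
    have 1: "(\<lambda>x. \<Sum>i \<in> A \<inter> {m..n}. t i x) \<in> L2 M" using assms by (intro L2_sum) auto
    have "emb M (\<lambda>x. \<Sum>i \<in> A \<inter> {m..n}. t i x) = (\<Sum>i \<in> A \<inter> {m..n}. emb M (t i))"
      using assms by (intro emb_sum) auto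
    then show ?thesis using norm_emb[OF L2_diff[OF 1 assms(2)]] emb_diff[OF 1 assms(2)] by simp
  qed
  then show ?thesis
    using assms by (auto simp: l2_sums_def nsums_def case_prod_beta' tendsto_norm_zero_iff LIM_zero_iff)
qed

lemma l2_has_sum_iff:
  assumes "\<And>j. j \<in> J \<Longrightarrow> t j \<in> L2 M" "s \<in> L2 M"
  shows "l2_has_sum M t J s \<longleftrightarrow> ((\<lambda>j. emb M (t j)) has_sum emb M s) J"
proof -
  have "eventually (\<lambda>K. l2norm M (\<lambda>x. (\<Sum>j \<in> K. t j x) - s x) = norm ((\<Sum>j \<in> K. emb M (t j)) - emb M s))
      (finite_subsets_at_top J)"
  proof (rule eventually_finite_subsets_at_top_weakI)
    fix K assume "K \<subseteq> J"
    then have t: "\<And>j. j \<in> K \<Longrightarrow> t j \<in> L2 M" using assms by auto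
    then have "(\<lambda>x. \<Sum>j \<in> K. t j x) \<in> L2 M" by (rule L2_sum)
    then show "l2norm M (\<lambda>x. (\<Sum>j \<in> K. t j x) - s x) = norm ((\<Sum>j \<in> K. emb M (t j)) - emb M s)"
      using norm_emb[OF L2_diff[OF _ assms(2)], of "\<lambda>x. \<Sum>j \<in> K. t j x"] emb_sum[of K t M, OF t]
        emb_diff[OF _ assms(2), of "\<lambda>x. \<Sum>j \<in> K. t j x"] by simp
  qed
  from tendsto_cong[OF this] show ?thesis
    using assms by (auto simp: l2_has_sum_def has_sum_def tendsto_norm_zero_iff LIM_zero_iff)
qed

lemma iter_sums_L2: "iter_sums M A a qs k s \<Longrightarrow> s \<in> L2 M"
  by (cases qs) (auto simp: l2_sums_def)

lemma iter_sums_imp_niter: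
  assumes "\<And>k. a k \<in> L2 M"
  shows "iter_sums M A a qs k s \<Longrightarrow> niter A (\<lambda>k. emb M (a k)) qs k (emb M s)"
proof (induction qs arbitrary: k s)
  case Nil
  then show ?case using assms by (simp add: emb_eq_iff)
next
  case (Cons q qs)
  then obtain t where t: "\<And>i. i \<in> A q \<Longrightarrow> iter_sums M A a qs (upd k q i) (t i)" "l2_sums M (A q) t s"
    by (auto simp: upd_def)
  then have "nsums (A q) (\<lambda>i. emb M (t i)) (emb M s)"
    by (subst l2_sums_iff[symmetric]) (auto simp: l2_sums_def)
  then show ?case using t(1) Cons.IH unfolding niter.simps
    by (intro exI[of _ "\<lambda>i. emb M (t i)"]) simp
qed

text \<open>Each limit is a priori just a vector of the Banach space. It is represented by a
  square-integrable function because the image of L2 is closed.\<close>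

lemma (in prob_space) niter_imp_iter_sums:
  assumes "\<And>k. a k \<in> L2 M"
  shows "niter A (\<lambda>k. emb M (a k)) qs k x \<Longrightarrow> \<exists>s. iter_sums M A a qs k s \<and> emb M s = x"
proof (induction qs arbitrary: k x)
  case Nil
  then show ?case using assms by (intro exI[of _ "a k"]) auto
next
  case (Cons q qs)
  then obtain t where t: "\<And>i. i \<in> A q \<Longrightarrow> niter A (\<lambda>k. emb M (a k)) qs (upd k q i) (t i)"
    "nsums (A q) t x" by auto
  from t(1) Cons.IH have "\<forall>i\<in>A q. \<exists>s. iter_sums M A a qs (upd k q i) s \<and> emb M s = t i" by blast
  then obtain u where u: "\<And>i. i \<in> A q \<Longrightarrow> iter_sums M A a qs (upd k q i) (u i)"
    "\<And>i. i \<in> A q \<Longrightarrow> emb M (u i) = t i" by metis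
  have uL2: "\<And>i. i \<in> A q \<Longrightarrow> u i \<in> L2 M" using u(1) iter_sums_L2 by blast
  have sums: "nsums (A q) (\<lambda>i. emb M (u i)) x"
    using t(2) u(2) nsums_cong[of "A q" "\<lambda>i. emb M (u i)" t] by simp
  have "x \<in> emb M ` L2 M"
  proof (rule Lim_in_closed_set[OF closed_emb _ bot_top_nontrivial sums[unfolded nsums_def]])
    show "\<forall>\<^sub>F p in at_bot \<times>\<^sub>F at_top. (\<Sum>i\<in>A q \<inter> {fst p..snd p}. emb M (u i)) \<in> emb M ` L2 M"
      using uL2 by (intro always_eventually allI subspace_sum[OF subspace_emb]) auto
  qed
  then obtain s where s: "s \<in> L2 M" "x = emb M s" by auto
  then have "l2_sums M (A q) u s" using sums uL2 by (simp add: l2_sums_iff)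
  then show ?case using s u(1) by (auto simp: upd_def)
qed

section \<open>Operators on \<open>L\<^sup>2\<close>\<close>

definition L2_space :: "'a measure \<Rightarrow> 'a l2 set" where
  "L2_space M = emb M ` L2 M"

definition rep :: "'a measure \<Rightarrow> 'a l2 \<Rightarrow> 'a \<Rightarrow> real" where
  "rep M x = (SOME f. f \<in> L2 M \<and> emb M f = x)"

definition hip :: "'a measure \<Rightarrow> 'a l2 \<Rightarrow> 'a l2 \<Rightarrow> real" where
  "hip M x y = (\<integral>w. rep M x w * rep M y w \<partial>M)"

text \<open>Setting the operator to \<open>0\<close> off \<^term>\<open>L2_space M\<close> makes commutation rules unconditional.\<close>
definition lift :: "'a measure \<Rightarrow> (('a \<Rightarrow> real) \<Rightarrow> 'a \<Rightarrow> real) \<Rightarrow> 'a l2 \<Rightarrow> 'a l2" where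
  "lift M \<Phi> x = (if x \<in> L2_space M then emb M (\<Phi> (rep M x)) else 0)"

definition L2_op :: "'a measure \<Rightarrow> (('a \<Rightarrow> real) \<Rightarrow> 'a \<Rightarrow> real) \<Rightarrow> bool" where
  "L2_op M \<Phi> \<longleftrightarrow> (\<forall>f\<in>L2 M. \<Phi> f \<in> L2 M) \<and>
     (\<forall>f\<in>L2 M. \<forall>g\<in>L2 M. (AE x in M. f x = g x) \<longrightarrow> (AE x in M. \<Phi> f x = \<Phi> g x))"

lemma emb_in_hil [simp]: "f \<in> L2 M \<Longrightarrow> emb M f \<in> L2_space M"
  by (simp add: L2_space_def)

lemma L2_spaceE: assumes "x \<in> L2_space M" obtains f where "f \<in> L2 M" "x = emb M f"
  using assms by (auto simp: L2_space_def)

lemma subspace_hil: "subspace (L2_space M)"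
  unfolding L2_space_def by (rule subspace_emb)

lemmas hil_add = subspace_add[OF subspace_hil]
  and hil_diff = subspace_diff[OF subspace_hil]
  and hil_zero [simp] = subspace_0[OF subspace_hil]
  and hil_sum = subspace_sum[OF subspace_hil]
  and hil_scale = subspace_scale[OF subspace_hil]

lemma rep:
  assumes "x \<in> L2_space M"
  shows "rep M x \<in> L2 M \<and> emb M (rep M x) = x"
proof -
  have "\<exists>f. f \<in> L2 M \<and> emb M f = x" using assms by (auto simp: L2_space_def)
  from someI_ex[OF this] show ?thesis by (simp add: rep_def)
qed

lemma lift_emb: "L2_op M \<Phi> \<Longrightarrow> f \<in> L2 M \<Longrightarrow> lift M \<Phi> (emb M f) = emb M (\<Phi> f)"
  using rep[of "emb M f" M] by (auto simp: lift_def L2_op_def emb_eq_iff)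

lemma lift_in_hil: "L2_op M \<Phi> \<Longrightarrow> lift M \<Phi> x \<in> L2_space M"
  using rep[of x M] by (auto simp: lift_def L2_op_def)

lemma hip_emb: "f \<in> L2 M \<Longrightarrow> g \<in> L2 M \<Longrightarrow> hip M (emb M f) (emb M g) = (\<integral>x. f x * g x \<partial>M)"
proof -
  assume "f \<in> L2 M" "g \<in> L2 M"
  then have *: "rep M (emb M f) \<in> L2 M" "rep M (emb M g) \<in> L2 M"
    "AE x in M. rep M (emb M f) x = f x" "AE x in M. rep M (emb M g) x = g x"
    using rep[of "emb M f" M] rep[of "emb M g" M] by (auto simp: emb_eq_iff)
  note [measurable] = L2_measurable[OF *(1)] L2_measurable[OF *(2)]
    L2_measurable[OF \<open>f \<in> L2 M\<close>] L2_measurable[OF \<open>g \<in> L2 M\<close>]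
  show ?thesis unfolding hip_def
    by (rule integral_cong_AE) (use *(3,4) in auto)
qed

lemma hip_commute: "hip M x y = hip M y x"
  by (simp add: hip_def mult.commute)

lemma hip_add_left: "x \<in> L2_space M \<Longrightarrow> y \<in> L2_space M \<Longrightarrow> z \<in> L2_space M \<Longrightarrow> hip M (x + y) z = hip M x z + hip M y z"
  by (elim L2_spaceE) (simp add: emb_add[symmetric] hip_emb L2_add distrib_right L2_mult_integrable)

lemma hip_diff_left: "x \<in> L2_space M \<Longrightarrow> y \<in> L2_space M \<Longrightarrow> z \<in> L2_space M \<Longrightarrow> hip M (x - y) z = hip M x z - hip M y z"
  by (elim L2_spaceE) (simp add: emb_diff[symmetric] hip_emb L2_diff left_diff_distrib L2_mult_integrable)

lemma hip_diff_right: "x \<in> L2_space M \<Longrightarrow> y \<in> L2_space M \<Longrightarrow> z \<in> L2_space M \<Longrightarrow> hip M z (x - y) = hip M z x - hip M z y"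
  by (simp add: hip_commute[of M z] hip_diff_left)

lemma hip_self: "x \<in> L2_space M \<Longrightarrow> hip M x x = (norm x)\<^sup>2"
  by (elim L2_spaceE) (simp add: hip_emb norm_emb l2norm_sq flip: power2_eq_square)

lemma hip_bound: "x \<in> L2_space M \<Longrightarrow> y \<in> L2_space M \<Longrightarrow> \<bar>hip M x y\<bar> \<le> norm x * norm y"
  by (elim L2_spaceE) (simp add: hip_emb norm_emb l2_Cauchy_Schwarz)

lemma hip_zero [simp]: "hip M 0 x = 0" if "x \<in> L2_space M"
  using hip_bound[of 0 M x] that by simp

lemma hip_sum_left:
  "(\<And>i. i \<in> I \<Longrightarrow> f i \<in> L2_space M) \<Longrightarrow> y \<in> L2_space M \<Longrightarrow> hip M (\<Sum>i\<in>I. f i) y = (\<Sum>i\<in>I. hip M (f i) y)"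
  by (induction I rule: infinite_finite_induct) (auto simp: hip_add_left hil_sum)

lemma norm_diff_sq:
  "x \<in> L2_space M \<Longrightarrow> y \<in> L2_space M \<Longrightarrow> (norm (x - y))\<^sup>2 = (norm x)\<^sup>2 - 2 * hip M x y + (norm y)\<^sup>2"
  using hip_self[of "x - y" M] hip_self[of x M] hip_self[of y M] hip_commute[of M y x]
  by (simp add: hil_diff hip_diff_left hip_diff_right)

text \<open>Additive, idempotent and self-adjoint: this treats conditional expectations, their
  differences \<open>Pr\<close> and the products \<open>PP\<close> at once. Homogeneity is a
  consequence, see \<open>oproj_scale\<close>.\<close>

definition oproj :: "'a measure \<Rightarrow> ('a l2 \<Rightarrow> 'a l2) \<Rightarrow> bool" where
  "oproj M p \<longleftrightarrow> (\<forall>x\<in>L2_space M. p x \<in> L2_space M) \<and> (\<forall>x\<in>L2_space M. \<forall>y\<in>L2_space M. p (x + y) = p x + p y) \<and>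
     (\<forall>x\<in>L2_space M. p (p x) = p x) \<and> (\<forall>x\<in>L2_space M. \<forall>y\<in>L2_space M. hip M (p x) y = hip M x (p y))"

lemma oproj_hil: "oproj M p \<Longrightarrow> x \<in> L2_space M \<Longrightarrow> p x \<in> L2_space M"
  and oproj_add: "oproj M p \<Longrightarrow> x \<in> L2_space M \<Longrightarrow> y \<in> L2_space M \<Longrightarrow> p (x + y) = p x + p y"
  and oproj_idem: "oproj M p \<Longrightarrow> x \<in> L2_space M \<Longrightarrow> p (p x) = p x"
  and oproj_adj: "oproj M p \<Longrightarrow> x \<in> L2_space M \<Longrightarrow> y \<in> L2_space M \<Longrightarrow> hip M (p x) y = hip M x (p y)"
  by (auto simp: oproj_def)

lemma oproj_diff: "oproj M p \<Longrightarrow> x \<in> L2_space M \<Longrightarrow> y \<in> L2_space M \<Longrightarrow> p (x - y) = p x - p y"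
  using oproj_add[of M p "x - y" y] by (simp add: hil_diff)

lemma oproj_zero: "oproj M p \<Longrightarrow> p 0 = 0"
  using oproj_add[of M p 0 0] by simp

lemma oproj_sum: "oproj M p \<Longrightarrow> (\<And>i. i \<in> I \<Longrightarrow> f i \<in> L2_space M) \<Longrightarrow> p (\<Sum>i\<in>I. f i) = (\<Sum>i\<in>I. p (f i))"
  by (induction I rule: infinite_finite_induct) (auto simp: oproj_zero oproj_add hil_sum)

lemma oproj_norm_sq: "oproj M p \<Longrightarrow> x \<in> L2_space M \<Longrightarrow> hip M x (p x) = (norm (p x))\<^sup>2"
  by (metis hip_self oproj_adj oproj_hil oproj_idem)

lemma oproj_norm: "oproj M p \<Longrightarrow> x \<in> L2_space M \<Longrightarrow> norm (p x) \<le> norm x"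
proof -
  assume p: "oproj M p" "x \<in> L2_space M"
  have "(norm (p x))\<^sup>2 \<le> norm x * norm (p x)"
    using hip_bound[OF p(2) oproj_hil[OF p]] oproj_norm_sq[OF p] by simp
  then show ?thesis by (cases "norm (p x) = 0") (auto simp: power2_eq_square)
qed

lemma oproj_tendsto:
  assumes p: "oproj M p" and "\<And>n. f n \<in> L2_space M" "x \<in> L2_space M" "(f \<longlongrightarrow> x) F"
  shows "((\<lambda>n. p (f n)) \<longlongrightarrow> p x) F"
proof (rule LIM_zero_cancel, rule Lim_null_comparison[OF always_eventually])
  show "\<forall>n. norm (p (f n) - p x) \<le> norm (f n - x)"
    using assms by (auto simp: oproj_diff[symmetric] intro: oproj_norm hil_diff)
  show "((\<lambda>n. norm (f n - x)) \<longlongrightarrow> 0) F"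
    using assms(4) by (simp add: LIM_zero_iff tendsto_norm_zero)
qed

lemma oproj_id: "oproj M (\<lambda>x. x)"
  by (simp add: oproj_def)

lemma oproj_comp:
  assumes p: "oproj M p" and r: "oproj M r" and comm: "\<And>x. x \<in> L2_space M \<Longrightarrow> p (r x) = r (p x)"
  shows "oproj M (\<lambda>x. p (r x))"
  unfolding oproj_def
proof (intro conjI ballI)
  fix x y assume xy: "x \<in> L2_space M" "y \<in> L2_space M"
  show "p (r (x + y)) = p (r x) + p (r y)"
    using xy by (simp add: oproj_add[OF p] oproj_add[OF r] oproj_hil[OF r])
  have "hip M (p (r x)) y = hip M x (r (p y))"
    using xy by (simp add: oproj_adj[OF p] oproj_adj[OF r] oproj_hil[OF r] oproj_hil[OF p])
  then show "hip M (p (r x)) y = hip M x (p (r y))" using xy by (simp add: comm)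
next
  fix x assume x: "x \<in> L2_space M"
  then show "p (r x) \<in> L2_space M" by (simp add: oproj_hil[OF p] oproj_hil[OF r])
  have "p (r (p (r x))) = p (p (r (r x)))"
    using x comm[of "r x"] by (simp add: oproj_hil[OF r])
  also have "\<dots> = p (r x)"
    using x by (simp add: oproj_hil[OF r] oproj_idem[OF r] oproj_idem[OF p])
  finally show "p (r (p (r x))) = p (r x)" .
qed

lemma oproj_minus:
  assumes "oproj M p" "oproj M r" "\<And>x. x \<in> L2_space M \<Longrightarrow> p (r x) = r x" "\<And>x. x \<in> L2_space M \<Longrightarrow> r (p x) = r x"
  shows "oproj M (\<lambda>x. p x - r x)"
  unfolding oproj_def
  using assms(3,4) oproj_hil[OF assms(1)] oproj_hil[OF assms(2)]
  by (auto simp: hil_diff oproj_add[OF assms(1)] oproj_add[OF assms(2)] oproj_diff[OF assms(1)]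
    oproj_diff[OF assms(2)] oproj_idem[OF assms(1)] oproj_idem[OF assms(2)] hip_diff_left hip_diff_right
    oproj_adj[OF assms(1)] oproj_adj[OF assms(2)])

lemma LIM_in_hil:
  assumes "closed (L2_space M)" "\<And>n. f n \<in> L2_space M" "(f \<longlongrightarrow> x) F" "F \<noteq> bot"
  shows "x \<in> L2_space M"
  using assms by (intro Lim_in_closed_set[of "L2_space M" f F]) auto

lemma hip_tendsto:
  assumes "\<And>n. f n \<in> L2_space M" "x \<in> L2_space M" "y \<in> L2_space M" "f \<longlonglongrightarrow> x"
  shows "(\<lambda>n. hip M (f n) y) \<longlonglongrightarrow> hip M x y"
proof (rule LIM_zero_cancel, rule Lim_null_comparison[OF always_eventually])
  show "\<forall>n. norm (hip M (f n) y - hip M x y) \<le> norm (f n - x) * norm y"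
    using assms by (auto simp: hip_diff_left[symmetric] intro: hip_bound hil_diff)
  show "(\<lambda>n. norm (f n - x) * norm y) \<longlonglongrightarrow> 0"
    using assms(4) by (intro tendsto_mult_left_zero) (simp add: LIM_zero_iff tendsto_norm_zero)
qed

text \<open>Projections onto a monotone sequence of subspaces satisfy the identity by Pythagoras.
  The absolute value covers increasing and decreasing sequences alike.\<close>

lemma convergent_of_norm_diff:
  fixes y :: "nat \<Rightarrow> 'x::{real_normed_vector, complete_space}"
  assumes diff: "\<And>n m. n \<le> m \<Longrightarrow> (norm (y m - y n))\<^sup>2 = \<bar>(norm (y m))\<^sup>2 - (norm (y n))\<^sup>2\<bar>"
    and conv: "convergent (\<lambda>n. (norm (y n))\<^sup>2)"
  shows "convergent y"
proof -
  have "Cauchy y"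
  proof (rule CauchyI)
    fix e :: real assume e: "0 < e"
    have "Cauchy (\<lambda>n. (norm (y n))\<^sup>2)" using conv by (rule convergent_Cauchy)
    then obtain N where N: "\<And>m n. N \<le> m \<Longrightarrow> N \<le> n \<Longrightarrow> \<bar>(norm (y m))\<^sup>2 - (norm (y n))\<^sup>2\<bar> < e\<^sup>2"
      using e unfolding Cauchy_iff by (metis real_norm_def zero_less_power)
    have le: "norm (y m - y n) < e" if "n \<le> m" "N \<le> n" for m n
      using diff[OF that(1)] N[of m n] that e by (intro power2_less_imp_less[of _ e]) auto
    have "norm (y m - y n) < e" if "N \<le> m" "N \<le> n" for m n
      using le[of m n] le[of n m] that by (cases "n \<le> m") (auto simp: norm_minus_commute)
    then show "\<exists>N. \<forall>m\<ge>N. \<forall>n\<ge>N. norm (y m - y n) < e" by blast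
  qed
  then show ?thesis by (rule Cauchy_convergent)
qed

section \<open>Conditional expectations as orthogonal projections\<close>

abbreviation ce :: "'a measure \<Rightarrow> 'a measure \<Rightarrow> 'a l2 \<Rightarrow> 'a l2" where
  "ce M G \<equiv> lift M (real_cond_exp M G)"

context prob_space
begin

lemma closed_hil: "closed (L2_space M)"
  unfolding L2_space_def by (rule closed_emb)

lemma sigma_finite_subalgebra: "subalgebra M G \<Longrightarrow> sigma_finite_subalgebra M G"
  by (intro finite_measure_subalgebra_is_sigma_finite)
    (simp add: finite_measure_subalgebra_def finite_measure_subalgebra_axioms_def finite_measure_axioms)

lemma cond_exp_L2:
  assumes "subalgebra M G" "f \<in> L2 M"
  shows "real_cond_exp M G f \<in> L2 M"
proof -
  interpret sigma_finite_subalgebra M G by (rule sigma_finite_subalgebra[OF assms(1)])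
  have sq: "integrable M (\<lambda>x. (f x)\<^sup>2)" using assms(2) by (rule L2_integrable_sq)
  have conv: "convex_on UNIV (\<lambda>x::real. x\<^sup>2)"
    by (rule convex_power2)
  have "AE x in M. (real_cond_exp M G f x)\<^sup>2 \<le> real_cond_exp M G (\<lambda>x. (f x)\<^sup>2) x"
    by (rule real_cond_exp_jensens_inequality(2)[where I = UNIV and q = "\<lambda>x. x\<^sup>2"])
      (use L2_integrable[OF assms(2)] sq conv in auto)
  then have "integrable M (\<lambda>x. (real_cond_exp M G f x)\<^sup>2)"
    using real_cond_exp_int(1)[OF sq]
    by (intro Bochner_Integration.integrable_bound[OF real_cond_exp_int(1)[OF sq]]) auto
  then show ?thesis by (simp add: L2_def)
qed

lemma L2_op_cond_exp:
  assumes G: "subalgebra M G"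
  shows "L2_op M (real_cond_exp M G)"
proof -
  interpret sigma_finite_subalgebra M G by (rule sigma_finite_subalgebra[OF G])
  show ?thesis
    unfolding L2_op_def using cond_exp_L2[OF G] real_cond_exp_cong L2_measurable by blast
qed

lemma ce_emb: "subalgebra M G \<Longrightarrow> f \<in> L2 M \<Longrightarrow> ce M G (emb M f) = emb M (real_cond_exp M G f)"
  by (rule lift_emb[OF L2_op_cond_exp])

lemma ce_in_hil: "subalgebra M G \<Longrightarrow> ce M G x \<in> L2_space M"
  by (rule lift_in_hil[OF L2_op_cond_exp])

lemma ce_off: "x \<notin> L2_space M \<Longrightarrow> ce M G x = 0"
  by (simp add: lift_def)

lemma oproj_ce:
  assumes G: "subalgebra M G"
  shows "oproj M (ce M G)"
proof -
  interpret sigma_finite_subalgebra M G by (rule sigma_finite_subalgebra[OF G])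
  \<comment> \<open>The right side is symmetric in \<open>f\<close> and \<open>g\<close>, so this is
    self-adjointness.\<close>
  have adj: "(\<integral>x. real_cond_exp M G f x * g x \<partial>M) = (\<integral>x. real_cond_exp M G f x * real_cond_exp M G g x \<partial>M)"
    if "f \<in> L2 M" "g \<in> L2 M" for f g
    using that by (intro real_cond_exp_intg(2)[symmetric]) (auto intro: L2_mult_integrable cond_exp_L2[OF G] L2_measurable)
  show ?thesis unfolding oproj_def
  proof (intro conjI ballI)
    fix x y assume "x \<in> L2_space M" "y \<in> L2_space M"
    then obtain f g where f: "f \<in> L2 M" "x = emb M f" and g: "g \<in> L2 M" "y = emb M g"
      by (elim L2_spaceE)
    show "ce M G (x + y) = ce M G x + ce M G y"
      using f g by (simp add: emb_add[symmetric] ce_emb[OF G] cond_exp_L2[OF G] L2_add emb_eq_iff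
        real_cond_exp_add L2_integrable)
    show "hip M (ce M G x) y = hip M x (ce M G y)"
      using f g adj[of f g] adj[of g f] by (simp add: ce_emb[OF G] hip_emb cond_exp_L2[OF G] mult.commute)
  next
    fix x assume "x \<in> L2_space M"
    then obtain f where f: "f \<in> L2 M" "x = emb M f" by (elim L2_spaceE)
    then show "ce M G (ce M G x) = ce M G x"
      using L2_integrable[OF cond_exp_L2[OF G f(1)]]
      by (simp add: ce_emb[OF G] cond_exp_L2[OF G] emb_eq_iff real_cond_exp_F_meas)
  qed (use ce_in_hil[OF G] in auto)
qed

lemma ce_nested:
  assumes H: "subalgebra M H" and GH: "subalgebra H G"
  shows "ce M G (ce M H x) = ce M G x" "ce M H (ce M G x) = ce M G x"
proof -
  have G: "subalgebra M G" using assms by (auto simp: subalgebra_def)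
  interpret G: sigma_finite_subalgebra M G by (rule sigma_finite_subalgebra[OF G])
  interpret H: sigma_finite_subalgebra M H by (rule sigma_finite_subalgebra[OF H])
  have "ce M G (ce M H x) = ce M G x \<and> ce M H (ce M G x) = ce M G x"
  proof (cases "x \<in> L2_space M")
    case True
    then obtain f where f: "f \<in> L2 M" "x = emb M f" by (elim L2_spaceE)
    have "AE x in M. real_cond_exp M H (real_cond_exp M G f) x = real_cond_exp M G f x"
      by (rule H.real_cond_exp_F_meas)
        (use f borel_measurable_cond_exp in \<open>auto intro: L2_integrable cond_exp_L2[OF G] measurable_from_subalg[OF GH]\<close>)
    then show ?thesis using f
      by (simp add: ce_emb[OF G] ce_emb[OF H] cond_exp_L2[OF G] cond_exp_L2[OF H] emb_eq_iff
        G.real_cond_exp_nested_subalg[OF H GH] L2_integrable)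
  qed (simp add: ce_off oproj_zero[OF oproj_ce[OF G]] oproj_zero[OF oproj_ce[OF H]])
  then show "ce M G (ce M H x) = ce M G x" "ce M H (ce M G x) = ce M G x" by auto
qed

lemma ce_fixed_iff:
  assumes G: "subalgebra M G" and f: "f \<in> L2 M"
  shows "ce M G (emb M f) = emb M f \<longleftrightarrow> ae_measurable M G f"
proof
  assume "ce M G (emb M f) = emb M f"
  then have "AE x in M. f x = real_cond_exp M G f x"
    using f by (simp add: ce_emb[OF G] emb_eq_iff[OF f cond_exp_L2[OF G f], symmetric])
  then show "ae_measurable M G f"
    unfolding ae_measurable_def by (rule bexI[of _ "real_cond_exp M G f"]) (rule borel_measurable_cond_exp)
next
  assume "ae_measurable M G f"
  then obtain h where h: "h \<in> borel_measurable G" "AE x in M. f x = h x"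
    unfolding ae_measurable_def by (elim bexE)
  have hL: "h \<in> L2 M" by (rule L2_AE_cong[OF f measurable_from_subalg[OF G h(1)] h(2)])
  then have "emb M f = emb M h" using f h(2) by (simp add: emb_eq_iff)
  moreover have "ce M G (emb M h) = emb M h"
    using sigma_finite_subalgebra.real_cond_exp_F_meas[OF sigma_finite_subalgebra[OF G] L2_integrable[OF hL] h(1)]
    by (simp add: ce_emb[OF G hL] emb_eq_iff[OF cond_exp_L2[OF G hL] hL])
  ultimately show "ce M G (emb M f) = emb M f" by simp
qed

lemma ce_zero_iff:
  assumes "subalgebra M G" "f \<in> L2 M"
  shows "ce M G (emb M f) = 0 \<longleftrightarrow> (AE x in M. real_cond_exp M G f x = 0)"
  using assms emb_eq_iff[OF cond_exp_L2[OF assms] L2_zero] by (simp add: ce_emb emb_zero)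

lemma L2_indicator: "A \<in> sets M \<Longrightarrow> indicator A \<in> L2 M"
  by (auto simp: L2_def power2_eq_square emeasure_finite less_top[symmetric] simp flip: indicator_inter_arith
    intro!: integrable_real_indicator)

lemma hip_indicator:
  assumes "f \<in> L2 M" "A \<in> sets M"
  shows "hip M (emb M f) (emb M (indicator A)) = (\<integral>x\<in>A. f x \<partial>M)"
  using assms by (simp add: hip_emb L2_indicator set_lebesgue_integral_def mult.commute)

text \<open>Martingale convergence in L2. Monotone bounded norms make the projections Cauchy. Their
  limit \<open>z\<close> is fixed by the projection to \<open>H\<close>, and \<open>z - x\<close>
  integrates to 0 over each set of each \<open>G m\<close>, hence over each set of \<open>H\<close>
  by a pi-lambda argument.\<close>

theorem ce_upward:
  assumes sub: "\<And>n. subalgebra M (G n)" "subalgebra M H" and mono: "\<And>m n. m \<le> n \<Longrightarrow> sets (G m) \<subseteq> sets (G n)"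
    and H: "sets H = sigma_sets (space M) (\<Union>n. sets (G n))" and x: "x \<in> L2_space M"
  shows "(\<lambda>n. ce M (G n) x) \<longlonglongrightarrow> ce M H x"
proof -
  have spG: "space (G n) = space M" "space H = space M" for n
    using sub by (auto simp: subalgebra_def)
  have subG: "subalgebra (G n) (G m)" if "m \<le> n" for m n
    using mono[OF that] by (auto simp: subalgebra_def spG)
  have subH: "subalgebra H (G n)" for n
    unfolding subalgebra_def spG H by (auto intro: sigma_sets.Basic)
  note pr = oproj_ce[OF sub(1)]
  define y where "y = (\<lambda>n. ce M (G n) x)"
  have y: "y n \<in> L2_space M" for n unfolding y_def by (rule ce_in_hil[OF sub(1)])
  have hip_y: "hip M (y m) (y n) = (norm (y n))\<^sup>2" if "n \<le> m" for m n
    using oproj_adj[OF pr x y[of n], of m] ce_nested(2)[OF sub(1) subG[OF that], of x] oproj_norm_sq[OF pr x]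
    by (simp add: y_def)
  have diff: "(norm (y m - y n))\<^sup>2 = (norm (y m))\<^sup>2 - (norm (y n))\<^sup>2" if "n \<le> m" for m n
    using norm_diff_sq[OF y y, of m n] hip_y[OF that] by simp
  have inc: "(norm (y n))\<^sup>2 \<le> (norm (y m))\<^sup>2" if "n \<le> m" for m n
    using diff[OF that] zero_le_power2[of "norm (y m - y n)"] by simp
  have "convergent y"
  proof (rule convergent_of_norm_diff)
    have "norm (y n) \<le> norm x" for n unfolding y_def by (rule oproj_norm[OF pr x])
    then have "Bseq (\<lambda>n. (norm (y n))\<^sup>2)" by (intro BseqI'[of _ "(norm x)\<^sup>2"]) (simp add: power_mono)
    then show "convergent (\<lambda>n. (norm (y n))\<^sup>2)"
      by (rule Bseq_mono_convergent) (intro allI impI inc)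
  qed (simp only: diff inc abs_of_nonneg diff_ge_0_iff_ge)
  then obtain z where z: "y \<longlonglongrightarrow> z" by (auto simp: convergent_def)
  have zH: "z \<in> L2_space M" by (rule LIM_in_hil[OF closed_hil y z]) simp
  have "(\<lambda>n. ce M H (y n)) \<longlonglongrightarrow> ce M H z"
    by (rule oproj_tendsto[OF oproj_ce[OF sub(2)] y zH z])
  then have "y \<longlonglongrightarrow> ce M H z" by (simp add: y_def ce_nested(2)[OF sub(2) subH])
  then have ce_z: "ce M H z = z" using z LIMSEQ_unique by blast
  obtain h where h: "h \<in> L2 M" "z - x = emb M h" using hil_diff[OF zH x] by (elim L2_spaceE)
  have [measurable]: "h \<in> borel_measurable M" using h(1) by (rule L2_measurable)
  have AM: "A \<in> sets M" if "A \<in> sets H" for A using sub(2) that by (auto simp: subalgebra_def)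
  have base: "(\<integral>w\<in>A. h w \<partial>M) = 0" if "A \<in> sets (G m)" for A m
  proof -
    have A: "A \<in> sets M" using sub(1)[of m] that by (auto simp: subalgebra_def)
    let ?a = "emb M (indicator A)"
    have a: "?a \<in> L2_space M" by (simp add: L2_indicator A)
    have "hip M (y n) ?a = hip M x ?a" if "m \<le> n" for n
    proof -
      have "ae_measurable M (G n) (indicator A)"
        unfolding ae_measurable_def
        by (rule bexI[of _ "indicator A"]) (use mono[OF that] \<open>A \<in> sets (G m)\<close> in auto)
      then have "ce M (G n) ?a = ?a" using ce_fixed_iff[OF sub(1)] L2_indicator[OF A] by blast
      then show ?thesis using oproj_adj[OF pr x a, of n] by (simp add: y_def)
    qed
    then have "(\<lambda>n. hip M (y n) ?a) \<longlonglongrightarrow> hip M x ?a"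
      by (intro tendsto_eventually) (auto simp: eventually_sequentially)
    then have "hip M z ?a = hip M x ?a"
      using hip_tendsto[OF y zH a z] LIMSEQ_unique by blast
    then show ?thesis using hip_diff_left[OF zH x a] hip_indicator[OF h(1) A] h(2) by simp
  qed
  have int: "set_integrable M A h" if "A \<in> sets H" for A
    using L2_integrable[OF h(1)] AM[OF that] unfolding set_integrable_def
    by (intro integrable_mult_indicator)
  have all: "(\<integral>w\<in>A. h w \<partial>M) = 0" if "A \<in> sets H" for A
  proof -
    have "Int_stable (\<Union>n. sets (G n))"
      unfolding Int_stable_def
      by (auto, metis (no_types) linorder_le_cases mono sets.Int subsetD)
    moreover have "(\<Union>n. sets (G n)) \<subseteq> Pow (space M)"
      using sets.space_closed spG by (metis UN_least)
    moreover have "A \<in> sigma_sets (space M) (\<Union>n. sets (G n))" using that H by simp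
    ultimately show ?thesis
    proof (induction rule: sigma_sets_induct_disjoint)
      case (compl A)
      then have A: "A \<in> sets H" by (simp add: H)
      have "(\<integral>w\<in>space M. h w \<partial>M) = 0" using base[of "space M" 0] spG(1)[of 0] sets.top[of "G 0"] by simp
      moreover have "space M = (space M - A) \<union> A" using AM[OF A] sets.sets_into_space by auto
      moreover have "(\<integral>w\<in>(space M - A) \<union> A. h w \<partial>M) = (\<integral>w\<in>space M - A. h w \<partial>M) + (\<integral>w\<in>A. h w \<partial>M)"
        using A sets.compl_sets[OF A] unfolding spG(2) by (intro set_integral_Un int) auto
      ultimately show ?case using compl.IH by simp
    next
      case (union A)
      then have A: "A i \<in> sets H" for i using H by auto
      have "(\<integral>w\<in>(\<Union>i. A i). h w \<partial>M) = (\<Sum>i. \<integral>w\<in>A i. h w \<partial>M)"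
        using union.hyps(1) A AM by (intro lebesgue_integral_countable_add int) (auto simp: disjoint_family_on_def)
      then show ?case using union.IH by simp
    qed (use base in \<open>auto simp: set_lebesgue_integral_def\<close>)
  qed
  interpret sigma_finite_subalgebra M H by (rule sigma_finite_subalgebra[OF sub(2)])
  have "AE w in M. real_cond_exp M H h w = 0"
    by (rule real_cond_exp_charact) (use all L2_integrable[OF h(1)] in \<open>auto simp: set_lebesgue_integral_def\<close>)
  then have "ce M H (z - x) = 0" using ce_zero_iff[OF sub(2) h(1)] h(2) by simp
  then have "z = ce M H x" using oproj_diff[OF oproj_ce[OF sub(2)] zH x] ce_z by simp
  then show ?thesis using z by (simp add: y_def)
qed

text \<open>Reversed martingale convergence. The norms decrease, so a limit \<open>z\<close> exists,
  and it is fixed by every \<open>G m\<close>. Once \<open>z\<close> has a version measurable for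
  the intersection \<open>H\<close>, it equals its projection to \<open>H\<close>, which is that of
  \<open>x\<close>, namely 0.\<close>

theorem ce_downward:
  assumes sub: "\<And>n. subalgebra M (G n)" "subalgebra M H" and mono: "\<And>m n. m \<le> n \<Longrightarrow> sets (G n) \<subseteq> sets (G m)"
    and H: "sets H = (\<Inter>n. sets (G n))" and x: "x \<in> L2_space M" "ce M H x = 0"
  shows "(\<lambda>n. ce M (G n) x) \<longlonglongrightarrow> 0"
proof -
  have spG: "space (G n) = space M" "space H = space M" for n
    using sub by (auto simp: subalgebra_def)
  have subG: "subalgebra (G m) (G n)" if "m \<le> n" for m n
    using mono[OF that] by (auto simp: subalgebra_def spG)
  have subH: "subalgebra (G n) H" for n
    unfolding subalgebra_def spG H by auto
  note pr = oproj_ce[OF sub(1)]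
  define y where "y = (\<lambda>n. ce M (G n) x)"
  have y: "y n \<in> L2_space M" for n unfolding y_def by (rule ce_in_hil[OF sub(1)])
  have hip_y: "hip M (y m) (y n) = (norm (y m))\<^sup>2" if "n \<le> m" for m n
    using oproj_adj[OF pr x(1) y[of n], of m] ce_nested(1)[OF sub(1) subG[OF that], of x] oproj_norm_sq[OF pr x(1)]
    by (simp add: y_def)
  have diff: "(norm (y m - y n))\<^sup>2 = (norm (y n))\<^sup>2 - (norm (y m))\<^sup>2" if "n \<le> m" for m n
    using norm_diff_sq[OF y y, of m n] hip_y[OF that] by simp
  have dec: "(norm (y m))\<^sup>2 \<le> (norm (y n))\<^sup>2" if "n \<le> m" for m n
    using diff[OF that] zero_le_power2[of "norm (y m - y n)"] by simp
  have "convergent y"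
  proof (rule convergent_of_norm_diff)
    have "norm (y n) \<le> norm x" for n unfolding y_def by (rule oproj_norm[OF pr x(1)])
    then have "Bseq (\<lambda>n. - (norm (y n))\<^sup>2)" by (intro BseqI'[of _ "(norm x)\<^sup>2"]) (simp add: power_mono)
    then have "convergent (\<lambda>n. - (norm (y n))\<^sup>2)"
      by (rule Bseq_mono_convergent) (intro allI impI le_imp_neg_le dec)
    then show "convergent (\<lambda>n. (norm (y n))\<^sup>2)" by (subst convergent_minus_iff)
  qed (simp only: diff dec abs_of_nonpos diff_le_0_iff_le minus_diff_eq)
  then obtain z where z: "y \<longlonglongrightarrow> z" by (auto simp: convergent_def)
  have zH: "z \<in> L2_space M" by (rule LIM_in_hil[OF closed_hil y z]) simp
  obtain g where g: "g \<in> L2 M" "z = emb M g" using zH by (elim L2_spaceE)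
  have "ce M (G m) z = z" for m
  proof -
    have "(\<lambda>n. ce M (G m) (y n)) \<longlonglongrightarrow> ce M (G m) z"
      by (rule oproj_tendsto[OF pr y zH z])
    moreover have "\<forall>\<^sub>F n in sequentially. ce M (G m) (y n) = y n"
      unfolding eventually_sequentially y_def using ce_nested(2)[OF sub(1) subG] by blast
    ultimately have "y \<longlonglongrightarrow> ce M (G m) z" by (rule Lim_transform_eventually)
    then show ?thesis using z LIMSEQ_unique by blast
  qed
  then have "\<forall>m. ae_measurable M (G m) g" using ce_fixed_iff[OF sub(1) g(1)] g(2) by simp
  then obtain k where k: "\<And>m. k m \<in> borel_measurable (G m)" "\<And>m. AE w in M. g w = k m w"
    unfolding ae_measurable_def by metis
  \<comment> \<open>The versions \<open>k m\<close> agree with \<open>g\<close> only off null sets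
    that need not belong to the smaller sigma-algebras. The limit ignores finitely many terms of the
    sequence, so it is measurable for every \<open>G n\<close> exactly.\<close>
  define l where "l w = lim (\<lambda>m. k m w)" for w
  have "l \<in> borel_measurable (G n)" for n
  proof -
    have "l w = lim (\<lambda>m. k (m + n) w)" for w
    proof -
      have "(\<lambda>m. k m w) \<longlonglongrightarrow> L \<longleftrightarrow> (\<lambda>m. k (m + n) w) \<longlonglongrightarrow> L" for L
        using LIMSEQ_ignore_initial_segment[of "\<lambda>m. k m w" L n] LIMSEQ_offset[of "\<lambda>m. k m w" n L] by blast
      then show ?thesis by (simp add: l_def lim_def)
    qed
    moreover have "k (m + n) \<in> borel_measurable (G n)" for m
      by (rule measurable_from_subalg[OF subG k(1)]) simp
    then have "(\<lambda>w. lim (\<lambda>m. k (m + n) w)) \<in> borel_measurable (G n)"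
      by measurable
    ultimately show ?thesis by (simp add: l_def[abs_def])
  qed
  then have "l \<in> borel_measurable H"
    unfolding measurable_def H spG by auto
  moreover have "AE w in M. g w = l w"
  proof -
    have "AE w in M. \<forall>m. g w = k m w" using k(2) by (simp add: AE_all_countable)
    then show ?thesis by eventually_elim (simp add: l_def)
  qed
  ultimately have "ce M H z = z"
    using ce_fixed_iff[OF sub(2) g(1)] g(2) by (auto simp: ae_measurable_def)
  moreover have "(\<lambda>n. ce M H (y n)) \<longlonglongrightarrow> ce M H z"
    by (rule oproj_tendsto[OF oproj_ce[OF sub(2)] y zH z])
  then have "ce M H z = 0"
    using x(2) by (simp add: y_def ce_nested(1)[OF sub(1) subH] LIMSEQ_const_iff)
  ultimately show ?thesis using z by (simp add: y_def)
qed

end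

section \<open>Products of commuting projections and orthogonal series\<close>

lemma foldr_commute_all:
  assumes "\<And>q x. q \<in> set qs \<Longrightarrow> r (P q x) = P q (r x)"
  shows "r (foldr P qs x) = foldr P qs (r x)"
  using assms by (induction qs) auto

text \<open>\<open>P q\<close> commutes through the product to its own copy and is absorbed
  there.\<close>

lemma foldr_absorb:
  assumes comm: "\<And>p q x. P p (P q x) = P q (P p x)" and "q \<in> set qs"
    and idem: "\<And>x. x \<in> V \<Longrightarrow> P q (P q x) = P q x" and V: "\<And>p x. x \<in> V \<Longrightarrow> P p x \<in> V"
  shows "x \<in> V \<Longrightarrow> P q (foldr P qs x) = foldr P qs x"
  using assms(2)
proof (induction qs)
  case (Cons p qs)
  have "foldr P qs x \<in> V" for qs using Cons.prems(1) V by (induction qs) auto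
  then show ?case using Cons comm[of q p] idem by (cases "p = q") auto
qed simp

text \<open>By Pythagoras the squared norm of a finite piece of the series is the corresponding
  piece of the series of squares, so the finite partial sums form a Cauchy net.\<close>

lemma (in prob_space) orthogonal_summable:
  assumes c: "\<And>k. c k \<in> L2_space M" and orth: "\<And>k l. k \<noteq> l \<Longrightarrow> hip M (c k) (c l) = 0"
    and sq: "sqsum c"
  obtains g where "(c has_sum g) UNIV" "g \<in> L2_space M"
proof -
  have pyth: "(norm (\<Sum>k\<in>K. c k))\<^sup>2 = (\<Sum>k\<in>K. (norm (c k))\<^sup>2)" if "finite K" for K
    using that
  proof (induction K rule: finite_induct)
    case (insert k K)
    have *: "(\<Sum>k\<in>K. c k) \<in> L2_space M" by (intro hil_sum c)
    have "hip M (\<Sum>k\<in>K. c k) (c k) = 0"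
      using insert.hyps by (subst hip_sum_left) (auto intro!: c sum.neutral orth)
    then have "(norm (c k + (\<Sum>k\<in>K. c k)))\<^sup>2 = (norm (c k))\<^sup>2 + (norm (\<Sum>k\<in>K. c k))\<^sup>2"
      using hip_self[OF hil_add[OF c[of k] *]] hip_self[OF c[of k]] hip_self[OF *]
        hip_add_left[OF c[of k] * hil_add[OF c[of k] *]] hip_add_left[OF c[of k] * c[of k]]
        hip_add_left[OF c[of k] * *]
        hip_commute[of M "c k"  "c k + (\<Sum>k\<in>K. c k)"] hip_commute[of M "\<Sum>k\<in>K. c k" "c k + (\<Sum>k\<in>K. c k)"]
        hip_commute[of M "c k" "\<Sum>k\<in>K. c k"]
      by simp
    with insert show ?case by simp
  qed simp
  have "\<exists>P. eventually P (finite_subsets_at_top UNIV) \<and> (\<forall>K L. P K \<and> P L \<longrightarrow> dist (\<Sum>k\<in>K. c k) (\<Sum>k\<in>L. c k) < e)"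
    if e: "0 < e" for e
  proof -
    define s where "s = infsum (\<lambda>k. (norm (c k))\<^sup>2) UNIV"
    have has: "((\<lambda>k. (norm (c k))\<^sup>2) has_sum s) UNIV"
      using sq unfolding sqsum_def s_def by (rule has_sum_infsum)
    have "eventually (\<lambda>K. dist (\<Sum>k\<in>K. (norm (c k))\<^sup>2) s < (e/2)\<^sup>2) (finite_subsets_at_top UNIV)"
      using has unfolding has_sum_def by (rule tendstoD) (use e in simp)
    then obtain F0 where F0: "finite F0" "\<And>K. finite K \<Longrightarrow> F0 \<subseteq> K \<Longrightarrow> dist (\<Sum>k\<in>K. (norm (c k))\<^sup>2) s < (e/2)\<^sup>2"
      unfolding eventually_finite_subsets_at_top by auto
    have le: "(\<Sum>k\<in>K. (norm (c k))\<^sup>2) \<le> s" if "finite K" for K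
      by (rule finite_sum_le_has_sum[OF has that]) auto
    have tail: "norm ((\<Sum>k\<in>K. c k) - (\<Sum>k\<in>F0. c k)) < e/2" if K: "finite K" "F0 \<subseteq> K" for K
    proof -
      have "(\<Sum>k\<in>K. c k) - (\<Sum>k\<in>F0. c k) = (\<Sum>k\<in>K - F0. c k)"
        using K by (simp add: sum_diff)
      then have "(norm ((\<Sum>k\<in>K. c k) - (\<Sum>k\<in>F0. c k)))\<^sup>2 = (\<Sum>k\<in>K - F0. (norm (c k))\<^sup>2)"
        using pyth[of "K - F0"] K by simp
      also have "\<dots> = (\<Sum>k\<in>K. (norm (c k))\<^sup>2) - (\<Sum>k\<in>F0. (norm (c k))\<^sup>2)"
        using K by (simp add: sum_diff)
      also have "\<dots> < (e/2)\<^sup>2"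
        using le[OF K(1)] F0(2)[OF F0(1) order_refl] unfolding dist_real_def by linarith
      finally show ?thesis by (rule power_less_imp_less_base) (use e in simp)
    qed
    have "dist (\<Sum>k\<in>K. c k) (\<Sum>k\<in>L. c k) < e" if "finite K" "F0 \<subseteq> K" "finite L" "F0 \<subseteq> L" for K L
      using dist_triangle_half_r[of "\<Sum>k\<in>F0. c k" "\<Sum>k\<in>K. c k" e "\<Sum>k\<in>L. c k"] tail[OF that(1,2)] tail[OF that(3,4)]
      by (simp add: dist_norm norm_minus_commute)
    moreover have "eventually (\<lambda>K. finite K \<and> F0 \<subseteq> K) (finite_subsets_at_top UNIV)"
      unfolding eventually_finite_subsets_at_top using F0(1) by (intro exI[of _ F0]) auto
    ultimately show ?thesis
      by (intro exI[of _ "\<lambda>K. finite K \<and> F0 \<subseteq> K"]) simp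
  qed
  then have "cauchy_filter (filtermap (sum c) (finite_subsets_at_top UNIV))"
    by (simp add: cauchy_filter_metric_filtermap)
  then obtain g where g: "(sum c \<longlongrightarrow> g) (finite_subsets_at_top UNIV)"
    using complete_uniform[where S="UNIV :: 'a l2 set"] complete_UNIV by (force simp add: filterlim_def)
  have "g \<in> L2_space M"
    by (rule LIM_in_hil[OF closed_hil _ g]) (auto intro: hil_sum c)
  with g show thesis by (intro that[of g]) (simp add: has_sum_def)
qed

lemma oproj_has_sum:
  assumes p: "oproj M p" and c: "\<And>k. c k \<in> L2_space M" and g: "g \<in> L2_space M" "(c has_sum g) A"
  shows "((\<lambda>k. p (c k)) has_sum p g) A"
proof -
  have "((\<lambda>K. p (\<Sum>k\<in>K. c k)) \<longlongrightarrow> p g) (finite_subsets_at_top A)"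
    by (rule oproj_tendsto[OF p]) (use c g in \<open>auto simp: has_sum_def intro: hil_sum\<close>)
  then show ?thesis by (simp add: has_sum_def oproj_sum[OF p c])
qed

lemma tendsto_int_at_bot:
  assumes "(\<lambda>n::nat. f (- int n)) \<longlonglongrightarrow> L"
  shows "(f \<longlongrightarrow> L) at_bot"
  using tendsto_int_at_top[of "\<lambda>i. f (- i)", OF assms] by (simp add: at_bot_mirror filterlim_filtermap)

lemma tendsto_int_shift:
  assumes "(f \<longlongrightarrow> L) at_top" shows "((\<lambda>l::int. f (l + c)) \<longlongrightarrow> L) at_top"
proof (rule filterlim_compose[OF assms])
  show "filterlim (\<lambda>l::int. l + c) at_top at_top"
    unfolding filterlim_at_top eventually_at_top_linorder by presburger
qed

lemma tendsto_int_shift_bot: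
  assumes "(f \<longlongrightarrow> L) at_bot" shows "((\<lambda>l::int. f (l + c)) \<longlongrightarrow> L) at_bot"
proof (rule filterlim_compose[OF assms])
  show "filterlim (\<lambda>l::int. l + c) at_bot at_bot"
    unfolding filterlim_at_bot eventually_at_bot_linorder by presburger
qed

context completely_commuting_filtration
begin

section \<open>The filtration\<close>

lemma T_measurable [measurable]: "T i \<in> M \<rightarrow>\<^sub>M M"
  and T_distr: "distr M M (T i) = M"
  and T_zero: "w \<in> space M \<Longrightarrow> T 0 w = w"
  and T_add: "w \<in> space M \<Longrightarrow> T (i + j) w = T i (T j w)"
  using action by (auto simp: zd_action_def)

lemma T_space: "w \<in> space M \<Longrightarrow> T i w \<in> space M"
  using measurable_space[OF T_measurable] .

lemma space_F: "space F = space M" and sets_F: "sets F \<subseteq> sets M"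
  using subalg by (auto simp: subalgebra_def)

text \<open>\<open>T i\<close> inverts \<open>T (- i)\<close> on the space. Preimages replace the
  images in the definition of \<open>Filt\<close>, and preimages respect the operations of a
  sigma-algebra.\<close>

lemma T_image: "B \<subseteq> space M \<Longrightarrow> T (- i) ` B = T i -` B \<inter> space M"
proof (intro set_eqI iffI)
  fix w assume "B \<subseteq> space M" "w \<in> T (- i) ` B"
  then show "w \<in> T i -` B \<inter> space M"
    using T_add[of _ i "- i"] T_zero by (auto simp: subset_iff T_space)
next
  fix w assume "w \<in> T i -` B \<inter> space M"
  then show "w \<in> T (- i) ` B"
    using T_add[of w "- i" i] T_zero by (intro image_eqI[of _ _ "T i w"]) auto
qed

lemma sets_Filt: "sets (Filt M T F i) = {T i -` B \<inter> space M | B. B \<in> sets F}"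
proof -
  have "sets F \<subseteq> Pow (space M)" using sets.space_closed[of F] space_F by simp
  then have eq: "(\<lambda>B. T (- i) ` B) ` sets F = {T i -` B \<inter> space M | B. B \<in> sets F}"
    using T_image by (auto simp: image_iff subset_iff)
  have "sets (Filt M T F i) = sigma_sets (space M) {T i -` B \<inter> space M | B. B \<in> sets F}"
    unfolding Filt_def eq by (rule sets_measure_of) auto
  also have "\<dots> = {T i -` B \<inter> space M | B. B \<in> sets F}"
    using sets_vimage_algebra2[of "T i" "space M" F] T_space
    by (simp add: sets_vimage_algebra space_F Pi_def)
  finally show ?thesis .
qed

lemma space_Filt [simp]: "space (Filt M T F i) = space M"
  by (simp add: Filt_def space_measure_of_conv)

lemma subalgebra_Filt: "subalgebra M (Filt M T F i)"
  unfolding subalgebra_def using sets_F by (auto simp: sets_Filt intro!: measurable_sets[OF T_measurable])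

lemma space_Filt_dir [simp]: "space (Filt_dir M T F q l) = space M"
  and space_Filt_inf [simp]: "space (Filt_inf M T F) = space M"
  and space_Filt_dir_minf [simp]: "space (Filt_dir_minf M T F q) = space M"
  by (simp_all add: Filt_dir_def Filt_inf_def Filt_dir_minf_def space_measure_of_conv)

lemma Filt_Pow: "sets (Filt M T F i) \<subseteq> Pow (space M)"
  using sets.space_closed[of "Filt M T F i"] by simp

lemma sets_Filt_dir: "sets (Filt_dir M T F q l) = sigma_sets (space M) (\<Union>i\<in>{i. i $ q \<le> l}. sets (Filt M T F i))"
  unfolding Filt_dir_def using Filt_Pow by (intro sets_measure_of) blast

lemma sets_Filt_inf: "sets (Filt_inf M T F) = sigma_sets (space M) (\<Union>i. sets (Filt M T F i))"
  unfolding Filt_inf_def using Filt_Pow by (intro sets_measure_of) blast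

lemma Filt_sub: "sets (Filt M T F i) \<subseteq> sets M"
  using subalgebra_Filt by (simp add: subalgebra_def)

lemma subalgebra_Filt_dir: "subalgebra M (Filt_dir M T F q l)"
  unfolding subalgebra_def sets_Filt_dir using Filt_sub by (auto intro!: sets.sigma_sets_subset)

lemma subalgebra_Filt_inf: "subalgebra M (Filt_inf M T F)"
  unfolding subalgebra_def sets_Filt_inf using Filt_sub by (auto intro!: sets.sigma_sets_subset)

lemma Filt_dir_mono: "l \<le> m \<Longrightarrow> sets (Filt_dir M T F q l) \<subseteq> sets (Filt_dir M T F q m)"
  unfolding sets_Filt_dir by (intro sigma_sets_mono' UN_mono) auto

lemma sets_Filt_dir_minf: "sets (Filt_dir_minf M T F q) = (\<Inter>k::nat. sets (Filt_dir M T F q (- int k)))"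
proof -
  let ?I = "\<Inter>k::nat. sets (Filt_dir M T F q (- int k))"
  have "?I \<subseteq> sets (Filt_dir M T F q (- int 0))" by (rule INT_lower) simp
  then have "?I \<subseteq> Pow (space M)"
    using sets.space_closed[of "Filt_dir M T F q (- int 0)"] by simp
  then have "sets (Filt_dir_minf M T F q) = sigma_sets (space M) ?I"
    unfolding Filt_dir_minf_def by (rule sets_measure_of)
  moreover have "sigma_sets (space M) ?I \<subseteq> sets (Filt_dir M T F q (- int k))" for k
    using sets.sigma_sets_subset[of ?I "Filt_dir M T F q (- int k)"] by auto
  ultimately show ?thesis by (auto intro: sigma_sets.Basic)
qed

lemma subalgebra_Filt_dir_minf: "subalgebra M (Filt_dir_minf M T F q)"
  unfolding subalgebra_def sets_Filt_dir_minf
  using subalgebra_Filt_dir[of q "- int 0"] INT_lower[of 0 UNIV "\<lambda>k. sets (Filt_dir M T F q (- int k))"]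
  by (auto simp only: subalgebra_def space_Filt_dir_minf)

definition corner :: "'d::{finite,linorder} \<Rightarrow> int \<Rightarrow> nat \<Rightarrow> int ^ 'd::{finite,linorder}" where
  "corner q l n = (\<chi> p. if p = q then l else int n)"

text \<open>The corners are cofinal among the indices with \<open>i $ q\<close> at most
  \<open>l\<close>, the other coordinates being free to grow. An increasing sequence of generators
  is what \<open>ce_upward\<close> requires.\<close>

lemma Filt_dir_directed: "sets (Filt_dir M T F q l) = sigma_sets (space M) (\<Union>n. sets (Filt M T F (corner q l n)))"
proof -
  have "(\<Union>i\<in>{i. i $ q \<le> l}. sets (Filt M T F i)) = (\<Union>n. sets (Filt M T F (corner q l n)))"
  proof (intro equalityI UN_least)
    fix i assume i: "i \<in> {i. i $ q \<le> l}"
    define n where "n = (\<Sum>p\<in>UNIV. nat \<bar>i $ p\<bar>)"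
    have "nat \<bar>i $ p\<bar> \<le> n" for p unfolding n_def by (rule member_le_sum) auto
    then have "i $ p \<le> int n" for p by (metis abs_ge_self nat_le_iff order_trans)
    then have "i \<le> corner q l n" using i by (auto simp: less_eq_vec_def corner_def)
    then show "sets (Filt M T F i) \<subseteq> (\<Union>n. sets (Filt M T F (corner q l n)))"
      using Filt_mono by blast
  next
    fix n
    have "corner q l n $ q \<le> l" by (simp add: corner_def)
    then show "sets (Filt M T F (corner q l n)) \<subseteq> (\<Union>i\<in>{i. i $ q \<le> l}. sets (Filt M T F i))"
      by blast
  qed
  then show ?thesis by (simp add: sets_Filt_dir)
qed

abbreviation E :: "'d::{finite,linorder} \<Rightarrow> int \<Rightarrow> 'a l2 \<Rightarrow> 'a l2" where
  "E q l \<equiv> ce M (Filt_dir M T F q l)"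

lemma corner_mono: "m \<le> n \<Longrightarrow> corner q l m \<le> corner q l n"
  by (auto simp: corner_def less_eq_vec_def)

lemma E_limit: "x \<in> L2_space M \<Longrightarrow> (\<lambda>n. ce M (Filt M T F (corner q l n)) x) \<longlonglongrightarrow> E q l x"
  by (rule ce_upward[OF subalgebra_Filt subalgebra_Filt_dir Filt_mono[OF corner_mono] Filt_dir_directed])

lemma ce_Filt_commute:
  "ce M (Filt M T F i) (ce M (Filt M T F j) x) = ce M (Filt M T F j) (ce M (Filt M T F i) x)"
proof (cases "x \<in> L2_space M")
  case True
  then obtain f where f: "f \<in> L2 M" "x = emb M f" by (elim L2_spaceE)
  have "ce M (Filt M T F i) (ce M (Filt M T F j) x) =
      emb M (real_cond_exp M (Filt M T F (\<chi> q. min (j $ q) (i $ q))) f)" for i j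
    using f commuting[OF L2_integrable[OF f(1)], of i j]
    by (simp add: ce_emb[OF subalgebra_Filt] cond_exp_L2[OF subalgebra_Filt] emb_eq_iff)
  then show ?thesis by (simp add: min.commute)
qed (simp add: ce_off oproj_zero[OF oproj_ce[OF subalgebra_Filt]])

lemma oproj_E: "oproj M (E q l)"
  by (rule oproj_ce[OF subalgebra_Filt_dir])

lemma E_hil [simp]: "E q l x \<in> L2_space M"
  by (rule ce_in_hil[OF subalgebra_Filt_dir])

lemma ce_Filt_hil [simp]: "ce M (Filt M T F i) x \<in> L2_space M"
  by (rule ce_in_hil[OF subalgebra_Filt])

text \<open>Commutation is assumed for the sigma-algebras \<open>Filt\<close> at single indices. It
  passes to the directional ones by a limit along corners, first in one factor, then in the
  other.\<close>

theorem E_commute: "E q l (E p m x) = E p m (E q l x)"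
proof (cases "x \<in> L2_space M")
  case x: True
  let ?c = "\<lambda>n. ce M (Filt M T F (corner q l n))" and ?d = "\<lambda>n. ce M (Filt M T F (corner p m n))"
  note cont = oproj_tendsto[OF oproj_ce[OF subalgebra_Filt]]
  have eq: "E q l (?d n x) = ?d n (E q l x)" for n
  proof (rule LIMSEQ_unique)
    show "(\<lambda>k. ?c k (?d n x)) \<longlonglongrightarrow> E q l (?d n x)" by (rule E_limit) simp
    have "(\<lambda>k. ?d n (?c k x)) \<longlonglongrightarrow> ?d n (E q l x)"
      by (rule cont[OF _ _ E_limit[OF x]]) simp_all
    then show "(\<lambda>k. ?c k (?d n x)) \<longlonglongrightarrow> ?d n (E q l x)" by (simp only: ce_Filt_commute[of "corner p m n"])
  qed
  show ?thesis
  proof (rule LIMSEQ_unique)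
    show "(\<lambda>n. E q l (?d n x)) \<longlonglongrightarrow> E q l (E p m x)"
      by (rule oproj_tendsto[OF oproj_E _ _ E_limit[OF x]]) simp_all
    show "(\<lambda>n. E q l (?d n x)) \<longlonglongrightarrow> E p m (E q l x)"
      unfolding eq by (rule E_limit) simp
  qed
qed (simp add: ce_off oproj_zero[OF oproj_E])

lemma E_min: "E q l (E q m x) = E q (min l m) x"
proof -
  have *: "subalgebra (Filt_dir M T F q m) (Filt_dir M T F q l)" if "l \<le> m" for l m
    using Filt_dir_mono[OF that] by (simp add: subalgebra_def)
  show ?thesis
    using ce_nested[OF subalgebra_Filt_dir *, of l m x] ce_nested[OF subalgebra_Filt_dir *, of m l x]
    by (cases "l \<le> m") (auto simp: min_def)
qed

section \<open>The action on \<open>L\<^sup>2\<close>\<close>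

abbreviation Uu :: "int ^ 'd::{finite,linorder} \<Rightarrow> 'a l2 \<Rightarrow> 'a l2" where
  "Uu i \<equiv> lift M (Uop T i)"

lemma integral_T: "f \<in> borel_measurable M \<Longrightarrow> (\<integral>w. f (T i w) \<partial>M) = (\<integral>w. f w \<partial>M)" for f :: "'a \<Rightarrow> real"
  using integral_distr[OF T_measurable[of i], of f] by (simp add: T_distr)

lemma integrable_T: "integrable M f \<Longrightarrow> integrable M (\<lambda>w. f (T i w))" for f :: "'a \<Rightarrow> real"
  using integrable_distr[OF T_measurable[of i], of f] by (simp add: T_distr)

lemma AE_T: "AE w in M. P w \<Longrightarrow> AE w in M. P (T i w)"
  using AE_distrD[OF T_measurable[of i], of P] unfolding T_distr .

lemma Uop_L2: "f \<in> L2 M \<Longrightarrow> Uop T i f \<in> L2 M"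
  unfolding L2_def Uop_def using integrable_T[of "\<lambda>w. (f w)\<^sup>2"] measurable_compose[OF T_measurable] by auto

lemma L2_op_Uop: "L2_op M (Uop T i)"
  unfolding L2_op_def
proof (intro conjI ballI impI)
  fix f g :: "'a \<Rightarrow> real" assume "AE w in M. f w = g w"
  then show "AE w in M. Uop T i f w = Uop T i g w" unfolding Uop_def by (rule AE_T)
qed (rule Uop_L2)

lemma Uu_emb: "f \<in> L2 M \<Longrightarrow> Uu i (emb M f) = emb M (Uop T i f)"
  by (rule lift_emb[OF L2_op_Uop])

lemma Uu_hil [simp]: "Uu i x \<in> L2_space M"
  by (rule lift_in_hil[OF L2_op_Uop])

lemma Uu_off: "x \<notin> L2_space M \<Longrightarrow> Uu i x = 0"
  by (simp add: lift_def)

lemma Uu_norm: "x \<in> L2_space M \<Longrightarrow> norm (Uu i x) = norm x"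
proof (elim L2_spaceE)
  fix f assume f: "f \<in> L2 M" "x = emb M f"
  have [measurable]: "f \<in> borel_measurable M" using f(1) by (rule L2_measurable)
  have "(l2norm M (Uop T i f))\<^sup>2 = (l2norm M f)\<^sup>2"
    using integral_T[of "\<lambda>w. (f w)\<^sup>2"] by (simp add: l2norm_sq Uop_def)
  then show ?thesis using f by (simp add: Uu_emb norm_emb Uop_L2)
qed

lemma Uu_add: "x \<in> L2_space M \<Longrightarrow> y \<in> L2_space M \<Longrightarrow> Uu i (x + y) = Uu i x + Uu i y"
  by (elim L2_spaceE) (simp add: emb_add[symmetric] Uu_emb L2_add Uop_L2, simp add: Uop_def)

lemma Uu_diff: "x \<in> L2_space M \<Longrightarrow> y \<in> L2_space M \<Longrightarrow> Uu i (x - y) = Uu i x - Uu i y"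
  using Uu_add[of "x - y" y i] by (simp add: hil_diff)

lemma Uu_zero [simp]: "Uu i 0 = 0"
  using Uu_add[of 0 0 i] by simp

lemma Uu_Uu: "Uu i (Uu j x) = Uu (i + j) x"
proof (cases "x \<in> L2_space M")
  case True
  then obtain f where f: "f \<in> L2 M" "x = emb M f" by (elim L2_spaceE)
  have "AE w in M. Uop T i (Uop T j f) w = Uop T (i + j) f w"
    by (rule AE_I2) (simp add: Uop_def T_add[symmetric] add.commute)
  then show ?thesis using f by (simp add: Uu_emb Uop_L2 emb_eq_iff)
qed (simp add: Uu_off)

lemma Uu_id: "x \<in> L2_space M \<Longrightarrow> Uu 0 x = x"
proof (elim L2_spaceE)
  fix f assume f: "f \<in> L2 M" "x = emb M f"
  have "AE w in M. Uop T 0 f w = f w" by (rule AE_I2) (simp add: Uop_def T_zero)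
  then show ?thesis using f by (simp add: Uu_emb Uop_L2 emb_eq_iff)
qed

lemma Uu_tendsto:
  assumes "\<And>n. f n \<in> L2_space M" "x \<in> L2_space M" "(f \<longlongrightarrow> x) G"
  shows "((\<lambda>n. Uu i (f n)) \<longlongrightarrow> Uu i x) G"
proof (rule LIM_zero_cancel, rule Lim_null_comparison[OF always_eventually])
  show "\<forall>n. norm (Uu i (f n) - Uu i x) \<le> norm (f n - x)"
    using assms by (auto simp: Uu_diff[symmetric] Uu_norm hil_diff)
  show "((\<lambda>n. norm (f n - x)) \<longlongrightarrow> 0) G"
    using assms(3) by (simp add: LIM_zero_iff tendsto_norm_zero)
qed

text \<open>Every test set in \<open>G'\<close> is the preimage of some \<open>B\<close> in
  \<open>G\<close>, and invariance of the measure carries integrals over the former to integrals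
  over \<open>B\<close>.\<close>

lemma cond_exp_transport:
  assumes G: "subalgebra M G" and G': "subalgebra M G'"
    and eq: "sets G' = {T k -` B \<inter> space M | B. B \<in> sets G}" and f: "integrable M f"
  shows "AE w in M. real_cond_exp M G' (\<lambda>w. f (T k w)) w = real_cond_exp M G f (T k w)"
proof -
  interpret G: sigma_finite_subalgebra M G by (rule sigma_finite_subalgebra[OF G])
  interpret G': sigma_finite_subalgebra M G' by (rule sigma_finite_subalgebra[OF G'])
  have sp: "space G = space M" "space G' = space M" using G G' by (auto simp: subalgebra_def)
  show ?thesis
  proof (rule G'.real_cond_exp_charact)
    fix A assume "A \<in> sets G'"
    then obtain B where B: "B \<in> sets G" "A = T k -` B \<inter> space M" using eq by auto
    have [measurable]: "B \<in> sets M" using B(1) G by (auto simp: subalgebra_def)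
    have [measurable]: "f \<in> borel_measurable M" using f by auto
    have ind: "set_lebesgue_integral M A (\<lambda>w. g (T k w)) = set_lebesgue_integral M B g"
      if [measurable]: "g \<in> borel_measurable M" for g :: "'a \<Rightarrow> real"
    proof -
      have "set_lebesgue_integral M A (\<lambda>w. g (T k w)) = (\<integral>w. indicator B (T k w) * g (T k w) \<partial>M)"
        unfolding set_lebesgue_integral_def B(2)
        by (rule Bochner_Integration.integral_cong) (auto simp: indicator_def)
      also have "\<dots> = (\<integral>w. indicator B w * g w \<partial>M)"
        by (rule integral_T[of "\<lambda>w. indicator B w * g w"]) measurable
      finally show ?thesis by (simp add: set_lebesgue_integral_def)
    qed
    show "(\<integral>w\<in>A. f (T k w) \<partial>M) = (\<integral>w\<in>A. real_cond_exp M G f (T k w) \<partial>M)"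
      using G.real_cond_exp_intA[OF f B(1)] by (simp add: ind)
  next
    show "integrable M (\<lambda>w. f (T k w))" using f by (rule integrable_T)
    show "integrable M (\<lambda>w. real_cond_exp M G f (T k w))"
      using G.real_cond_exp_int(1)[OF f] by (rule integrable_T)
    have "T k \<in> measurable G' G"
      by (rule measurableI) (auto simp: sp T_space eq)
    then show "(\<lambda>w. real_cond_exp M G f (T k w)) \<in> borel_measurable G'"
      by (rule measurable_compose) (rule borel_measurable_cond_exp)
  qed
qed

lemma Filt_shift: "sets (Filt M T F (i + k)) = {T k -` B \<inter> space M | B. B \<in> sets (Filt M T F i)}"
proof -
  have *: "T (i + k) -` B \<inter> space M = T k -` (T i -` B \<inter> space M) \<inter> space M" for B
    by (auto simp: T_add T_space)
  show ?thesis unfolding sets_Filt * by blast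
qed

lemma Filt_dir_shift:
  "sets (Filt_dir M T F q (l + k $ q)) = {T k -` B \<inter> space M | B. B \<in> sets (Filt_dir M T F q l)}"
proof -
  have "(\<Union>i\<in>{i. i $ q \<le> l + k $ q}. sets (Filt M T F i)) =
      {T k -` A \<inter> space M | A. A \<in> (\<Union>i\<in>{i. i $ q \<le> l}. sets (Filt M T F i))}"
  proof (intro set_eqI iffI)
    fix A assume "A \<in> (\<Union>i\<in>{i. i $ q \<le> l + k $ q}. sets (Filt M T F i))"
    then obtain i where i: "i $ q \<le> l + k $ q" "A \<in> sets (Filt M T F ((i - k) + k))" by auto
    then have "(i - k) $ q \<le> l" by simp
    then show "A \<in> {T k -` A \<inter> space M | A. A \<in> (\<Union>i\<in>{i. i $ q \<le> l}. sets (Filt M T F i))}"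
      using i(2) unfolding Filt_shift by blast
  next
    fix A assume "A \<in> {T k -` A \<inter> space M | A. A \<in> (\<Union>i\<in>{i. i $ q \<le> l}. sets (Filt M T F i))}"
    then obtain i where i: "i $ q \<le> l" "A \<in> sets (Filt M T F (i + k))" unfolding Filt_shift by auto
    then have "(i + k) $ q \<le> l + k $ q" by simp
    then show "A \<in> (\<Union>i\<in>{i. i $ q \<le> l + k $ q}. sets (Filt M T F i))" using i(2) by blast
  qed
  then show ?thesis
    unfolding sets_Filt_dir using sigma_sets_vimage_commute[of "T k" "space M" "space M"] T_space
    by (simp add: Pi_def)
qed

lemma Uu_E: "Uu k (E q l x) = E q (l + k $ q) (Uu k x)"
proof (cases "x \<in> L2_space M")
  case True
  then obtain f where f: "f \<in> L2 M" "x = emb M f" by (elim L2_spaceE)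
  note sub = subalgebra_Filt_dir
  have "AE w in M. Uop T k (real_cond_exp M (Filt_dir M T F q l) f) w =
      real_cond_exp M (Filt_dir M T F q (l + k $ q)) (Uop T k f) w"
    using cond_exp_transport[OF sub sub Filt_dir_shift L2_integrable[OF f(1)]] unfolding Uop_def by (simp add: eq_commute)
  then show ?thesis
    using f by (simp add: Uu_emb Uop_L2 emb_eq_iff ce_emb[OF sub] cond_exp_L2[OF sub])
qed (simp add: Uu_off ce_off oproj_zero[OF oproj_E])

section \<open>Regular functions\<close>

text \<open>Regularity as convergence of the directional expectations at both ends. In this form it
  passes through continuous operators that commute with the expectations or merely shift their
  index; \<open>regX_iff\<close> links it with \<open>regular\<close>.\<close>

definition regX :: "'a l2 \<Rightarrow> bool" where
  "regX x \<longleftrightarrow> x \<in> L2_space M \<and> (\<forall>q. ((\<lambda>l. E q l x) \<longlongrightarrow> x) at_top \<and> ((\<lambda>l. E q l x) \<longlongrightarrow> 0) at_bot)"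

lemma Filt_inf_eq: "sets (Filt_inf M T F) = sigma_sets (space M) (\<Union>n. sets (Filt_dir M T F q (int n)))"
  unfolding sets_Filt_inf
proof (rule sigma_sets_eqI)
  fix A assume "A \<in> (\<Union>i. sets (Filt M T F i))"
  then obtain i where i: "A \<in> sets (Filt M T F i)" by auto
  have "i $ q \<le> int (nat (i $ q))" by simp
  then have "A \<in> sets (Filt_dir M T F q (int (nat (i $ q))))"
    using i unfolding sets_Filt_dir by (intro sigma_sets.Basic) blast
  then show "A \<in> sigma_sets (space M) (\<Union>n. sets (Filt_dir M T F q (int n)))"
    by (intro sigma_sets.Basic) blast
next
  fix A assume "A \<in> (\<Union>n. sets (Filt_dir M T F q (int n)))"
  then obtain n where "A \<in> sets (Filt_dir M T F q (int n))" by auto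
  then show "A \<in> sigma_sets (space M) (\<Union>i. sets (Filt M T F i))"
    unfolding sets_Filt_dir
    using sigma_sets_mono'[of "\<Union>i\<in>{i. i $ q \<le> int n}. sets (Filt M T F i)" "\<Union>i. sets (Filt M T F i)"]
    by blast
qed

lemma regX_iff:
  "regX x \<longleftrightarrow> x \<in> L2_space M \<and> ce M (Filt_inf M T F) x = x \<and> (\<forall>q. ce M (Filt_dir_minf M T F q) x = 0)"
proof
  assume x: "x \<in> L2_space M \<and> ce M (Filt_inf M T F) x = x \<and> (\<forall>q. ce M (Filt_dir_minf M T F q) x = 0)"
  show "regX x"
    unfolding regX_def
  proof (intro conjI allI)
    fix q
    have "(\<lambda>n. E q (int n) x) \<longlonglongrightarrow> ce M (Filt_inf M T F) x"
      using x by (intro ce_upward subalgebra_Filt_dir subalgebra_Filt_inf Filt_dir_mono Filt_inf_eq) auto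
    then show "((\<lambda>l. E q l x) \<longlongrightarrow> x) at_top" using x by (intro tendsto_int_at_top) simp
    have "(\<lambda>n. E q (- int n) x) \<longlonglongrightarrow> 0"
      using x by (intro ce_downward[OF subalgebra_Filt_dir subalgebra_Filt_dir_minf Filt_dir_mono sets_Filt_dir_minf]) auto
    then show "((\<lambda>l. E q l x) \<longlongrightarrow> 0) at_bot" by (intro tendsto_int_at_bot)
  qed (use x in simp)
next
  assume reg: "regX x"
  then have x: "x \<in> L2_space M" by (simp add: regX_def)
  have "ce M (Filt_inf M T F) x = x"
  proof -
    \<comment> \<open>The index type is nonempty, and any one direction yields the claim.\<close>
    fix q :: "'d::{finite,linorder}"
    have lim: "((\<lambda>l. E q l x) \<longlongrightarrow> x) at_top" using reg by (simp add: regX_def)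
    have "subalgebra (Filt_inf M T F) (Filt_dir M T F q l)" for l
      unfolding subalgebra_def sets_Filt_dir sets_Filt_inf
      using sigma_sets_mono'[of "\<Union>i\<in>{i. i $ q \<le> l}. sets (Filt M T F i)" "\<Union>i. sets (Filt M T F i)"] by auto
    then have "ce M (Filt_inf M T F) (E q l x) = E q l x" for l
      by (rule ce_nested(2)[OF subalgebra_Filt_inf])
    then have "((\<lambda>l. E q l x) \<longlongrightarrow> ce M (Filt_inf M T F) x) at_top"
      using oproj_tendsto[OF oproj_ce[OF subalgebra_Filt_inf] E_hil x lim] by simp
    then show ?thesis using lim by (rule tendsto_unique[rotated]) simp
  qed
  moreover have "ce M (Filt_dir_minf M T F q) x = 0" for q
  proof -
    have lim: "((\<lambda>l. E q l x) \<longlongrightarrow> 0) at_bot" using reg by (simp add: regX_def)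
    have "subalgebra (Filt_dir M T F q l) (Filt_dir_minf M T F q)" for l
    proof -
      have "- int (nat (- l)) \<le> l" by simp
      then have "sets (Filt_dir_minf M T F q) \<subseteq> sets (Filt_dir M T F q l)"
        unfolding sets_Filt_dir_minf using Filt_dir_mono[of "- int (nat (- l))" l q] by blast
      then show ?thesis by (simp add: subalgebra_def)
    qed
    then have "ce M (Filt_dir_minf M T F q) (E q l x) = ce M (Filt_dir_minf M T F q) x" for l
      by (rule ce_nested(1)[OF subalgebra_Filt_dir])
    then have "((\<lambda>l::int. ce M (Filt_dir_minf M T F q) x) \<longlongrightarrow> ce M (Filt_dir_minf M T F q) 0) at_bot"
      using oproj_tendsto[OF oproj_ce[OF subalgebra_Filt_dir_minf[of q]] E_hil hil_zero lim] by simp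
    then show ?thesis
      by (simp add: tendsto_const_iff oproj_zero[OF oproj_ce[OF subalgebra_Filt_dir_minf]])
  qed
  ultimately show "x \<in> L2_space M \<and> ce M (Filt_inf M T F) x = x \<and> (\<forall>q. ce M (Filt_dir_minf M T F q) x = 0)"
    using x by simp
qed

lemma regular_iff: "f \<in> L2 M \<Longrightarrow> regular M T F f \<longleftrightarrow> regX (emb M f)"
  by (simp add: regX_iff regular_def L2_integrable ce_fixed_iff[OF subalgebra_Filt_inf]
    ce_zero_iff[OF subalgebra_Filt_dir_minf])

lemma regX_diff:
  assumes "regX x" "regX y" shows "regX (x - y)"
proof -
  have "E q l (x - y) = E q l x - E q l y" for q l
    using assms by (intro oproj_diff[OF oproj_E]) (auto simp: regX_def)
  then show ?thesis
    using assms tendsto_diff[of "\<lambda>l. E _ l x" x at_top "\<lambda>l. E _ l y" y]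
      tendsto_diff[of "\<lambda>l. E _ l x" 0 at_bot "\<lambda>l. E _ l y" 0]
    by (auto simp: regX_def hil_diff)
qed

lemma regX_zero: "regX 0"
  by (simp add: regX_def oproj_zero[OF oproj_E])

lemma regX_add: "regX x \<Longrightarrow> regX y \<Longrightarrow> regX (x + y)"
  using regX_diff[of x "0 - y"] regX_diff[OF regX_zero, of y] by simp

lemma regX_sum: "(\<And>i. i \<in> I \<Longrightarrow> regX (f i)) \<Longrightarrow> regX (\<Sum>i\<in>I. f i)"
  by (induction I rule: infinite_finite_induct) (auto simp: regX_zero regX_add)

lemma regX_Uu:
  assumes "regX x" shows "regX (Uu i x)"
proof -
  have x: "x \<in> L2_space M" using assms by (simp add: regX_def)
  have eq: "E q l (Uu i x) = Uu i (E q (l + - (i $ q)) x)" for q l by (simp add: Uu_E)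
  show ?thesis unfolding regX_def eq
  proof (intro conjI allI)
    fix q
    show "((\<lambda>l. Uu i (E q (l + - (i $ q)) x)) \<longlongrightarrow> Uu i x) at_top"
      using assms by (intro Uu_tendsto[OF _ x] tendsto_int_shift[of "\<lambda>l. E q l x"]) (auto simp: regX_def)
    show "((\<lambda>l. Uu i (E q (l + - (i $ q)) x)) \<longlongrightarrow> 0) at_bot"
      using assms Uu_tendsto[of "\<lambda>l. E q (l + - (i $ q)) x" 0 at_bot i, OF _ hil_zero tendsto_int_shift_bot[of "\<lambda>l. E q l x"]]
      by (auto simp: regX_def)
  qed simp
qed

lemma regX_oproj:
  assumes "regX x" and p: "oproj M p" and comm: "\<And>q l. E q l (p x) = p (E q l x)"
  shows "regX (p x)"
proof -
  have x: "x \<in> L2_space M" using assms by (simp add: regX_def)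
  have "((\<lambda>l. p (E q l x)) \<longlongrightarrow> p x) at_top" "((\<lambda>l. p (E q l x)) \<longlongrightarrow> p 0) at_bot" for q
    using assms(1) by (intro oproj_tendsto[OF p E_hil] x hil_zero; simp add: regX_def)+
  then show ?thesis
    unfolding regX_def comm using oproj_hil[OF p x] oproj_zero[OF p] by simp
qed

section \<open>The projections \<open>P\<^sub>k\<close>\<close>

definition Pr :: "'d::{finite,linorder} \<Rightarrow> int \<Rightarrow> 'a l2 \<Rightarrow> 'a l2" where
  "Pr q l x = E q l x - E q (l - 1) x"

definition PP :: "int ^ 'd::{finite,linorder} \<Rightarrow> 'a l2 \<Rightarrow> 'a l2" where
  "PP k = op_prod (\<lambda>q. Pr q (k $ q)) UNIV"

lemma Pr_hil [simp]: "Pr q l x \<in> L2_space M"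
  by (simp add: Pr_def hil_diff)

lemma E_Pr: "E p m (Pr q l x) = Pr q l (E p m x)"
  by (simp add: Pr_def oproj_diff[OF oproj_E] E_commute[of p m])

lemma Pr_commute: "Pr p m (Pr q l x) = Pr q l (Pr p m x)"
  by (simp add: Pr_def[of p] E_Pr) (simp add: Pr_def oproj_diff[OF oproj_E] E_commute[of p])

lemma Pr_Pr: "Pr q l (Pr q m x) = (if l = m then Pr q l x else 0)"
  by (auto simp: Pr_def oproj_diff[OF oproj_E] E_min min_def)

lemma oproj_Pr: "oproj M (Pr q l)"
  using oproj_minus[OF oproj_E[of q l] oproj_E[of q "l - 1"]] by (simp add: Pr_def[abs_def] E_min)

lemma Uu_Pr: "Uu k (Pr q l x) = Pr q (l + k $ q) (Uu k x)"
  by (simp add: Pr_def Uu_diff Uu_E algebra_simps)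

lemma PP_foldr: "PP k = foldr (\<lambda>q. Pr q (k $ q)) (sorted_list_of_set UNIV)"
  by (simp add: PP_def op_prod_def)

lemma oproj_foldr_Pr: "oproj M (foldr (\<lambda>q. Pr q (k $ q)) qs)"
proof (induction qs)
  case (Cons q qs)
  have "oproj M (\<lambda>x. Pr q (k $ q) (foldr (\<lambda>q. Pr q (k $ q)) qs x))"
    by (rule oproj_comp[OF oproj_Pr Cons]) (rule foldr_commute_all, rule Pr_commute)
  then show ?case by (simp add: comp_def)
qed (simp add: oproj_id id_def)

lemma oproj_PP: "oproj M (PP k)"
  unfolding PP_foldr by (rule oproj_foldr_Pr)

lemma Pr_PP: "Pr q l (PP k x) = PP k (Pr q l x)"
  unfolding PP_foldr by (rule foldr_commute_all) (rule Pr_commute)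

lemma Pr_PP_same: "x \<in> L2_space M \<Longrightarrow> Pr q (k $ q) (PP k x) = PP k x"
  unfolding PP_foldr
  by (rule foldr_absorb[where V = "L2_space M"]) (auto simp: Pr_commute Pr_Pr)

lemma PP_hil: "x \<in> L2_space M \<Longrightarrow> PP k x \<in> L2_space M"
  by (rule oproj_hil[OF oproj_PP])

lemma PP_PP: "x \<in> L2_space M \<Longrightarrow> PP k (PP l x) = (if k = l then PP k x else 0)"
proof (cases "k = l")
  case False
  assume x: "x \<in> L2_space M"
  from False obtain q where q: "k $ q \<noteq> l $ q" by (auto simp: vec_eq_iff)
  have "PP k (PP l x) = PP k (Pr q (l $ q) (PP l x))" using x by (simp add: Pr_PP_same)
  also have "\<dots> = Pr q (l $ q) (Pr q (k $ q) (PP k (PP l x)))"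
    by (simp only: Pr_PP[symmetric] Pr_PP_same[OF PP_hil[OF x]])
  also have "\<dots> = 0" using q by (simp add: Pr_Pr)
  finally show ?thesis using False by simp
qed (use oproj_idem[OF oproj_PP] in auto)

lemma PP_orth: "x \<in> L2_space M \<Longrightarrow> y \<in> L2_space M \<Longrightarrow> k \<noteq> l \<Longrightarrow> hip M (PP k x) (PP l y) = 0"
  using oproj_adj[OF oproj_PP, of x "PP l y" k] hip_commute[of M x 0] by (simp add: PP_hil PP_PP)

lemma Uu_PP: "Uu i (PP k x) = PP (k + i) (Uu i x)"
proof -
  have "Uu i (foldr (\<lambda>q. Pr q (k $ q)) qs x) = foldr (\<lambda>q. Pr q ((k + i) $ q)) qs (Uu i x)" for qs
    by (induction qs) (simp_all add: Uu_Pr)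
  then show ?thesis by (simp add: PP_foldr)
qed

lemma Bessel:
  assumes "x \<in> L2_space M" shows "sqsum (\<lambda>k. PP k x)"
  unfolding sqsum_def
proof (rule nonneg_bdd_above_summable_on)
  show "bdd_above (sum (\<lambda>k. (norm (PP k x))\<^sup>2) ` {K. K \<subseteq> UNIV \<and> finite K})"
  proof (rule bdd_aboveI2)
    fix K assume K: "K \<in> {K :: (int ^ 'd::{finite,linorder}) set. K \<subseteq> UNIV \<and> finite K}"
    define y where "y = (\<Sum>k\<in>K. PP k x)"
    have y: "y \<in> L2_space M" unfolding y_def by (intro hil_sum PP_hil assms)
    have xy: "hip M x y = (\<Sum>k\<in>K. (norm (PP k x))\<^sup>2)"
      using assms by (simp add: hip_commute[of M x] y_def hip_sum_left PP_hil)
        (simp add: hip_commute[of M _ x] oproj_norm_sq[OF oproj_PP])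
    have "hip M y y = (\<Sum>k\<in>K. hip M (PP k x) y)"
      unfolding y_def using assms by (intro hip_sum_left) (auto intro: PP_hil hil_sum)
    also have "\<dots> = (\<Sum>k\<in>K. (norm (PP k x))\<^sup>2)"
    proof (rule sum.cong)
      fix k assume k: "k \<in> K"
      have "PP k y = (\<Sum>l\<in>K. PP k (PP l x))"
        unfolding y_def using assms by (intro oproj_sum[OF oproj_PP] PP_hil)
      also have "\<dots> = PP k x" using assms k K by (simp add: PP_PP)
      finally show "hip M (PP k x) y = (norm (PP k x))\<^sup>2"
        using oproj_adj[OF oproj_PP assms y] oproj_norm_sq[OF oproj_PP assms] by simp
    qed simp
    finally have "0 \<le> (norm x)\<^sup>2 - (\<Sum>k\<in>K. (norm (PP k x))\<^sup>2)"
      using norm_diff_sq[OF assms y] zero_le_power2[of "norm (x - y)"] hip_self[OF y] xy by simp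
    then show "(\<Sum>k\<in>K. (norm (PP k x))\<^sup>2) \<le> (norm x)\<^sup>2" by simp
  qed
qed auto

text \<open>The factors are stripped off one at a time. If \<open>Pr q l y = 0\<close> for all
  \<open>l\<close>, then \<open>E q l y\<close> is constant in \<open>l\<close>; regularity says
  that its limits are \<open>y\<close> at one end and 0 at the other.\<close>

lemma regX_PP_zero:
  assumes "regX x" and "\<And>k. PP k x = 0"
  shows "x = 0"
proof -
  have "x = 0" if "distinct qs" "\<And>k. foldr (\<lambda>q. Pr q (k $ q)) qs x = 0" for qs
    using that
  proof (induction qs)
    case (Cons q qs)
    have "foldr (\<lambda>q. Pr q (k $ q)) qs x = 0" for k
    proof -
      define y where "y = foldr (\<lambda>q. Pr q (k $ q)) qs x"
      have "regX y" unfolding y_def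
        by (rule regX_oproj[OF assms(1) oproj_foldr_Pr]) (rule foldr_commute_all, rule E_Pr)
      then have lim: "((\<lambda>l. E q l y) \<longlongrightarrow> y) at_top" "((\<lambda>l. E q l y) \<longlongrightarrow> 0) at_bot"
        by (auto simp: regX_def)
      have step: "E q l y = E q (l - 1) y" for l
      proof -
        have "foldr (\<lambda>q. Pr q (upd k q0 l $ q)) qs x = foldr (\<lambda>q. Pr q (k $ q)) qs x" if "q0 \<notin> set qs" for q0 qs
          by (rule foldr_cong) (use that in \<open>auto simp: upd_nth\<close>)
        then have "Pr q l y = 0" using Cons.prems(1) Cons.prems(2)[of "upd k q l"] by (simp add: y_def)
        then show ?thesis by (simp add: Pr_def)
      qed
      have const: "E q l y = E q 0 y" for l
      proof (induction l rule: int_induct[of _ 0])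
        case (step1 i) then show ?case using step[of "i + 1"] by simp
      next
        case (step2 i) then show ?case using step[of i] by simp
      qed simp
      then have "(\<lambda>l. E q l y) = (\<lambda>_. E q 0 y)" by (intro ext)
      then have "y = E q 0 y" "E q 0 y = 0" using lim by (simp_all add: tendsto_const_iff)
      then show ?thesis by (simp add: y_def)
    qed
    then show ?case using Cons by auto
  qed simp
  from this[of "sorted_list_of_set UNIV"] assms(2) show ?thesis by (simp add: PP_foldr)
qed

text \<open>Terms in the ranges of different \<open>P_k\<close> are orthogonal, so the series
  converges. Continuous projections act on it termwise, which gives both the components of
  \<open>g\<close> and its regularity.\<close>

lemma synthesis:
  assumes c: "\<And>k. c k \<in> L2_space M" "\<And>k. PP k (c k) = c k" and "sqsum c"
  obtains g where "(c has_sum g) UNIV" "regX g" "\<And>k. PP k g = c k"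
proof -
  have orth: "hip M (c k) (c l) = 0" if "k \<noteq> l" for k l
    using PP_orth[OF c(1)[of k] c(1)[of l] that] by (simp add: c(2))
  obtain g where g: "(c has_sum g) UNIV" "g \<in> L2_space M"
    using orthogonal_summable[of c] c(1) orth assms(3) by metis
  have lim: "p g = 0" if "oproj M p" "\<And>k. p (c k) = 0" for p
  proof (rule has_sum_unique)
    show "((\<lambda>k. p (c k)) has_sum p g) UNIV" by (rule oproj_has_sum[OF that(1) c(1) g(2) g(1)])
    show "((\<lambda>k. p (c k)) has_sum 0) UNIV" using that(2) by simp
  qed
  have "PP k g = c k" for k
  proof -
    have "PP k (c l) = (if l = k then c k else 0)" for l
      using PP_PP[OF c(1)[of l], of k l] by (auto simp: c(2))
    then have "((\<lambda>l. if l = k then c k else 0) has_sum PP k g) UNIV"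
      using oproj_has_sum[OF oproj_PP[of k] c(1) g(2) g(1)] by simp
    moreover have "((\<lambda>l. if l = k then c k else 0) has_sum c k) UNIV"
      by (rule has_sum_finite_neutralI[of "{k}"]) auto
    ultimately show ?thesis by (rule has_sum_unique)
  qed
  moreover have "regX g"
    unfolding regX_iff
  proof (intro conjI allI)
    have E_c: "E q (k $ q) (c k) = c k" "E q (k $ q - 1) (c k) = 0" for q k
    proof -
      have *: "Pr q (k $ q) (c k) = c k" using Pr_PP_same[OF c(1)[of k], of q k] by (simp add: c(2))
      have "E q (k $ q) (Pr q (k $ q) (c k)) = Pr q (k $ q) (c k)"
        "E q (k $ q - 1) (Pr q (k $ q) (c k)) = 0"
        by (simp_all add: Pr_def oproj_diff[OF oproj_E] E_min min_def)
      then show "E q (k $ q) (c k) = c k" "E q (k $ q - 1) (c k) = 0" by (simp_all add: *)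
    qed
    have regc: "regX (c k)" for k
      unfolding regX_def
    proof (intro conjI allI)
      fix q
      have "E q l (c k) = c k" if "l \<ge> k $ q" for l
        using E_min[of q l "k $ q" "c k"] that by (simp add: E_c)
      then show "((\<lambda>l. E q l (c k)) \<longlongrightarrow> c k) at_top"
        by (intro tendsto_eventually eventually_mono[OF eventually_ge_at_top[of "k $ q"]]) simp
      have "E q l (c k) = 0" if "l \<le> k $ q - 1" for l
        using E_min[of q l "k $ q - 1" "c k"] that by (simp add: E_c oproj_zero[OF oproj_E])
      then show "((\<lambda>l. E q l (c k)) \<longlongrightarrow> 0) at_bot"
        by (intro tendsto_eventually eventually_mono[OF eventually_le_at_bot[of "k $ q - 1"]]) simp
    qed (rule c)
    show "ce M (Filt_dir_minf M T F q) g = 0" for q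
      by (rule lim[OF oproj_ce[OF subalgebra_Filt_dir_minf]]) (use regc in \<open>simp add: regX_iff\<close>)
    have "(c has_sum ce M (Filt_inf M T F) g) UNIV"
      using oproj_has_sum[OF oproj_ce[OF subalgebra_Filt_inf] c(1) g(2) g(1)] regc by (simp add: regX_iff)
    then show "ce M (Filt_inf M T F) g = g" using g(1) by (rule has_sum_unique)
  qed (rule g)
  ultimately show thesis using g(1) that by blast
qed

end

section \<open>Iterated series under continuous maps and reflections\<close>

lemma niter_closed:
  assumes "closed V" "subspace V" "\<And>k. a k \<in> V"
  shows "niter A a qs k s \<Longrightarrow> s \<in> V"
proof (induction qs arbitrary: k s)
  case (Cons q qs)
  then obtain t where t: "\<And>i. i \<in> A q \<Longrightarrow> t i \<in> V" "nsums (A q) t s" by auto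
  show ?case
    by (rule Lim_in_closed_set[OF assms(1) _ bot_top_nontrivial t(2)[unfolded nsums_def]])
      (intro always_eventually allI subspace_sum[OF assms(2)] t(1), auto)
qed (use assms in simp)

text \<open>Additivity and continuity are asked on \<open>V\<close> only, since a lifted operator is
  cut off to 0 outside \<open>L2_space\<close>.\<close>

lemma niter_map:
  assumes V: "closed V" "subspace V" "\<And>k. a k \<in> V"
    and add: "\<And>(I :: int set) f. (\<And>i. i \<in> I \<Longrightarrow> f i \<in> V) \<Longrightarrow> \<Phi> (\<Sum>i\<in>I. f i) = (\<Sum>i\<in>I. \<Phi> (f i))"
    and cont: "\<And>f s. (\<And>p. f p \<in> V) \<Longrightarrow> s \<in> V \<Longrightarrow> (f \<longlongrightarrow> s) (at_bot \<times>\<^sub>F at_top) \<Longrightarrow>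
      ((\<lambda>p. \<Phi> (f p)) \<longlongrightarrow> \<Phi> s) ((at_bot :: int filter) \<times>\<^sub>F (at_top :: int filter))"
  shows "niter A a qs k s \<Longrightarrow> niter A (\<lambda>k. \<Phi> (a k)) qs k (\<Phi> s)"
proof (induction qs arbitrary: k s)
  case (Cons q qs)
  then obtain t where t: "\<And>i. i \<in> A q \<Longrightarrow> niter A a qs (upd k q i) (t i)" "nsums (A q) t s" by auto
  have tV: "t i \<in> V" if "i \<in> A q" for i by (rule niter_closed[OF V t(1)[OF that]])
  have "nsums (A q) (\<lambda>i. \<Phi> (t i)) (\<Phi> s)"
  proof -
    have "((\<lambda>p. \<Phi> (\<Sum>i\<in>A q \<inter> {fst p..snd p}. t i)) \<longlongrightarrow> \<Phi> s) (at_bot \<times>\<^sub>F at_top)"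
      by (rule cont[OF _ niter_closed[OF V Cons.prems] t(2)[unfolded nsums_def]])
        (intro subspace_sum[OF V(2)] tV, auto)
    moreover have "\<Phi> (\<Sum>i\<in>A q \<inter> {fst p..snd p}. t i) = (\<Sum>i\<in>A q \<inter> {fst p..snd p}. \<Phi> (t i))" for p
      by (rule add) (auto intro: tV)
    ultimately show ?thesis unfolding nsums_def by simp
  qed
  moreover have "\<forall>i\<in>A q. niter A (\<lambda>k. \<Phi> (a k)) qs (upd k q i) (\<Phi> (t i))"
    using t(1) Cons.IH by blast
  ultimately show ?case unfolding niter.simps by (intro exI[of _ "\<lambda>i. \<Phi> (t i)"]) simp
qed simp

lemma niter_flip:
  assumes e: "\<And>q. e q = 1 \<or> e q = - 1"
  shows "niter A (\<lambda>i. a (\<chi> q. e q * i $ q)) qs 0 s \<longleftrightarrow> niter (\<lambda>q. (\<lambda>i. e q * i) ` A q) a qs 0 s"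
proof
  have ee: "e q * (e q * i) = i" for q i using e[of q] by auto
  have im: "(\<lambda>i. e q * i) ` (\<lambda>i. e q * i) ` A q = A q" for q by (simp add: image_image ee)
  have zero: "(\<chi> q. (0 :: int)) = 0" by (simp add: vec_eq_iff)
  show "niter (\<lambda>q. (\<lambda>i. e q * i) ` A q) a qs 0 s \<Longrightarrow> niter A (\<lambda>i. a (\<chi> q. e q * i $ q)) qs 0 s"
    using niter_affine[of e "\<lambda>_. 0" A a qs 0 s] e by (simp add: zero)
  show "niter A (\<lambda>i. a (\<chi> q. e q * i $ q)) qs 0 s \<Longrightarrow> niter (\<lambda>q. (\<lambda>i. e q * i) ` A q) a qs 0 s"
    using niter_affine[of e "\<lambda>_. 0" "\<lambda>q. (\<lambda>i. e q * i) ` A q" "\<lambda>i. a (\<chi> q. e q * i $ q)" qs 0 s] e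
    by (simp add: zero im ee)
qed

section \<open>The conditions in terms of coefficients\<close>

definition tail_condition :: "('d::{finite,linorder} set \<Rightarrow> 'd set \<Rightarrow> 'd list) \<Rightarrow> (int ^ 'd::{finite,linorder} \<Rightarrow> 'x::real_normed_vector) \<Rightarrow> bool" where
  "tail_condition ord a \<longleftrightarrow> (\<forall>S S'. S' \<subseteq> - S \<longrightarrow>
     (\<exists>\<beta>. (\<forall>j\<in>tail_index S. niter (\<lambda>q. index_set (tail_range S S' j q)) a (ord S S') 0 (\<beta> j)) \<and>
          (\<lambda>j. (norm (\<beta> j))\<^sup>2) summable_on tail_index S))"

definition quad_index :: "'d set \<Rightarrow> (int ^ 'd) set" where
  "quad_index S = {j. (\<forall>k\<in>S. j $ k \<ge> 0) \<and> (\<forall>l\<in>- S. j $ l \<le> 0)}"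

text \<open>The signs are reversed against (iii) because the coefficient at \<open>k\<close>
  involves \<open>U\<close> at \<open>- k\<close>. For \<open>j = 0\<close> both kinds of half-line
  contain 0, so, unlike for the tails, several summands of \<open>decomp\<close> may
  contribute.\<close>

definition quad_range :: "'d set \<Rightarrow> int ^ 'd \<Rightarrow> 'd \<Rightarrow> halfline" where
  "quad_range S j q = (if q \<in> S then Le (- (j $ q)) else Ge (- (j $ q)))"

definition quad_condition :: "('d::{finite,linorder} set \<Rightarrow> 'd set \<Rightarrow> 'd list) \<Rightarrow> (int ^ 'd::{finite,linorder} \<Rightarrow> 'x::real_normed_vector) \<Rightarrow> bool" where
  "quad_condition ord a \<longleftrightarrow> (\<exists>\<beta>.
     (\<forall>S. \<forall>j\<in>quad_index S. niter (\<lambda>q. index_set (quad_range S j q)) a (ord S (- S)) 0 (\<beta> S j)) \<and>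
     (\<lambda>(S, j). (norm (\<beta> S j))\<^sup>2) summable_on (SIGMA S:UNIV. quad_index S))"

definition decomposes :: "(int ^ 'd::{finite,linorder} \<Rightarrow> 'x::real_normed_vector) \<Rightarrow> ('d set \<Rightarrow> int ^ 'd::{finite,linorder} \<Rightarrow> 'x) \<Rightarrow> bool" where
  "decomposes a b \<longleftrightarrow> a = decomp b \<and> (\<forall>S. sqsum (b S) \<and> vanishing_off S (b S))"

text \<open>Up to sign the tail sums are values of the single family \<open>b S\<close>, at points
  that are distinct for distinct \<open>j\<close>.\<close>

lemma decomposes_imp_tail:
  fixes a :: "int ^ 'd::{finite,linorder} \<Rightarrow> 'x::real_normed_vector"
  assumes ord: "\<And>S S'. distinct (ord S S') \<and> set (ord S S') = UNIV" and b: "decomposes a b"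
  shows "tail_condition ord a"
  unfolding tail_condition_def
proof (intro allI impI)
  fix S S' :: "'d::{finite,linorder} set" assume S': "S' \<subseteq> - S"
  define \<beta> where "\<beta> = (\<lambda>j. (- 1) ^ card (- S - S') *\<^sub>R b S (tail_point S S' j))"
  have "niter (\<lambda>q. index_set (tail_range S S' j q)) a (ord S S') 0 (\<beta> j)" if "j \<in> tail_index S" for j
    using niter_decomp_tail[of "ord S S'" b S' S j 0] ord b S' that by (simp add: decomposes_def \<beta>_def)
  moreover have "inj_on (tail_point S S') (tail_index S)"
  proof (rule inj_onI)
    fix k l assume *: "k \<in> tail_index S" "l \<in> tail_index S" "tail_point S S' k = tail_point S S' l"
    have "k $ q = l $ q" for q
    proof -
      have "tail_point S S' k $ q = tail_point S S' l $ q" by (simp only: *(3))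
      moreover have "q \<in> S \<Longrightarrow> k $ q = l $ q" using *(1,2) by (simp add: tail_index_def)
      ultimately show ?thesis by (cases "q \<in> S"; cases "q \<in> S'") (simp_all add: tail_point_def)
    qed
    then show "k = l" by (simp add: vec_eq_iff)
  qed
  have "(\<lambda>k. (norm (b S k))\<^sup>2) summable_on tail_point S S' ` tail_index S"
    by (rule summable_on_subset[of _ UNIV]) (use b in \<open>auto simp: decomposes_def sqsum_def\<close>)
  then have "(\<lambda>j. (norm (\<beta> j))\<^sup>2) summable_on tail_index S"
    using \<open>inj_on _ _\<close> by (subst (asm) summable_on_reindex) (simp_all add: comp_def \<beta>_def)
  ultimately show "\<exists>\<beta>. (\<forall>j\<in>tail_index S. niter (\<lambda>q. index_set (tail_range S S' j q)) a (ord S S') 0 (\<beta> j)) \<and>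
      (\<lambda>j. (norm (\<beta> j))\<^sup>2) summable_on tail_index S"
    by blast
qed

lemma tail_imp_decomposes:
  fixes a :: "int ^ 'd::{finite,linorder} \<Rightarrow> 'x::real_normed_vector"
  assumes ord: "\<And>S S'. distinct (ord S S') \<and> set (ord S S') = UNIV" and tail: "tail_condition ord a"
    and V: "closed V" "subspace V" "\<And>k. a k \<in> V"
  shows "\<exists>b. decomposes a b \<and> (\<forall>S k. b S k \<in> V)"
proof -
  obtain \<beta> where \<beta>: "\<And>S S' j. S' \<subseteq> - S \<Longrightarrow> j \<in> tail_index S \<Longrightarrow>
      niter (\<lambda>q. index_set (tail_range S S' j q)) a (ord S S') 0 (\<beta> S S' j)"
    "\<And>S S'. S' \<subseteq> - S \<Longrightarrow> (\<lambda>j. (norm (\<beta> S S' j))\<^sup>2) summable_on tail_index S"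
    using tail unfolding tail_condition_def by metis
  show ?thesis
    using decomp_of_tail_sums[OF ord \<beta> V(2) niter_closed[OF V \<beta>(1)]] unfolding decomposes_def by blast
qed

lemma abs_prod_weight_le: "\<bar>\<Prod>q\<in>UNIV. weight S h q\<bar> \<le> 1" for h :: "'d::finite \<Rightarrow> halfline"
  unfolding abs_prod by (rule prod_le_1) (auto simp: weight_def split: halfline.split)

text \<open>A quadrant sum is a finite combination of values of the \<open>b R\<close> with weights
  of modulus at most 1. For fixed \<open>S\<close>, where the weight of \<open>R\<close> is nonzero
  the evaluation point determines \<open>j\<close>, so each value of \<open>b R\<close> is used at
  most once.\<close>

lemma decomposes_imp_quad:
  fixes a :: "int ^ 'd::{finite,linorder} \<Rightarrow> 'x::real_normed_vector"
  assumes ord: "\<And>S S'. distinct (ord S S') \<and> set (ord S S') = UNIV" and b: "decomposes a b"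
  shows "quad_condition ord a"
proof -
  define \<beta> where "\<beta> = (\<lambda>S j. \<Sum>R\<in>UNIV. (\<Prod>q\<in>UNIV. weight R (quad_range S j) q) *\<^sub>R b R (\<chi> q. point R (quad_range S j) q))"
  have niter: "niter (\<lambda>q. index_set (quad_range S j q)) a (ord S (- S)) 0 (\<beta> S j)" for S j
    using niter_decomp[of "ord S (- S)" b "quad_range S j" 0] ord b by (simp add: decomposes_def \<beta>_def)
  have "(\<lambda>j. (norm (\<beta> S j))\<^sup>2) summable_on quad_index S" for S
  proof -
    define P where "P R j \<longleftrightarrow> j \<in> quad_index S \<and> (\<Prod>q\<in>UNIV. weight R (quad_range S j) q) \<noteq> 0" for R j
    define \<phi> where "\<phi> R j = (\<chi> q. point R (quad_range S j) q)" for R j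
    have "sqsum (\<lambda>j. if P R j then (\<Prod>q\<in>UNIV. weight R (quad_range S j) q) *\<^sub>R b R (\<phi> R j) else 0)" for R
      unfolding sqsum_def
    proof (rule summable_on_comparison_test)
      have "inj_on (\<phi> R) {j. P R j}"
      proof (rule inj_onI)
        fix k l assume *: "k \<in> {j. P R j}" "l \<in> {j. P R j}" "\<phi> R k = \<phi> R l"
        \<comment> \<open>A nonzero weight means that 0 lies in the half-line of \<open>q\<close>;
          given the sign of \<open>j $ q\<close>, the half-line must then start at 0.\<close>
        have zero: "j $ q = 0" if "P R j" "q \<in> R" for j q
        proof -
          have "weight R (quad_range S j) q \<noteq> 0" using that(1) by (auto simp: P_def)
          moreover have "q \<in> S \<Longrightarrow> 0 \<le> j $ q" "q \<notin> S \<Longrightarrow> j $ q \<le> 0"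
            using that(1) by (auto simp: P_def quad_index_def)
          ultimately show ?thesis using that(2) by (auto simp: weight_def quad_range_def split: if_splits)
        qed
        have "k $ q = l $ q" for q
        proof (cases "q \<in> R")
          case False
          moreover have "\<phi> R k $ q = \<phi> R l $ q" by (simp only: *(3))
          ultimately show ?thesis by (cases "q \<in> S") (simp_all add: \<phi>_def point_def quad_range_def)
        qed (use * zero in simp)
        then show "k = l" by (simp add: vec_eq_iff)
      qed
      then have "sqsum (\<lambda>j. if P R j then b R (\<phi> R j) else 0)"
        using b by (intro sqsum_reindex[where A = UNIV]) (auto simp: decomposes_def sqsum_def)
      then show "(\<lambda>j. (norm (if P R j then b R (\<phi> R j) else 0))\<^sup>2) summable_on UNIV"
        by (simp add: sqsum_def)
      fix j
      have "\<bar>c\<bar> * norm v \<le> norm v" if "\<bar>c\<bar> \<le> 1" for c :: real and v :: 'x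
        using mult_right_mono[OF that, of "norm v"] by simp
      then show "(norm (if P R j then (\<Prod>q\<in>UNIV. weight R (quad_range S j) q) *\<^sub>R b R (\<phi> R j) else 0))\<^sup>2
          \<le> (norm (if P R j then b R (\<phi> R j) else 0))\<^sup>2"
        using abs_prod_weight_le[of R "quad_range S j"] by (intro power_mono) simp_all
    qed auto
    then have "sqsum (\<lambda>j. \<Sum>R\<in>UNIV. if P R j then (\<Prod>q\<in>UNIV. weight R (quad_range S j) q) *\<^sub>R b R (\<phi> R j) else 0)"
      by (intro sqsum_sum) auto
    then have "(\<lambda>j. (norm (\<Sum>R\<in>UNIV. if P R j then (\<Prod>q\<in>UNIV. weight R (quad_range S j) q) *\<^sub>R b R (\<phi> R j) else 0))\<^sup>2)
        summable_on quad_index S"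
      unfolding sqsum_def by (rule summable_on_subset) auto
    moreover have "(\<Sum>R\<in>UNIV. if P R j then (\<Prod>q\<in>UNIV. weight R (quad_range S j) q) *\<^sub>R b R (\<phi> R j) else 0) = \<beta> S j"
      if "j \<in> quad_index S" for j
      unfolding \<beta>_def \<phi>_def by (intro sum.cong) (auto simp: P_def that)
    ultimately show ?thesis by (simp cong: summable_on_cong)
  qed
  then have "(\<lambda>(S, j). (norm (\<beta> S j))\<^sup>2) summable_on (SIGMA S:UNIV. quad_index S)"
    by (intro summable_on_SigmaI[where g = "\<lambda>S. infsum (\<lambda>j. (norm (\<beta> S j))\<^sup>2) (quad_index S)"]) auto
  then show ?thesis unfolding quad_condition_def using niter by blast
qed

text \<open>The sum over the outer rays at \<open>k\<close> is the one in (iii) with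
  \<open>S = neg_part k\<close> and \<open>j = - k\<close>. Its order depends on \<open>k\<close>
  through \<open>neg_part k\<close> alone, which outward steps preserve.\<close>

lemma quad_imp_decomposes:
  fixes a :: "int ^ 'd::{finite,linorder} \<Rightarrow> 'x::real_normed_vector"
  assumes ord: "\<And>S S'. distinct (ord S S') \<and> set (ord S S') = UNIV" and quad: "quad_condition ord a"
    and V: "closed V" "subspace V" "\<And>k. a k \<in> V"
  shows "\<exists>b. decomposes a b \<and> (\<forall>S k. b S k \<in> V)"
proof -
  obtain \<beta> where \<beta>: "\<And>S j. j \<in> quad_index S \<Longrightarrow> niter (\<lambda>q. index_set (quad_range S j q)) a (ord S (- S)) 0 (\<beta> S j)"
    and sq: "(\<lambda>(S, j). (norm (\<beta> S j))\<^sup>2) summable_on (SIGMA S:UNIV. quad_index S)"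
    using quad unfolding quad_condition_def by blast
  define c where "c k = \<beta> (neg_part k) (- k)" for k
  have idx: "- k \<in> quad_index (neg_part k)" for k
    by (auto simp: quad_index_def neg_part_def)
  have c: "niter (index_box {} {} k) a (ord (neg_part k) (- neg_part k)) 0 (c k)" for k
  proof -
    have "(\<lambda>q. index_set (quad_range (neg_part k) (- k) q)) = index_box {} {} k"
      by (auto simp: fun_eq_iff quad_range_def index_box_def outer_ray_def neg_part_def)
    then show ?thesis using \<beta>[OF idx[of k]] by (simp add: c_def)
  qed
  have "sqsum c"
  proof -
    have "inj (\<lambda>k. (neg_part k, - k))" by (auto intro: injI)
    moreover have "(\<lambda>(S, j). (norm (\<beta> S j))\<^sup>2) summable_on range (\<lambda>k. (neg_part k, - k))"
      using sq by (rule summable_on_subset) (use idx in auto)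
    ultimately show ?thesis
      unfolding sqsum_def by (subst (asm) summable_on_reindex) (simp_all add: comp_def c_def)
  qed
  moreover have "neg_part (outward q k) = neg_part k" for q and k :: "int ^ 'd::{finite,linorder}"
    by (auto simp: neg_part_def outward_def upd_nth split: if_splits)
  moreover have "c k \<in> V" for k by (rule niter_closed[OF V c])
  ultimately show ?thesis
    using decomp_of_quadrant_sums[of "\<lambda>k. ord (neg_part k) (- neg_part k)" a c V] ord c V(2)
    unfolding decomposes_def by auto
qed

lemma hip_scale_left: "x \<in> L2_space M \<Longrightarrow> y \<in> L2_space M \<Longrightarrow> hip M (c *\<^sub>R x) y = c * hip M x y"
  by (elim L2_spaceE) (simp add: emb_cmult[symmetric] hip_emb L2_cmult mult.assoc L2_mult_integrable)

text \<open>By self-adjointness both sides have the same inner product with their difference, which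
  is therefore orthogonal to itself.\<close>

lemma oproj_scale:
  assumes p: "oproj M p" and x: "x \<in> L2_space M"
  shows "p (c *\<^sub>R x) = c *\<^sub>R p x"
proof -
  let ?z = "p (c *\<^sub>R x) - c *\<^sub>R p x"
  have px: "p x \<in> L2_space M" "p (c *\<^sub>R x) \<in> L2_space M" "c *\<^sub>R p x \<in> L2_space M"
    using x by (auto intro: oproj_hil[OF p] hil_scale)
  then have z: "?z \<in> L2_space M" by (auto intro: hil_diff)
  have "hip M (p (c *\<^sub>R x)) ?z = hip M (c *\<^sub>R p x) ?z"
    using x z by (simp add: oproj_adj[OF p] hil_scale hip_scale_left oproj_hil[OF p])
  then have "hip M ?z ?z = 0" using hip_diff_left[OF px(2,3) z] by simp
  then show ?thesis using hip_self[OF z] by simp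
qed

context completely_commuting_filtration
begin

section \<open>Coefficients\<close>

text \<open>Shifting \<open>P_k x\<close> back by \<open>k\<close> puts all coefficients into one
  space, the range of \<open>P_0\<close>. These are the vectors that (ii) and (iii) sum.\<close>

definition coef :: "'a l2 \<Rightarrow> int ^ 'd::{finite,linorder} \<Rightarrow> 'a l2" where
  "coef x k = PP 0 (Uu (- k) x)"

text \<open>The range of \<open>P\<^sub>0\<close>, where all coefficients live.\<close>
definition innovations :: "'a l2 set" where
  "innovations = {y \<in> L2_space M. PP 0 y = y}"

lemma coef_eq: "coef x k = Uu (- k) (PP k x)"
  by (simp add: coef_def Uu_PP)

lemma Uu_coef: "x \<in> L2_space M \<Longrightarrow> Uu k (coef x k) = PP k x"
  by (simp add: coef_eq Uu_Uu Uu_id PP_hil)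

lemma coef_in_innovations: "coef x k \<in> innovations"
  by (simp add: innovations_def coef_def PP_hil PP_PP)

lemma innovations_hil: "y \<in> innovations \<Longrightarrow> y \<in> L2_space M"
  by (simp add: innovations_def)

lemma subspace_innovations: "subspace innovations"
  by (rule subspaceI) (auto simp: innovations_def oproj_zero[OF oproj_PP] oproj_add[OF oproj_PP] oproj_scale[OF oproj_PP]
    intro: hil_add hil_scale)

lemma closed_innovations: "closed innovations"
  unfolding closed_sequential_limits
proof (intro allI impI, elim conjE)
  fix f l assume f: "\<forall>n. f n \<in> innovations" "f \<longlonglongrightarrow> l"
  then have fh: "f n \<in> L2_space M" "PP 0 (f n) = f n" for n by (auto simp: innovations_def)
  have l: "l \<in> L2_space M" by (rule LIM_in_hil[OF closed_hil fh(1) f(2)]) simp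
  have "f \<longlonglongrightarrow> PP 0 l"
    using oproj_tendsto[OF oproj_PP fh(1) l f(2), of 0] by (simp add: fh(2))
  then have "PP 0 l = l" using f(2) LIMSEQ_unique by blast
  then show "l \<in> innovations" using l by (simp add: innovations_def)
qed

lemma norm_coef: "x \<in> L2_space M \<Longrightarrow> norm (coef x k) = norm (PP k x)"
  by (simp add: coef_eq Uu_norm PP_hil)

lemma sqsum_coef: "x \<in> L2_space M \<Longrightarrow> sqsum (coef x)"
  using Bessel[of x] by (simp add: sqsum_def norm_coef)

lemma coef_diff: "x \<in> L2_space M \<Longrightarrow> y \<in> L2_space M \<Longrightarrow> coef (x - y) k = coef x k - coef y k"
  by (simp add: coef_def Uu_diff oproj_diff[OF oproj_PP])

lemma coef_zero: "coef 0 k = 0"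
  by (simp add: coef_def oproj_zero[OF oproj_PP])

lemma coef_add: "x \<in> L2_space M \<Longrightarrow> y \<in> L2_space M \<Longrightarrow> coef (x + y) k = coef x k + coef y k"
  by (simp add: coef_def Uu_add oproj_add[OF oproj_PP])

lemma coef_sum: "(\<And>i. i \<in> I \<Longrightarrow> f i \<in> L2_space M) \<Longrightarrow> coef (\<Sum>i\<in>I. f i) k = (\<Sum>i\<in>I. coef (f i) k)"
  by (induction I rule: infinite_finite_induct) (auto simp: coef_zero coef_add hil_sum)

lemma regX_coef_zero: "regX x \<Longrightarrow> (\<And>k. coef x k = 0) \<Longrightarrow> x = 0"
  by (rule regX_PP_zero) (auto simp flip: Uu_coef simp: regX_def)

definition one_minus_U :: "'d::{finite,linorder} \<Rightarrow> 'a l2 \<Rightarrow> 'a l2" where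
  "one_minus_U q x = x - Uu (axis q 1) x"

lemma one_minus_U_hil: "x \<in> L2_space M \<Longrightarrow> one_minus_U q x \<in> L2_space M"
  by (simp add: one_minus_U_def hil_diff)

lemma coef_one_minus_U: "x \<in> L2_space M \<Longrightarrow> coef (one_minus_U q x) = diffq q (coef x)"
proof
  fix k assume x: "x \<in> L2_space M"
  have "- k + axis q 1 = - upd k q (k $ q - 1)"
    by (simp add: vec_eq_iff upd_nth axis_def)
  then show "coef (one_minus_U q x) k = diffq q (coef x) k"
    using x by (simp add: one_minus_U_def coef_diff diffq_def) (simp add: coef_def Uu_Uu)
qed

lemma op_prod_one_minus_U:
  assumes "x \<in> L2_space M"
  shows "op_prod one_minus_U Q x \<in> L2_space M \<and> coef (op_prod one_minus_U Q x) = op_prod diffq Q (coef x)"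
proof -
  have "foldr one_minus_U qs x \<in> L2_space M \<and> coef (foldr one_minus_U qs x) = foldr diffq qs (coef x)" for qs
    by (induction qs) (auto simp: assms one_minus_U_hil coef_one_minus_U)
  then show ?thesis by (simp add: op_prod_def)
qed

lemma regX_op_prod_one_minus_U: "regX x \<Longrightarrow> regX (op_prod one_minus_U Q x)"
proof -
  assume "regX x"
  then have "regX (foldr one_minus_U qs x)" for qs
    by (induction qs) (auto simp: one_minus_U_def intro: regX_diff regX_Uu)
  then show ?thesis by (simp add: op_prod_def)
qed

lemma op_prod_I_minus_U:
  assumes "g \<in> L2 M"
  shows "op_prod (I_minus_U T) Q g \<in> L2 M \<and> emb M (op_prod (I_minus_U T) Q g) = op_prod one_minus_U Q (emb M g)"
proof -
  have "foldr (I_minus_U T) qs g \<in> L2 M \<and> emb M (foldr (I_minus_U T) qs g) = foldr one_minus_U qs (emb M g)" for qs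
  proof (induction qs)
    case (Cons q qs)
    let ?h = "foldr (I_minus_U T) qs g"
    have "Uop T (axis q 1) ?h \<in> L2 M" using Cons by (intro Uop_L2) auto
    then show ?case using Cons L2_diff[of ?h M "Uop T (axis q 1) ?h"] emb_diff[of ?h M "Uop T (axis q 1) ?h"]
      by (simp add: I_minus_U_def[of T q ?h] one_minus_U_def[of q] Uu_emb[symmetric])
  qed (simp add: assms)
  then show ?thesis by (simp add: op_prod_def)
qed

lemma emb_Proj1: "h \<in> L2 M \<Longrightarrow> Proj1 M T F q l h \<in> L2 M \<and> emb M (Proj1 M T F q l h) = Pr q l (emb M h)"
  using cond_exp_L2[OF subalgebra_Filt_dir, of h]
  by (simp add: Proj1_def L2_diff emb_diff Pr_def ce_emb[OF subalgebra_Filt_dir])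

lemma emb_Proj:
  assumes "h \<in> L2 M"
  shows "Proj M T F k h \<in> L2 M" "emb M (Proj M T F k h) = PP k (emb M h)"
proof -
  have "foldr (\<lambda>q. Proj1 M T F q (k $ q)) qs h \<in> L2 M \<and>
      emb M (foldr (\<lambda>q. Proj1 M T F q (k $ q)) qs h) = foldr (\<lambda>q. Pr q (k $ q)) qs (emb M h)" for qs
    by (induction qs) (auto simp: assms emb_Proj1)
  then show "Proj M T F k h \<in> L2 M" "emb M (Proj M T F k h) = PP k (emb M h)"
    by (simp_all add: Proj_def op_prod_def PP_foldr)
qed

lemma emb_Proj_Uop:
  assumes "f \<in> L2 M"
  shows "emb M (Proj M T F k (Uop T i f)) = Uu k (coef (emb M f) (k - i))"
  using assms by (simp add: emb_Proj Uop_L2 Uu_emb[symmetric] coef_def Uu_PP Uu_Uu)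

lemma L2_minus_iff:
  assumes "g \<in> L2 M"
  shows "g \<in> L2_minus M (Filt_dir M T F q 0) (Filt_dir M T F q (- 1)) \<longleftrightarrow> Pr q 0 (emb M g) = emb M g"
proof -
  have "g \<in> L2_minus M (Filt_dir M T F q 0) (Filt_dir M T F q (- 1)) \<longleftrightarrow>
      E q 0 (emb M g) = emb M g \<and> E q (- 1) (emb M g) = 0"
    using assms by (simp add: L2_minus_def ce_fixed_iff[OF subalgebra_Filt_dir] ce_zero_iff[OF subalgebra_Filt_dir])
  also have "\<dots> \<longleftrightarrow> Pr q 0 (emb M g) = emb M g"
  proof
    assume *: "Pr q 0 (emb M g) = emb M g"
    have "E q 0 (Pr q 0 (emb M g)) = Pr q 0 (emb M g)" "E q (- 1) (Pr q 0 (emb M g)) = 0"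
      by (simp_all add: Pr_def oproj_diff[OF oproj_E] E_min)
    then show "E q 0 (emb M g) = emb M g \<and> E q (- 1) (emb M g) = 0" by (simp add: *)
  qed (simp add: Pr_def)
  finally show ?thesis .
qed

lemma vanishing_coef:
  assumes "x \<in> L2_space M" "\<And>q. q \<in> S \<Longrightarrow> Pr q 0 x = x"
  shows "vanishing_off S (coef x)"
  unfolding vanishing_off_def
proof (intro allI impI)
  fix k :: "int ^ 'd::{finite,linorder}" assume "\<exists>q\<in>S. k $ q \<noteq> 0"
  then obtain q where q: "q \<in> S" "k $ q \<noteq> 0" by blast
  have "PP k x = Pr q (k $ q) (PP k (Pr q 0 x))" using assms q by (simp add: Pr_PP_same)
  also have "\<dots> = 0" using q(2) by (simp add: Pr_PP Pr_Pr oproj_zero[OF oproj_PP])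
  finally show "coef x k = 0" by (simp add: coef_eq)
qed

text \<open>Both the membership of \<open>g S\<close> and the identity for \<open>f\<close> compare
  regular vectors, and such vectors are determined by their components.\<close>

lemma mc_decomposition_iff:
  assumes f: "f \<in> L2 M" "regX (emb M f)" and g: "\<And>S. g S \<in> L2 M" "\<And>S. regX (emb M (g S))"
    and v: "\<And>S. vanishing_off S (coef (emb M (g S)))"
    and eq: "coef (emb M f) = decomp (\<lambda>S. coef (emb M (g S)))"
  shows "mc_decomposition M T F f g"
  unfolding mc_decomposition_def
proof (intro conjI allI ballI)
  fix S and q :: "'d::{finite,linorder}" assume q: "q \<in> S"
  let ?G = "emb M (g S)"
  have G: "?G \<in> L2_space M" using g by simp
  have "Pr q 0 ?G - ?G = 0"
  proof (rule regX_PP_zero)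
    show "regX (Pr q 0 ?G - ?G)"
      by (intro regX_diff regX_oproj[OF g(2) oproj_Pr] E_Pr g(2))
    fix k
    show "PP k (Pr q 0 ?G - ?G) = 0"
    proof (cases "k $ q = 0")
      case True
      then show ?thesis using Pr_PP_same[OF G, of q k] G by (simp add: oproj_diff[OF oproj_PP] Pr_PP)
    next
      case False
      then have "PP k ?G = 0" using v[of S] q Uu_coef[OF G, of k] by (auto simp: vanishing_off_def)
      then show ?thesis using G by (simp add: oproj_diff[OF oproj_PP] oproj_zero[OF oproj_Pr] flip: Pr_PP)
    qed
  qed
  then show "g S \<in> L2_minus M (Filt_dir M T F q 0) (Filt_dir M T F q (- 1))"
    using g by (simp add: L2_minus_iff)
next
  have sum: "(\<lambda>x. \<Sum>S\<in>UNIV. op_prod (I_minus_U T) (- S) (g S) x) \<in> L2 M"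
    using op_prod_I_minus_U g by (intro L2_sum) auto
  define s where "s = (\<Sum>S\<in>UNIV. op_prod one_minus_U (- S) (emb M (g S)))"
  have s: "emb M (\<lambda>x. \<Sum>S\<in>UNIV. op_prod (I_minus_U T) (- S) (g S) x) = s"
    using op_prod_I_minus_U[OF g(1)] by (subst emb_sum) (auto simp: s_def)
  have "coef s = decomp (\<lambda>S. coef (emb M (g S)))"
    using op_prod_one_minus_U g by (auto simp: s_def decomp_def fun_eq_iff coef_sum)
  moreover have regs: "regX s"
    unfolding s_def by (rule regX_sum) (rule regX_op_prod_one_minus_U[OF g(2)])
  then have "s \<in> L2_space M" by (simp add: regX_def)
  ultimately have "coef (emb M f - s) k = 0" for k
    using f(1) eq by (simp add: coef_diff)
  then have "emb M f - s = 0"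
    by (rule regX_coef_zero[OF regX_diff[OF f(2) regs]])
  then show "AE x in M. f x = (\<Sum>S\<in>UNIV. op_prod (I_minus_U T) (- S) (g S) x)"
    using f sum s by (simp flip: emb_eq_iff)
qed (rule g)

text \<open>Coefficients see only the projections \<open>P_k\<close> of the \<open>g S\<close>. This
  is how an arbitrary decomposition can be replaced by a regular one.\<close>

lemma mc_decomposition_decomposes:
  assumes f: "f \<in> L2 M" and mc: "mc_decomposition M T F f g"
  shows "decomposes (coef (emb M f)) (\<lambda>S. coef (emb M (g S)))"
proof -
  have g: "g S \<in> L2 M" "q \<in> S \<Longrightarrow> Pr q 0 (emb M (g S)) = emb M (g S)" for S q
    using mc by (auto simp: mc_decomposition_def L2_minus_iff[symmetric])
  have sum: "(\<lambda>x. \<Sum>S\<in>UNIV. op_prod (I_minus_U T) (- S) (g S) x) \<in> L2 M"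
    using op_prod_I_minus_U g by (intro L2_sum) auto
  have "emb M f = emb M (\<lambda>x. \<Sum>S\<in>UNIV. op_prod (I_minus_U T) (- S) (g S) x)"
    using f sum mc by (simp add: emb_eq_iff mc_decomposition_def)
  also have "\<dots> = (\<Sum>S\<in>UNIV. op_prod one_minus_U (- S) (emb M (g S)))"
    using op_prod_I_minus_U[OF g(1)] by (subst emb_sum) auto
  finally have "coef (emb M f) = decomp (\<lambda>S. coef (emb M (g S)))"
    using op_prod_one_minus_U g(1) by (auto simp: decomp_def fun_eq_iff coef_sum)
  then show ?thesis
    using g by (auto simp: decomposes_def intro: sqsum_coef vanishing_coef)
qed

text \<open>Since \<open>b S k\<close> lies in the range of \<open>P_0\<close>, its shift by
  \<open>k\<close> lies in that of \<open>P_k\<close>, so \<open>synthesis\<close> yields a regular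
  function with these components.\<close>

lemma decomposes_mc_decomposition:
  assumes f: "f \<in> L2 M" "regX (emb M f)" and b: "decomposes (coef (emb M f)) b" "\<And>S k. b S k \<in> innovations"
  shows "\<exists>g. mc_decomposition M T F f g \<and> (\<forall>S. regular M T F (g S))"
proof -
  have "\<exists>g. g \<in> L2 M \<and> regX (emb M g) \<and> coef (emb M g) = b S" for S
  proof -
    have b0: "PP 0 (b S k) = b S k" "b S k \<in> L2_space M" for k using b(2) by (auto simp: innovations_def)
    have 1: "PP k (Uu k (b S k)) = Uu k (b S k)" for k
      using Uu_PP[of k 0 "b S k"] by (simp add: b0)
    have 2: "sqsum (\<lambda>k. Uu k (b S k))" using b by (simp add: decomposes_def sqsum_def Uu_norm b0)
    obtain G where G: "regX G" "\<And>k. PP k G = Uu k (b S k)"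
      using synthesis[of "\<lambda>k. Uu k (b S k)", OF Uu_hil 1 2] by metis
    then obtain g where "g \<in> L2 M" "G = emb M g" by (auto simp: regX_def elim: L2_spaceE)
    moreover have "coef G = b S" by (simp add: fun_eq_iff coef_eq G Uu_Uu Uu_id b0)
    ultimately show ?thesis using G(1) by auto
  qed
  then obtain g where g: "\<And>S. g S \<in> L2 M" "\<And>S. regX (emb M (g S))" "\<And>S. coef (emb M (g S)) = b S" by metis
  have "mc_decomposition M T F f g"
    using b by (intro mc_decomposition_iff f g) (auto simp: g decomposes_def)
  then show ?thesis using g regular_iff by blast
qed

section \<open>Transfer of the conditions\<close>

text \<open>\<open>e\<close> is the sign pattern that turns the summation index into the index of
  the coefficient; the extra minus sign in \<open>idx\<close> is the one in
  \<open>coef_def\<close>.\<close>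

lemma multi_sums_iff:
  assumes f: "f \<in> L2 M" and e: "\<And>q. e q = 1 \<or> e q = - 1"
    and idx: "\<And>i. idx i = (\<chi> q. - (e q * i $ q))"
  shows "multi_sums M qs A (\<lambda>i. Proj M T F 0 (Uop T (idx i) f)) s \<Longrightarrow>
      niter (\<lambda>q. (\<lambda>i. e q * i) ` A q) (coef (emb M f)) qs 0 (emb M s)"
    and "niter (\<lambda>q. (\<lambda>i. e q * i) ` A q) (coef (emb M f)) qs 0 x \<Longrightarrow>
      \<exists>s. multi_sums M qs A (\<lambda>i. Proj M T F 0 (Uop T (idx i) f)) s \<and> emb M s = x"
proof -
  have L2: "Proj M T F 0 (Uop T (idx i) f) \<in> L2 M" for i
    using f by (intro emb_Proj Uop_L2)
  have "- idx i = (\<chi> q. e q * i $ q)" for i by (simp add: idx vec_eq_iff)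
  then have eq: "emb M (Proj M T F 0 (Uop T (idx i) f)) = coef (emb M f) (\<chi> q. e q * i $ q)" for i
    using f emb_Proj_Uop[OF f, of 0 "idx i"] innovations_hil[OF coef_in_innovations] by (simp add: Uu_id)
  show "multi_sums M qs A (\<lambda>i. Proj M T F 0 (Uop T (idx i) f)) s \<Longrightarrow>
      niter (\<lambda>q. (\<lambda>i. e q * i) ` A q) (coef (emb M f)) qs 0 (emb M s)"
    unfolding multi_sums_def
    using iter_sums_imp_niter[where a = "\<lambda>i. Proj M T F 0 (Uop T (idx i) f)", OF L2] niter_flip[where e = e and A = A and a = "coef (emb M f)" and qs = qs and s = "emb M s", OF e] by (simp add: eq)
  show "niter (\<lambda>q. (\<lambda>i. e q * i) ` A q) (coef (emb M f)) qs 0 x \<Longrightarrow>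
      \<exists>s. multi_sums M qs A (\<lambda>i. Proj M T F 0 (Uop T (idx i) f)) s \<and> emb M s = x"
    unfolding multi_sums_def
    using niter_imp_iter_sums[where a = "\<lambda>i. Proj M T F 0 (Uop T (idx i) f)", OF L2] niter_flip[where e = e and A = A and a = "coef (emb M f)" and qs = qs and s = x, OF e] by (simp add: eq)
qed

lemma multi_sums_L2: "multi_sums M qs A a s \<Longrightarrow> s \<in> L2 M"
  unfolding multi_sums_def by (rule iter_sums_L2)

lemma uminus_image: "(\<lambda>i. - 1 * i) ` {n..} = {..- n}" "(\<lambda>i. - 1 * i) ` {..n} = {- n..}" for n :: int
  by (auto simp: image_iff intro: bexI[of _ "- x" for x])

lemma condition_ii_iff:
  assumes f: "f \<in> L2 M"
  shows "condition_ii ord M T F f \<longleftrightarrow> tail_condition ord (coef (emb M f))"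
proof -
  \<comment> \<open>Passing to coefficients negates the index of \<open>U\<close>: this reverses
    \<open>i_r\<close> and \<open>i_u\<close>, and undoes the minus sign that \<open>i_v\<close>
    already carries.\<close>
  define e where "e S S' q = (if q \<in> S \<union> S' then - 1 else 1 :: int)" for S S' and q :: "'d::{finite,linorder}"
  let ?A = "\<lambda>S j q. if q \<in> S then UNIV else {j $ q ..}"
  let ?a = "\<lambda>S S' i. Proj M T F 0 (Uop T (idx_U S S' i) f)"
  have range: "(\<lambda>q. (\<lambda>i. e S S' q * i) ` ?A S j q) = (\<lambda>q. index_set (tail_range S S' j q))"
    if "S' \<subseteq> - S" for S S' and j :: "int ^ 'd::{finite,linorder}"
  proof
    fix q
    have "(\<lambda>i. - 1 * i) ` UNIV = (UNIV :: int set)" by (auto simp: image_iff intro: exI[of _ "- x" for x])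
    then show "(\<lambda>i. e S S' q * i) ` ?A S j q = index_set (tail_range S S' j q)"
      using that uminus_image by (auto simp: e_def tail_range_def simp del: mult_minus1)
  qed
  have iff: "(\<exists>b. (\<forall>j\<in>tail_index S. multi_sums M (ord S S') (?A S j) (?a S S') (b j)) \<and>
        (\<lambda>j. (l2norm M (b j))\<^sup>2) summable_on tail_index S) \<longleftrightarrow>
      (\<exists>\<beta>. (\<forall>j\<in>tail_index S. niter (\<lambda>q. index_set (tail_range S S' j q)) (coef (emb M f)) (ord S S') 0 (\<beta> j)) \<and>
        (\<lambda>j. (norm (\<beta> j))\<^sup>2) summable_on tail_index S)"
    if S': "S' \<subseteq> - S" for S S'
  proof -
    have idx: "idx_U S S' i = (\<chi> q. - (e S S' q * i $ q))" for i
      by (simp add: idx_U_def e_def vec_eq_iff)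
    have e1: "e S S' q = 1 \<or> e S S' q = - 1" for q by (simp add: e_def)
    note iffs = multi_sums_iff[OF f, of "e S S'" "idx_U S S'", OF e1 idx]
    show ?thesis
    proof (intro iffI; elim exE conjE)
      fix b assume b: "\<forall>j\<in>tail_index S. multi_sums M (ord S S') (?A S j) (?a S S') (b j)"
        "(\<lambda>j. (l2norm M (b j))\<^sup>2) summable_on tail_index S"
      have "niter (\<lambda>q. index_set (tail_range S S' j q)) (coef (emb M f)) (ord S S') 0 (emb M (b j))"
        if "j \<in> tail_index S" for j
        using iffs(1)[of "ord S S'" "?A S j" "b j"] b(1) that unfolding range[OF S'] by blast
      moreover have "b j \<in> L2 M" if "j \<in> tail_index S" for j
        using b(1) multi_sums_L2 that by blast
      then have "(\<lambda>j. (norm (emb M (b j)))\<^sup>2) summable_on tail_index S"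
        using b(2) by (subst summable_on_cong[of _ _ "\<lambda>j. (l2norm M (b j))\<^sup>2"]) (auto simp: norm_emb)
      ultimately show "\<exists>\<beta>. (\<forall>j\<in>tail_index S. niter (\<lambda>q. index_set (tail_range S S' j q)) (coef (emb M f)) (ord S S') 0 (\<beta> j)) \<and>
        (\<lambda>j. (norm (\<beta> j))\<^sup>2) summable_on tail_index S"
        by (intro exI[of _ "\<lambda>j. emb M (b j)"]) simp
    next
      fix \<beta> assume \<beta>: "\<forall>j\<in>tail_index S. niter (\<lambda>q. index_set (tail_range S S' j q)) (coef (emb M f)) (ord S S') 0 (\<beta> j)"
        "(\<lambda>j. (norm (\<beta> j))\<^sup>2) summable_on tail_index S"
      have "\<forall>j\<in>tail_index S. \<exists>s. multi_sums M (ord S S') (?A S j) (?a S S') s \<and> emb M s = \<beta> j"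
      proof
        fix j assume "j \<in> tail_index S"
        with \<beta>(1) have "niter (\<lambda>q. index_set (tail_range S S' j q)) (coef (emb M f)) (ord S S') 0 (\<beta> j)" by blast
        then show "\<exists>s. multi_sums M (ord S S') (?A S j) (?a S S') s \<and> emb M s = \<beta> j"
          by (intro iffs(2)) (simp only: range[OF S'])
      qed
      from bchoice[OF this] obtain b where
        b: "\<forall>j\<in>tail_index S. multi_sums M (ord S S') (?A S j) (?a S S') (b j) \<and> emb M (b j) = \<beta> j"
        by (elim exE)
      have "l2norm M (b j) = norm (\<beta> j)" if "j \<in> tail_index S" for j
      proof -
        note * = bspec[OF b that]
        show ?thesis by (simp only: norm_emb[OF multi_sums_L2[OF conjunct1[OF *]], symmetric] conjunct2[OF *])
      qed
      then have "(\<lambda>j. (l2norm M (b j))\<^sup>2) summable_on tail_index S"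
        using \<beta>(2) by (subst summable_on_cong[of _ _ "\<lambda>j. (norm (\<beta> j))\<^sup>2"]) auto
      with b show "\<exists>b. (\<forall>j\<in>tail_index S. multi_sums M (ord S S') (?A S j) (?a S S') (b j)) \<and>
        (\<lambda>j. (l2norm M (b j))\<^sup>2) summable_on tail_index S"
        by blast
    qed
  qed
  show ?thesis
    unfolding condition_ii_def tail_condition_def Let_def tail_index_def[symmetric]
    by (intro iff_allI imp_cong refl iff)
qed

lemma condition_iii_iff:
  assumes f: "f \<in> L2 M"
  shows "condition_iii ord M T F f \<longleftrightarrow> quad_condition ord (coef (emb M f))"
proof -
  let ?A = "\<lambda>S j q. if q \<in> S then {j $ q ..} else {.. j $ q}"
  let ?a = "\<lambda>i. Proj M T F 0 (Uop T i f)"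
  have range: "(\<lambda>q. (\<lambda>i. - 1 * i) ` ?A S j q) = (\<lambda>q. index_set (quad_range S j q))"
    for S and j :: "int ^ 'd::{finite,linorder}"
    using uminus_image by (auto simp: fun_eq_iff quad_range_def simp del: mult_minus1)
  have idx: "i = (\<chi> q. - (- 1 * i $ q))" for i :: "int ^ 'd::{finite,linorder}"
    by (simp add: vec_eq_iff)
  have e1: "(- 1 :: int) = 1 \<or> (- 1 :: int) = - 1" by simp
  note iffs = multi_sums_iff[OF f, of "\<lambda>_. - 1" "\<lambda>i. i", OF e1 idx]
  show ?thesis
    unfolding condition_iii_def quad_condition_def Let_def quad_index_def[symmetric]
  proof (intro iffI; elim exE conjE)
    fix b assume b: "\<forall>S. \<forall>j\<in>quad_index S. multi_sums M (ord S (- S)) (?A S j) ?a (b S j)"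
      "(\<lambda>(S, j). (l2norm M (b S j))\<^sup>2) summable_on (SIGMA S:UNIV. quad_index S)"
    have "niter (\<lambda>q. index_set (quad_range S j q)) (coef (emb M f)) (ord S (- S)) 0 (emb M (b S j))"
      if "j \<in> quad_index S" for S j
      using iffs(1)[of "ord S (- S)" "?A S j" "b S j"] b(1) that unfolding range by blast
    moreover have "b S j \<in> L2 M" if "j \<in> quad_index S" for S j
      using b(1) multi_sums_L2 that by blast
    then have "(\<lambda>(S, j). (norm (emb M (b S j)))\<^sup>2) summable_on (SIGMA S:UNIV. quad_index S)"
      using b(2)
      by (subst summable_on_cong[of _ _ "\<lambda>(S, j). (l2norm M (b S j))\<^sup>2"]) (auto simp: norm_emb)
    ultimately show "\<exists>\<beta>. (\<forall>S. \<forall>j\<in>quad_index S.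
        niter (\<lambda>q. index_set (quad_range S j q)) (coef (emb M f)) (ord S (- S)) 0 (\<beta> S j)) \<and>
      (\<lambda>(S, j). (norm (\<beta> S j))\<^sup>2) summable_on (SIGMA S:UNIV. quad_index S)"
      by (intro exI[of _ "\<lambda>S j. emb M (b S j)"]) simp
  next
    fix \<beta> assume \<beta>: "\<forall>S. \<forall>j\<in>quad_index S.
        niter (\<lambda>q. index_set (quad_range S j q)) (coef (emb M f)) (ord S (- S)) 0 (\<beta> S j)"
      "(\<lambda>(S, j). (norm (\<beta> S j))\<^sup>2) summable_on (SIGMA S:UNIV. quad_index S)"
    have "\<forall>S. \<forall>j\<in>quad_index S. \<exists>s. multi_sums M (ord S (- S)) (?A S j) ?a s \<and> emb M s = \<beta> S j"
    proof (intro allI ballI)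
      fix S :: "'d::{finite,linorder} set" and j :: "int ^ 'd::{finite,linorder}" assume "j \<in> quad_index S"
      with \<beta>(1) have "niter (\<lambda>q. index_set (quad_range S j q)) (coef (emb M f)) (ord S (- S)) 0 (\<beta> S j)" by blast
      then have "niter (\<lambda>q. (\<lambda>i. - 1 * i) ` ?A S j q) (coef (emb M f)) (ord S (- S)) 0 (\<beta> S j)"
        unfolding range .
      then show "\<exists>s. multi_sums M (ord S (- S)) (?A S j) ?a s \<and> emb M s = \<beta> S j"
        by (rule iffs(2))
    qed
    then have "\<forall>S. \<exists>b. \<forall>j\<in>quad_index S. multi_sums M (ord S (- S)) (?A S j) ?a (b j) \<and> emb M (b j) = \<beta> S j"
      by (intro allI bchoice) blast
    from choice[OF this] obtain b where
      b: "\<forall>S. \<forall>j\<in>quad_index S. multi_sums M (ord S (- S)) (?A S j) ?a (b S j) \<and> emb M (b S j) = \<beta> S j"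
      by (elim exE)
    have "l2norm M (b S j) = norm (\<beta> S j)" if "j \<in> quad_index S" for S j
    proof -
      note * = bspec[OF spec[OF b, of S] that]
      show ?thesis by (simp only: norm_emb[OF multi_sums_L2[OF conjunct1[OF *]], symmetric] conjunct2[OF *])
    qed
    then have "(\<lambda>(S, j). (l2norm M (b S j))\<^sup>2) summable_on (SIGMA S:UNIV. quad_index S)"
      using \<beta>(2) by (subst summable_on_cong[of _ _ "\<lambda>(S, j). (norm (\<beta> S j))\<^sup>2"]) auto
    with b show "\<exists>b. (\<forall>S. \<forall>j\<in>quad_index S. multi_sums M (ord S (- S)) (?A S j) ?a (b S j)) \<and>
      (\<lambda>(S, j). (l2norm M (b S j))\<^sup>2) summable_on (SIGMA S:UNIV. quad_index S)"
      by blast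
  qed
qed

section \<open>The representation of \<open>g\<^sub>S\<close>\<close>

lemma Uu_sum: "(\<And>i. i \<in> I \<Longrightarrow> f i \<in> L2_space M) \<Longrightarrow> Uu k (\<Sum>i\<in>I. f i) = (\<Sum>i\<in>I. Uu k (f i))"
  by (induction I rule: infinite_finite_induct) (auto simp: Uu_add hil_sum)

lemma Uu_sign: "x \<in> L2_space M \<Longrightarrow> Uu k ((- 1) ^ n *\<^sub>R x) = (- 1) ^ n *\<^sub>R Uu k x"
  using Uu_diff[of 0 x k] by (cases "even n") simp_all

text \<open>For fixed \<open>j\<close> and \<open>k = idx_P S S' j\<close>, the sum over
  \<open>i\<close> is \<open>U_k\<close> applied to a tail sum of the coefficients of
  \<open>f\<close>, hence a signed \<open>P_k g_S\<close>. As \<open>S'\<close> and \<open>j\<close>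
  vary, \<open>k\<close> runs once through the indices vanishing on \<open>S\<close>, and all other
  components of the regular function \<open>g_S\<close> are 0.\<close>

lemma g_formula_of_decomposition:
  assumes ord: "\<And>S S'. distinct (ord S S') \<and> set (ord S S') = UNIV"
    and f: "f \<in> L2 M" and mc: "mc_decomposition M T F f g" and reg: "\<And>S. regular M T F (g S)"
  shows "g_formula ord M T F f S (g S)"
proof -
  define G where "G = emb M (g S)"
  have g: "g S \<in> L2 M" using mc by (simp add: mc_decomposition_def)
  have G: "regX G" "G \<in> L2_space M" using reg[of S] regular_iff[OF g] g by (simp_all add: G_def)
  have dec: "decomposes (coef (emb M f)) (\<lambda>S. coef (emb M (g S)))"
    by (rule mc_decomposition_decomposes[OF f mc])
  have van: "PP k G = 0" if "q \<in> S" "k $ q \<noteq> 0" for k q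
  proof -
    have "vanishing_off S (coef G)" using dec by (simp add: decomposes_def G_def)
    then have "coef G k = 0" using that unfolding vanishing_off_def by blast
    then show ?thesis using Uu_coef[OF G(2), of k] by simp
  qed
  define J where "J S' = {j :: int ^ 'd::{finite,linorder}. (\<forall>r\<in>S. j $ r = 0) \<and> (\<forall>u\<in>S'. j $ u \<ge> 1) \<and> (\<forall>v\<in>- S - S'. j $ v \<ge> 0)}" for S'
  define K where "K S' = {k :: int ^ 'd::{finite,linorder}. (\<forall>q\<in>S. k $ q = 0) \<and> neg_part k = S'}" for S'
  let ?A = "\<lambda>S' q. if q \<in> S then UNIV else if q \<in> S' then {0..} else {1 :: int ..}"
  let ?a = "\<lambda>S' j i. Proj M T F (idx_P S S' j) (Uop T (idx_U S S' i) f)"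
  let ?n = "\<lambda>S'. card (- S - S')"
  have "\<exists>h. multi_sums M (ord S S') (?A S') (?a S' j) h \<and> emb M h = (- 1) ^ ?n S' *\<^sub>R PP (idx_P S S' j) G"
    if S': "S' \<subseteq> - S" and j: "j \<in> J S'" for S' j
  proof -
    define k where "k = idx_P S S' j"
    define e where "e q = (if q \<in> S \<union> S' then - 1 else 1 :: int)" for q
    \<comment> \<open>Chosen so that \<open>tail_point S S' j' = k\<close>: shifted to
      \<open>k\<close>, the ranges of \<open>i_u\<close> from 0 and of \<open>i_v\<close> from 1
      become \<open>Le (- j_u)\<close> and \<open>Ge (j_v + 1)\<close>.\<close>
    define j' where "j' = (\<chi> q. if q \<in> S then 0 else if q \<in> S' then j $ q else j $ q + 1)"
    have j': "j' \<in> tail_index S" using j by (auto simp: J_def tail_index_def j'_def)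
    have pt: "tail_point S S' j' = k"
      using S' by (auto simp: vec_eq_iff tail_point_def j'_def k_def idx_P_def)
    have range: "(\<lambda>q. (\<lambda>i. e q * i + k $ q) ` ?A S' q) = (\<lambda>q. index_set (tail_range S S' j' q))"
    proof
      fix q
      have im: "(\<lambda>i. - i + c) ` UNIV = UNIV" "(\<lambda>i. - i + c) ` {0..} = {..c}" "(\<lambda>i. i + c) ` {1..} = {c + 1..}"
        for c :: int
      proof -
        show "(\<lambda>i. - i + c) ` UNIV = UNIV" by (auto simp: image_iff; presburger)
        show "(\<lambda>i. - i + c) ` {0..} = {..c}" by (auto simp: image_iff; presburger)
        show "(\<lambda>i. i + c) ` {1..} = {c + 1..}"
          by (intro set_eqI iffI) (auto intro: image_eqI[of _ _ "x - c" for x])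
      qed
      show "(\<lambda>i. e q * i + k $ q) ` ?A S' q = index_set (tail_range S S' j' q)"
        using S' im(1)[of 0] im(2)[of "- (j $ q)"] im(3)[of "j $ q"]
        by (auto simp: e_def k_def idx_P_def tail_range_def j'_def simp del: add_uminus_conv_diff)
    qed
    have e1: "e q = 1 \<or> e q = - 1" for q by (simp add: e_def)
    have "niter (\<lambda>q. index_set (tail_range S S' j' q)) (coef (emb M f)) (ord S S') (\<chi> q. e q * 0 $ q + k $ q)
        ((- 1) ^ ?n S' *\<^sub>R coef G k)"
      using niter_decomp_tail[of "ord S S'" "\<lambda>S. coef (emb M (g S))" S' S j'] ord dec S' j'
      by (simp add: decomposes_def pt G_def)
    then have "niter (?A S') (\<lambda>i. coef (emb M f) (\<chi> q. e q * i $ q + k $ q)) (ord S S') 0 ((- 1) ^ ?n S' *\<^sub>R coef G k)"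
      by (intro niter_affine[where e = e and c = "\<lambda>q. k $ q", OF _ e1]) (simp only: range)
    moreover have "(\<chi> q. e q * i $ q + k $ q) = k - idx_U S S' i" for i
      by (simp add: vec_eq_iff e_def idx_U_def)
    ultimately have "niter (?A S') (\<lambda>i. coef (emb M f) (k - idx_U S S' i)) (ord S S') 0 ((- 1) ^ ?n S' *\<^sub>R coef G k)"
      by simp
    then have "niter (?A S') (\<lambda>i. Uu k (coef (emb M f) (k - idx_U S S' i))) (ord S S') 0
        (Uu k ((- 1) ^ ?n S' *\<^sub>R coef G k))"
      by (rule niter_map[OF closed_innovations subspace_innovations coef_in_innovations, rotated -1])
        (intro Uu_sum Uu_tendsto innovations_hil, assumption)+
    moreover have "Uu k ((- 1) ^ ?n S' *\<^sub>R coef G k) = (- 1) ^ ?n S' *\<^sub>R PP k G"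
      using G(2) by (simp add: Uu_sign innovations_hil[OF coef_in_innovations] Uu_coef)
    ultimately have "niter (?A S') (\<lambda>i. emb M (?a S' j i)) (ord S S') 0 ((- 1) ^ ?n S' *\<^sub>R PP k G)"
      by (simp add: emb_Proj_Uop[OF f] k_def)
    then show ?thesis
      unfolding multi_sums_def k_def
      by (intro niter_imp_iter_sums emb_Proj Uop_L2 f)
  qed
  then have "\<forall>S' j. \<exists>h. S' \<subseteq> - S \<longrightarrow> j \<in> J S' \<longrightarrow>
      multi_sums M (ord S S') (?A S') (?a S' j) h \<and> emb M h = (- 1) ^ ?n S' *\<^sub>R PP (idx_P S S' j) G"
    by blast
  then obtain h where h: "\<And>S' j. S' \<subseteq> - S \<Longrightarrow> j \<in> J S' \<Longrightarrow> multi_sums M (ord S S') (?A S') (?a S' j) (h S' j)"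
    "\<And>S' j. S' \<subseteq> - S \<Longrightarrow> j \<in> J S' \<Longrightarrow> emb M (h S' j) = (- 1) ^ ?n S' *\<^sub>R PP (idx_P S S' j) G"
    by (simp only: choice_iff) blast
  \<comment> \<open>The components of \<open>G\<close> with sign pattern \<open>S'\<close>, which
    \<open>synthesis\<close> assembles into \<open>Y S'\<close>.\<close>
  define c where "c S' k = (if k \<in> K S' then PP k G else 0)" for S' k
  have "\<exists>Y. (c S' has_sum Y) UNIV \<and> regX Y \<and> (\<forall>k. PP k Y = c S' k)" for S'
  proof -
    have "sqsum (c S')"
      using Bessel[OF G(2)] unfolding sqsum_def
      by (rule summable_on_comparison_test) (auto simp: c_def)
    moreover have "c S' k \<in> L2_space M" "PP k (c S' k) = c S' k" for k
      using G(2) by (auto simp: c_def PP_hil PP_PP oproj_zero[OF oproj_PP])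
    ultimately show ?thesis using synthesis[of "c S'"] by metis
  qed
  then obtain Y where Y: "\<And>S'. (c S' has_sum Y S') UNIV" "\<And>S'. regX (Y S')" "\<And>S' k. PP k (Y S') = c S' k"
    by metis
  have YH: "Y S' \<in> L2_space M" for S' using Y(2) by (simp add: regX_def)
  \<comment> \<open>The sign left by telescoping stays in \<open>u S'\<close> and cancels against
    the factor in the formula.\<close>
  have "\<exists>u. u \<in> L2 M \<and> emb M u = (- 1) ^ ?n S' *\<^sub>R Y S'" for S'
    using hil_scale[OF YH[of S']] by (metis L2_spaceE)
  then obtain u where u: "\<And>S'. u S' \<in> L2 M" "\<And>S'. emb M (u S') = (- 1) ^ ?n S' *\<^sub>R Y S'" by metis
  have sums: "l2_has_sum M (h S') (J S') (u S')" if S': "S' \<subseteq> - S" for S'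
  proof -
    have inj: "inj_on (idx_P S S') (J S')"
    proof (rule inj_onI)
      fix k l assume *: "k \<in> J S'" "l \<in> J S'" "idx_P S S' k = idx_P S S' l"
      have "k $ q = l $ q" for q
      proof -
        have "idx_P S S' k $ q = idx_P S S' l $ q" by (simp only: *(3))
        moreover have "q \<in> S \<Longrightarrow> k $ q = l $ q" using *(1,2) by (simp add: J_def)
        ultimately show ?thesis by (cases "q \<in> S"; cases "q \<in> S'") (simp_all add: idx_P_def)
      qed
      then show "k = l" by (simp add: vec_eq_iff)
    qed
    have img: "idx_P S S' ` J S' = K S'"
    proof (intro equalityI subsetI)
      fix k assume "k \<in> idx_P S S' ` J S'"
      then obtain j where j: "j \<in> J S'" "k = idx_P S S' j" by auto
      have "q \<in> neg_part k \<longleftrightarrow> q \<in> S'" for q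
      proof -
        have "q \<in> S' \<Longrightarrow> 1 \<le> j $ q" "q \<notin> S \<Longrightarrow> q \<notin> S' \<Longrightarrow> 0 \<le> j $ q" using j(1) by (auto simp: J_def)
        then show ?thesis using S' j(2) by (auto simp: neg_part_def idx_P_def)
      qed
      then show "k \<in> K S'" using j by (auto simp: K_def idx_P_def)
    next
      fix k assume k: "k \<in> K S'"
      then have neg: "k $ q < 0 \<longleftrightarrow> q \<in> S'" for q by (auto simp: K_def neg_part_def)
      have "idx_P S S' (idx_P S S' k) = k"
        using k by (auto simp: vec_eq_iff idx_P_def K_def)
      moreover have "idx_P S S' k \<in> J S'"
      proof -
        have "1 \<le> - (k $ q)" if "q \<in> S'" for q using neg[of q] that by simp
        moreover have "0 \<le> k $ q" if "q \<notin> S'" for q using neg[of q] that by simp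
        ultimately show ?thesis using S' by (auto simp: J_def idx_P_def)
      qed
      ultimately show "k \<in> idx_P S S' ` J S'" by (metis imageI)
    qed
    have "((\<lambda>k. PP k G) has_sum Y S') (idx_P S S' ` J S')"
      using Y(1)[of S'] unfolding img
      by (rule has_sum_cong_neutral[THEN iffD1, rotated -1]) (auto simp: c_def)
    then have "((\<lambda>j. PP (idx_P S S' j) G) has_sum Y S') (J S')"
      using inj by (simp add: has_sum_reindex comp_def)
    then have "((\<lambda>j. (- 1) ^ ?n S' *\<^sub>R PP (idx_P S S' j) G) has_sum (- 1) ^ ?n S' *\<^sub>R Y S') (J S')"
      by (cases "even (?n S')") (simp_all add: has_sum_uminus)
    then have "((\<lambda>j. emb M (h S' j)) has_sum emb M (u S')) (J S')"
      unfolding u(2) using h(2)[OF S'] by (simp cong: has_sum_cong)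
    moreover have "h S' j \<in> L2 M" if "j \<in> J S'" for j
      by (rule multi_sums_L2[OF h(1)[OF S' that]])
    ultimately show ?thesis using l2_has_sum_iff[of "J S'" "h S'" M "u S'"] u(1) by blast
  qed
  have total: "G = (\<Sum>S'\<in>Pow (- S). Y S')"
  proof -
    define Z where "Z = (\<Sum>S'\<in>Pow (- S). Y S')"
    have Z: "regX Z" unfolding Z_def by (intro regX_sum Y)
    have "PP k Z = PP k G" for k
    proof -
      have "PP k Z = (\<Sum>S'\<in>Pow (- S). c S' k)"
        unfolding Z_def by (simp add: oproj_sum[OF oproj_PP] YH Y(3))
      also have "\<dots> = PP k G"
      proof (cases "\<forall>q\<in>S. k $ q = 0")
        case True
        then have "neg_part k \<in> Pow (- S)" by (auto simp: neg_part_def)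
        moreover have "c S' k = (if S' = neg_part k then PP k G else 0)" for S'
          using True by (auto simp: c_def K_def)
        ultimately show ?thesis by simp
      next
        case False
        then have "PP k G = 0" using van by blast
        then have "\<forall>S'. c S' k = 0" by (simp add: c_def)
        with \<open>PP k G = 0\<close> show ?thesis by simp
      qed
      finally show ?thesis .
    qed
    moreover have "Z \<in> L2_space M" using Z by (simp add: regX_def)
    ultimately have "PP k (G - Z) = 0" for k using G(2) by (simp add: oproj_diff[OF oproj_PP])
    then have "G - Z = 0" by (rule regX_PP_zero[OF regX_diff[OF G(1) Z]])
    then show ?thesis by (simp add: Z_def)
  qed
  have "AE x in M. g S x = (\<Sum>S'\<in>Pow (- S). (- 1) ^ ?n S' * u S' x)"
  proof -
    have L: "(\<lambda>x. (- 1) ^ ?n S' * u S' x) \<in> L2 M" for S' by (rule L2_cmult[OF u(1)])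
    have "emb M (\<lambda>x. \<Sum>S'\<in>Pow (- S). (- 1) ^ ?n S' * u S' x) = (\<Sum>S'\<in>Pow (- S). emb M (\<lambda>x. (- 1) ^ ?n S' * u S' x))"
      by (rule emb_sum) (rule L)
    also have "\<dots> = (\<Sum>S'\<in>Pow (- S). Y S')"
      by (intro sum.cong refl) (simp add: emb_cmult u flip: power_mult_distrib)
    finally have "emb M (g S) = emb M (\<lambda>x. \<Sum>S'\<in>Pow (- S). (- 1) ^ ?n S' * u S' x)"
      using total by (simp add: G_def)
    moreover have "(\<lambda>x. \<Sum>S'\<in>Pow (- S). (- 1) ^ ?n S' * u S' x) \<in> L2 M"
      by (rule L2_sum) (rule L)
    ultimately show ?thesis using emb_eq_iff[OF g] by blast
  qed
  then show ?thesis
    unfolding g_formula_def Let_def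
    using h(1) sums by (intro exI[of _ u] conjI allI impI exI[of _ "h S'" for S'] ballI)
      (auto simp: J_def)
qed

end

theorem theorem2:
  fixes M :: "'a measure"
    and T :: "int ^ 'd::{finite,linorder} \<Rightarrow> 'a \<Rightarrow> 'a"
    and F :: "'a measure"
    and f :: "'a \<Rightarrow> real"
    and ord :: "'d set \<Rightarrow> 'd set \<Rightarrow> 'd list"
  assumes "completely_commuting_filtration M T F"
    and "f \<in> L2 M"
    and "regular M T F f"
    and "\<And>S S'. distinct (ord S S') \<and> set (ord S S') = UNIV"
  shows "((\<exists>g. mc_decomposition M T F f g) \<longleftrightarrow> condition_ii ord M T F f) \<and>
         (condition_ii ord M T F f \<longleftrightarrow> condition_iii ord M T F f) \<and>
         ((\<exists>g. mc_decomposition M T F f g) \<longrightarrow>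
            (\<exists>g. mc_decomposition M T F f g \<and> (\<forall>S. regular M T F (g S))) \<and>
            (\<forall>g. mc_decomposition M T F f g \<and> (\<forall>S. regular M T F (g S)) \<longrightarrow>
                 (\<forall>S. g_formula ord M T F f S (g S))))"
proof -
  interpret completely_commuting_filtration M T F by fact
  note f = assms(2) and ord = assms(4)
  have reg: "regX (emb M f)" using assms(3) regular_iff[OF f] by simp
  let ?a = "coef (emb M f)"
  \<comment> \<open>All implications pass through \<open>decomposes\<close>. Coming back from (ii)
    or (iii), the coefficients lie in \<open>innovations\<close>, so regular \<open>g S\<close> can
    be built; an arbitrary decomposition becomes regular by going to (ii) and back.\<close>
  have i_dec: "\<exists>b. decomposes ?a b" if "\<exists>g. mc_decomposition M T F f g"
    using that mc_decomposition_decomposes[OF f] by blast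
  have dec_i: "\<exists>g. mc_decomposition M T F f g \<and> (\<forall>S. regular M T F (g S))"
    if "\<exists>b. decomposes ?a b \<and> (\<forall>S k. b S k \<in> innovations)"
    using that decomposes_mc_decomposition[OF f reg] by blast
  have tail: "tail_condition ord ?a" "quad_condition ord ?a" if "\<exists>b. decomposes ?a b"
    using that decomposes_imp_tail[where ord = ord, OF ord] decomposes_imp_quad[where ord = ord, OF ord] by blast+
  have dec: "\<exists>b. decomposes ?a b \<and> (\<forall>S k. b S k \<in> innovations)" if "tail_condition ord ?a \<or> quad_condition ord ?a"
    using that tail_imp_decomposes[where ord = ord and a = ?a, OF ord _ closed_innovations subspace_innovations coef_in_innovations]
      quad_imp_decomposes[where ord = ord and a = ?a, OF ord _ closed_innovations subspace_innovations coef_in_innovations] by blast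
  have formula: "g_formula ord M T F f S (g S)" if "mc_decomposition M T F f g" "\<And>S. regular M T F (g S)" for g S
    by (rule g_formula_of_decomposition[where ord = ord, OF ord f that])
  show ?thesis
    unfolding condition_ii_iff[OF f] condition_iii_iff[OF f]
    using i_dec dec_i tail dec formula by blast
qed

end
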